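(* Let $n \in \{2,3\}$ and let $\Omega \subset \mathbb{R}^n$ be a domain. Let $f \in BV(\Omega, \mathbb{R}^n)$ be a sense-preserving homeomorphism. Then for $\mathcal{L}^n$-almost every $x_0 \in \Omega$ we have $J_f(x_0) \geq 0$.
   Context: A domain is a nonempty open connected set; $\mathcal{L}^n$ is Lebesgue measure. A homeomorphism $f:\Omega\to\mathbb{R}^n$ means a homeomorphism of $\Omega$ onto its image $f(\Omega)$. $BV(\Omega,\mathbb{R}^n)$ is the space of $f\in L^1(\Omega,\mathbb{R}^n)$ whose distributional derivative $Df$ is an $\mathbb{R}^{n\times n}$-valued Radon measure on $\Omega$ of finite total variation $|Df|(\Omega)<\infty$. Decompose $Df = D^a f + D^s f$ into its absolutely continuous and singular parts with respect to $\mathcal{L}^n$, and write $D^a f = \nabla f\,\mathcal{L}^n$ with $\nabla f \in L^1(\Omega,\mathbb{R}^{n\times n})$. The Jacobian is $J_f(x) = \det \nabla f(x)$, defined for $\mathcal{L}^n$-a.e. $x\in\Omega$. A homeomorphism $f:\Omega\to\mathbb{R}^n$ on a domain $\Omega$ is sense-preserving if its topological (Brouwer) degree satisfies $\deg(f, f(x), \Omega) = 1$ for every $x \in \Omega$, and sense-reversing if $\deg(f,f(x),\Omega) = -1$ for every $x\in\Omega$. (Since $f$ is injective, $\deg(f,f(x),\Omega)$ is understood as $\deg(f,f(x),U)$ for any open $U$ with $x\in U$ and $\overline{U}$ a compact subset of $\Omega$; it does not depend on $U$, and every homeomorphism on a domain is either sense-preserving or sense-reversing.) *)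

theory Defs
  imports "HOL-Analysis.Analysis"
begin

section \<open>Smooth functions and test functions\<close>

primrec Ck :: "nat \<Rightarrow> ('a::euclidean_space \<Rightarrow> 'b::real_normed_vector) \<Rightarrow> bool" where
  "Ck 0 f \<longleftrightarrow> continuous_on UNIV f"
| "Ck (Suc k) f \<longleftrightarrow>
     (\<forall>x. f differentiable (at x)) \<and> (\<forall>v. Ck k (\<lambda>x. frechet_derivative f (at x) v))"

definition smooth :: "('a::euclidean_space \<Rightarrow> 'b::real_normed_vector) \<Rightarrow> bool" where
  "smooth f \<longleftrightarrow> (\<forall>k. Ck k f)"

text \<open>\<open>C\<^sub>c\<^sup>\<infinity>(\<Omega>)\<close>, each test function being extended by zero to the whole space.\<close>

definition test_function :: "'a::euclidean_space set \<Rightarrow> ('a \<Rightarrow> real) \<Rightarrow> bool" where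
  "test_function \<Omega> \<phi> \<longleftrightarrow>
     smooth \<phi> \<and> compact (closure {x. \<phi> x \<noteq> 0}) \<and> closure {x. \<phi> x \<noteq> 0} \<subseteq> \<Omega>"

definition partial :: "'n \<Rightarrow> (real^'n \<Rightarrow> real) \<Rightarrow> real^'n \<Rightarrow> real" where
  "partial j \<phi> x = frechet_derivative \<phi> (at x) (axis j 1)"


section \<open>Vector-valued measures\<close>

text \<open>
  A vector-valued measure on an open set \<open>\<Omega>\<close> is a set function, of which only the values on
  the Borel subsets of \<open>\<Omega>\<close> matter. Being finite and Borel on an open subset of a Euclidean
  space, such measures are automatically Radon.
\<close>

definition borel_subsets :: "'a::topological_space set \<Rightarrow> 'a set set" where
  "borel_subsets \<Omega> = {B. B \<in> sets borel \<and> B \<subseteq> \<Omega>}"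

definition vector_measure ::
    "'a::topological_space set \<Rightarrow> ('a set \<Rightarrow> 'b::real_normed_vector) \<Rightarrow> bool" where
  "vector_measure \<Omega> \<mu> \<longleftrightarrow>
     (\<forall>A :: nat \<Rightarrow> 'a set. range A \<subseteq> borel_subsets \<Omega> \<and> disjoint_family A \<longrightarrow>
        (\<lambda>i. \<mu> (A i)) sums \<mu> (\<Union>i. A i))"

definition total_variation ::
    "('a::topological_space set \<Rightarrow> 'b::real_normed_vector) \<Rightarrow> 'a set \<Rightarrow> ennreal" where
  "total_variation \<mu> B =
     (SUP P \<in> {P. finite P \<and> P \<subseteq> borel_subsets B \<and> disjoint P \<and> \<Union>P = B}.
        \<Sum>A\<in>P. ennreal (norm (\<mu> A)))"

text \<open>
  The positive part in the Jordan decomposition of a real-valued measure \<open>\<nu>\<close>; the negative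
  part is the positive part of \<open>- \<nu>\<close>. Note that \<open>ennreal\<close> sends negative numbers to \<open>0\<close>.
\<close>

definition jordan_pos ::
    "'a::topological_space set \<Rightarrow> ('a set \<Rightarrow> real) \<Rightarrow> 'a measure" where
  "jordan_pos \<Omega> \<nu> =
     measure_of \<Omega> (borel_subsets \<Omega>) (\<lambda>B. SUP C \<in> borel_subsets B. ennreal (\<nu> C))"

definition signed_integral ::
    "'a::topological_space set \<Rightarrow> ('a set \<Rightarrow> real) \<Rightarrow> ('a \<Rightarrow> real) \<Rightarrow> real" where
  "signed_integral \<Omega> \<nu> \<phi> =
     (LINT x|jordan_pos \<Omega> \<nu>. \<phi> x) - (LINT x|jordan_pos \<Omega> (\<lambda>B. - \<nu> B). \<phi> x)"

definition singular_measure ::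
    "'a::euclidean_space set \<Rightarrow> ('a set \<Rightarrow> 'b::real_normed_vector) \<Rightarrow> bool" where
  "singular_measure \<Omega> \<mu> \<longleftrightarrow>
     vector_measure \<Omega> \<mu> \<and>
     (\<exists>N \<in> borel_subsets \<Omega>. emeasure lborel N = 0 \<and>
        (\<forall>B \<in> borel_subsets (\<Omega> - N). \<mu> B = 0))"


section \<open>Functions of bounded variation\<close>

text \<open>
  In the matrix \<open>\<mu> B\<close> the entry \<open>\<mu> B $ i $ j\<close> belongs to the \<open>j\<close>-th partial derivative of the
  \<open>i\<close>-th component of \<open>f\<close>. The norm on matrices entering \<open>total_variation\<close> is the Frobenius norm.
\<close>

definition distributional_derivative ::
    "(real^'n) set \<Rightarrow> (real^'n \<Rightarrow> real^'m) \<Rightarrow> ((real^'n) set \<Rightarrow> real^'n^'m) \<Rightarrow> bool" where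
  "distributional_derivative \<Omega> f \<mu> \<longleftrightarrow>
     vector_measure \<Omega> \<mu> \<and>
     (\<forall>\<phi> i j. test_function \<Omega> \<phi> \<longrightarrow>
        (LINT x:\<Omega>|lebesgue. f x $ i * partial j \<phi> x)
          = - signed_integral \<Omega> (\<lambda>B. \<mu> B $ i $ j) \<phi>)"

definition BV :: "(real^'n) set \<Rightarrow> (real^'n \<Rightarrow> real^'m) set" where
  "BV \<Omega> = {f. f absolutely_integrable_on \<Omega> \<and>
     (\<exists>\<mu>. distributional_derivative \<Omega> f \<mu> \<and> total_variation \<mu> \<Omega> < \<infinity>)}"

text \<open>
  \<open>G\<close> is a representative of the density \<open>\<nabla>f\<close> of the absolutely continuous part in the
  Lebesgue decomposition of \<open>Df\<close>. It is unique up to Lebesgue null sets, which is why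
  this is a predicate and not a function.
\<close>

definition BV_gradient ::
    "(real^'n) set \<Rightarrow> (real^'n \<Rightarrow> real^'m) \<Rightarrow> (real^'n \<Rightarrow> real^'n^'m) \<Rightarrow> bool" where
  "BV_gradient \<Omega> f G \<longleftrightarrow>
     G absolutely_integrable_on \<Omega> \<and>
     (\<exists>\<mu> \<mu>\<^sub>s. distributional_derivative \<Omega> f \<mu> \<and> singular_measure \<Omega> \<mu>\<^sub>s \<and>
        (\<forall>B \<in> borel_subsets \<Omega>. \<mu> B = (LINT x:B|lebesgue. G x) + \<mu>\<^sub>s B))"


section \<open>Topological degree\<close>

definition jacobian_det :: "(real^'n \<Rightarrow> real^'n) \<Rightarrow> real^'n \<Rightarrow> real" where
  "jacobian_det g x = det (matrix (frechet_derivative g (at x)))"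

text \<open>
  The analytic definition of the Brouwer degree, for bounded open \<open>U\<close>, \<open>f\<close> continuous on
  \<open>closure U\<close> and \<open>y \<notin> f ` frontier U\<close>: the common value of the sum of the signs of the
  Jacobian over the preimages of \<open>y\<close>, for all smooth \<open>g\<close> that have \<open>y\<close> as a regular value and
  are closer to \<open>f\<close> on \<open>closure U\<close> than the distance of \<open>y\<close> to \<open>f ` frontier U\<close>. For such \<open>g\<close>
  the preimage of \<open>y\<close> in \<open>U\<close> is finite, since it is discrete and \<open>g\<close> omits \<open>y\<close> on \<open>frontier U\<close>.
\<close>

definition degree_approximant ::
    "(real^'n \<Rightarrow> real^'n) \<Rightarrow> real^'n \<Rightarrow> (real^'n) set \<Rightarrow> (real^'n \<Rightarrow> real^'n) \<Rightarrow> bool" where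
  "degree_approximant f y U g \<longleftrightarrow>
     smooth g \<and>
     (\<forall>x \<in> closure U. dist (g x) (f x) < infdist y (f ` frontier U)) \<and>
     (\<forall>x \<in> U. g x = y \<longrightarrow> jacobian_det g x \<noteq> 0)"

definition topological_degree ::
    "(real^'n \<Rightarrow> real^'n) \<Rightarrow> real^'n \<Rightarrow> (real^'n) set \<Rightarrow> int" where
  "topological_degree f y U =
     (THE d. \<forall>g. degree_approximant f y U g \<longrightarrow>
        (\<Sum>x | x \<in> U \<and> g x = y. sgn (jacobian_det g x)) = real_of_int d)"

text \<open>
  For a homeomorphism \<open>f\<close> on \<open>\<Omega>\<close> the degree at \<open>f x\<close> does not depend on the neighbourhood \<open>U\<close>
  of \<open>x\<close>, and closed balls in \<open>\<Omega>\<close> show that such neighbourhoods exist.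
\<close>

definition sense_preserving :: "(real^'n) set \<Rightarrow> (real^'n \<Rightarrow> real^'n) \<Rightarrow> bool" where
  "sense_preserving \<Omega> f \<longleftrightarrow>
     (\<forall>x \<in> \<Omega>. \<forall>U. open U \<and> x \<in> U \<and> compact (closure U) \<and> closure U \<subseteq> \<Omega> \<longrightarrow>
        topological_degree f (f x) U = 1)"

end

theory Submission
  imports Defs "HOL-Computational_Algebra.Polynomial"
begin

text \<open>
  Let \<open>x\<^sub>0\<close> be a Lebesgue point of \<open>\<nabla>f\<close> at which the singular part of \<open>Df\<close> has density \<open>0\<close>, and put
  \<open>L = \<nabla>f(x\<^sub>0)\<close> with \<open>det L \<noteq> 0\<close>. The total variation of \<open>D(f - L)\<close> on a cube of side \<open>r\<close> around \<open>x\<^sub>0\<close>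
  is \<open>o(r\<^sup>n)\<close>, so averaging over translations yields a lattice of mesh comparable to \<open>r\<close> such that
  \<open>f - L\<close> oscillates by \<open>o(r)\<close> along its edges. After rescaling, let \<open>A\<close> and \<open>B\<close> map \<open>U\<close> into a
  neighbourhood of \<open>0\<close> so that \<open>A = B\<close> at \<open>0\<close> only, where \<open>A - B\<close> resembles the identity, while \<open>A\<close>
  and \<open>B\<close> map \<open>frontier U\<close> into edges: a square loop and a point for \<open>n = 2\<close>, two linked square loops for
  \<open>n = 3\<close>. As \<open>f\<close> is injective, \<open>f \<circ> A - f \<circ> B\<close> vanishes at \<open>0\<close> only, and a homotopy near \<open>0\<close> shows that its
  degree is that of \<open>f\<close>, namely \<open>1\<close>. On the other hand additive constants cancel in this difference, so on
  \<open>frontier U\<close> it is \<open>o(r)\<close>-close to \<open>L \<circ> (A - B)\<close>, whose degree is \<open>sgn (det L)\<close>.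
\<close>

section \<open>Smooth functions\<close>

text \<open>An L1 bound on a derivative controls oscillation in dimension one only; on surfaces of
  dimension two or more it gives no uniform bound. Boundary data for a degree argument can therefore
  be compared with those of \<open>L\<close> along edges, but not along a general frontier of
  dimension \<open>n - 1\<close>. For \<open>n = 2\<close> a loop is such a frontier. For
  \<open>n = 3\<close> the linking of two loops takes its place, since 1 + 1 = 3 - 1; two objects of
  dimension at most one reach no further, whence the restriction on \<open>n\<close>. The map
  \<open>f\<close> is merely continuous and \<open>Df\<close> is a measure, so integration along
  edges is carried out for a mollification. Its L1 bound does not depend on the mollification
  radius, which can thus be adapted to the modulus of continuity of \<open>f\<close>. The degree is
  defined by counting preimages of regular values. It is traded for the integral of
  \<open>bump (g x) * jacobian_det g x\<close>, because homotopy invariance of that integral is a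
  divergence identity, while additivity, linear maps and regular values are read off from
  it.\<close>

lemma Ck_SucI:
  assumes "\<And>x. (f has_derivative f' x) (at x)" "\<And>v. Ck k (\<lambda>x. f' x v)"
  shows "Ck (Suc k) f"
proof -
  have "frechet_derivative f (at x) = f' x" for x
    using frechet_derivative_at[OF assms(1)] by simp
  then show ?thesis
    using assms by (auto simp: differentiable_def)
qed

lemma Ck_Suc_has_derivative:
  assumes "Ck (Suc k) f"
  shows "(f has_derivative frechet_derivative f (at x)) (at x)"
  using assms by (simp add: frechet_derivative_works[symmetric])

lemma Ck_Suc_imp: "Ck (Suc k) f \<Longrightarrow> Ck k f"
proof (induction k arbitrary: f)
  case 0
  then show ?case
    by (auto simp: continuous_on_eq_continuous_at differentiable_imp_continuous_within)
next
  case (Suc k)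
  then show ?case by (metis Ck.simps(2))
qed

lemma Ck_continuous: "Ck k f \<Longrightarrow> continuous_on UNIV f"
  by (metis Ck.simps(1) Ck_Suc_imp not0_implies_Suc old.nat.exhaust nat_induct[of "\<lambda>k. Ck k f \<longrightarrow> Ck 0 f"])

lemma Ck_const [simp]: "Ck k (\<lambda>x. c)"
proof (induction k arbitrary: c)
  case (Suc k)
  show ?case by (rule Ck_SucI[where f' = "\<lambda>x v. 0"]) (use Suc in auto)
qed auto

lemma Ck_bounded_linear:
  assumes "bounded_linear h" "Ck k f"
  shows "Ck k (\<lambda>x. h (f x))"
  using assms(2)
proof (induction k arbitrary: f)
  case 0
  then show ?case using bounded_linear.continuous_on[OF assms(1)] by auto
next
  case (Suc k)
  show ?case
  proof (rule Ck_SucI)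
    show "((\<lambda>x. h (f x)) has_derivative (\<lambda>v. h (frechet_derivative f (at x) v))) (at x)" for x
      by (rule bounded_linear.has_derivative[OF assms(1) Ck_Suc_has_derivative[OF Suc.prems]])
  qed (use Suc in auto)
qed

lemma Ck_linear: "bounded_linear f \<Longrightarrow> Ck k f"
proof (cases k)
  case (Suc k)
  assume "bounded_linear f"
  then have "Ck (Suc k) f"
    by (intro Ck_SucI[where f' = "\<lambda>x. f"]) (auto intro: bounded_linear.has_derivative[of f "\<lambda>x. x" "\<lambda>x. x", simplified])
  then show ?thesis using Suc by simp
qed (auto intro: linear_continuous_on)

lemma Ck_add:
  assumes "Ck k f" "Ck k g"
  shows "Ck k (\<lambda>x. f x + g x)"
  using assms
proof (induction k arbitrary: f g)
  case 0
  then show ?case by (auto intro: continuous_intros)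
next
  case (Suc k)
  show ?case
  proof (rule Ck_SucI)
    show "((\<lambda>x. f x + g x) has_derivative
      (\<lambda>v. frechet_derivative f (at x) v + frechet_derivative g (at x) v)) (at x)" for x
      by (intro has_derivative_add Ck_Suc_has_derivative[OF Suc.prems(1)] Ck_Suc_has_derivative[OF Suc.prems(2)])
  qed (use Suc in auto)
qed

lemma Ck_bilinear:
  assumes "bounded_bilinear p" "Ck k f" "Ck k g"
  shows "Ck k (\<lambda>x. p (f x) (g x))"
  using assms(2,3)
proof (induction k arbitrary: f g)
  case 0
  then show ?case using bounded_bilinear.continuous_on[OF assms(1)] by auto
next
  case (Suc k)
  show ?case
  proof (rule Ck_SucI)
    show "((\<lambda>x. p (f x) (g x)) has_derivative
      (\<lambda>v. p (f x) (frechet_derivative g (at x) v) + p (frechet_derivative f (at x) v) (g x))) (at x)" for x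
      by (intro bounded_bilinear.FDERIV[OF assms(1)] Ck_Suc_has_derivative[OF Suc.prems(1)] Ck_Suc_has_derivative[OF Suc.prems(2)])
    show "Ck k (\<lambda>x. p (f x) (frechet_derivative g (at x) v) + p (frechet_derivative f (at x) v) (g x))" for v
      using Suc.prems Ck_Suc_imp[OF Suc.prems(1)] Ck_Suc_imp[OF Suc.prems(2)]
      by (intro Ck_add Suc.IH) auto
  qed
qed

lemmas Ck_mult = Ck_bilinear[OF bounded_bilinear_mult]

lemma Ck_sum: "(\<And>i. i \<in> I \<Longrightarrow> Ck k (f i)) \<Longrightarrow> Ck k (\<lambda>x. \<Sum>i\<in>I. f i x)"
  by (induction I rule: infinite_finite_induct) (auto intro: Ck_add)

lemma Ck_affine_compose:
  assumes "bounded_linear A" "Ck k f"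
  shows "Ck k (\<lambda>x. f (A x + b))"
  using assms(2)
proof (induction k arbitrary: f)
  case 0
  then show ?case
    using linear_continuous_on[OF assms(1)]
    by (auto intro!: continuous_intros continuous_on_compose2[of UNIV f])
next
  case (Suc k)
  show ?case
  proof (rule Ck_SucI)
    fix x
    have "((\<lambda>x. A x + b) has_derivative A) (at x)"
      using bounded_linear.has_derivative[OF assms(1) has_derivative_ident] by (auto intro!: derivative_eq_intros)
    then show "((\<lambda>x. f (A x + b)) has_derivative
      (\<lambda>v. frechet_derivative f (at (A x + b)) (A v))) (at x)"
      using has_derivative_compose[OF _ Ck_Suc_has_derivative[OF Suc.prems]] by blast
  qed (use Suc in auto)
qed

lemma smooth_Ck: "smooth f \<Longrightarrow> Ck k f"
  by (simp add: smooth_def)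

lemma smooth_has_derivative:
  "smooth f \<Longrightarrow> (f has_derivative frechet_derivative f (at x)) (at x)"
  using Ck_Suc_has_derivative[of 0] smooth_Ck by blast

lemma smooth_continuous: "smooth f \<Longrightarrow> continuous_on S f"
  using Ck_continuous smooth_Ck continuous_on_subset by blast

lemma smooth_frechet_derivative: "smooth f \<Longrightarrow> smooth (\<lambda>x. frechet_derivative f (at x) v)"
  unfolding smooth_def by (metis Ck.simps(2))

lemma real_polynomial_function_Ck:
  "real_polynomial_function f \<Longrightarrow> Ck k f"
  by (induction rule: real_polynomial_function.induct)
     (auto intro: Ck_linear Ck_add Ck_mult)

lemma polynomial_function_smooth:
  fixes f :: "'a::euclidean_space \<Rightarrow> 'b::euclidean_space"
  assumes "polynomial_function f"
  shows "smooth f"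
  unfolding smooth_def
proof
  fix k
  have "Ck k (\<lambda>x. \<Sum>b\<in>Basis. (f x \<bullet> b) *\<^sub>R b)"
  proof (intro Ck_sum)
    fix b :: 'b
    have "real_polynomial_function ((\<lambda>y. y \<bullet> b) \<circ> f)"
      using assms bounded_linear_inner_left unfolding polynomial_function_def by blast
    then have "Ck k (\<lambda>x. f x \<bullet> b)"
      by (auto simp: o_def dest: real_polynomial_function_Ck)
    then show "Ck k (\<lambda>x. (f x \<bullet> b) *\<^sub>R b)"
      using Ck_bounded_linear[OF bounded_linear_scaleR_left] by blast
  qed
  then show "Ck k f" by (simp add: euclidean_representation)
qed

section \<open>Symmetry of second derivatives\<close>

lemma second_difference_mean_value:
  fixes g :: "'a::euclidean_space \<Rightarrow> real"
  assumes g: "Ck 2 g" and h: "h > 0"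
  obtains s t where "0 < s" "s < h" "0 < t" "t < h"
    "g (x + h *\<^sub>R u + h *\<^sub>R v) - g (x + h *\<^sub>R u) - g (x + h *\<^sub>R v) + g x
      = h * h * frechet_derivative (\<lambda>x. frechet_derivative g (at x) u) (at (x + s *\<^sub>R u + t *\<^sub>R v)) v"
proof -
  let ?gu = "\<lambda>x. frechet_derivative g (at x) u"
  have g1: "(g has_derivative frechet_derivative g (at x)) (at x)" for x
    using Ck_Suc_has_derivative[of 1 g] g by (simp add: numeral_2_eq_2)
  have g2: "(?gu has_derivative frechet_derivative ?gu (at x)) (at x)" for x
    using Ck_Suc_has_derivative[of 0 ?gu] g by (simp add: numeral_2_eq_2)
  have line: "((\<lambda>s. k (y + s *\<^sub>R w)) has_field_derivative k' (y + s *\<^sub>R w) w) (at s)"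
    if "\<And>x. (k has_derivative k' x) (at x)" for k :: "'a \<Rightarrow> real" and k' y w s
  proof -
    have "((\<lambda>s. k (y + s *\<^sub>R w)) has_derivative (\<lambda>r. k' (y + s *\<^sub>R w) (r *\<^sub>R w))) (at s)"
      by (rule has_derivative_compose[OF _ that]) (auto intro!: derivative_eq_intros)
    moreover have "k' (y + s *\<^sub>R w) (r *\<^sub>R w) = k' (y + s *\<^sub>R w) w * r" for r
      using linear_cmul[OF has_derivative_linear[OF that]] by simp
    ultimately show ?thesis by (simp add: has_field_derivative_def)
  qed
  \<comment> \<open>The increment in direction \<open>v\<close> as a function of the step
    \<open>s\<close> in direction \<open>u\<close>. The mean value theorem is used once for
    \<open>\<phi>\<close> and once more, in direction \<open>v\<close>, for
    \<open>?gu\<close>.\<close>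
  define \<phi> where "\<phi> s = g ((x + h *\<^sub>R v) + s *\<^sub>R u) - g (x + s *\<^sub>R u)" for s
  have "\<exists>s. 0 < s \<and> s < h \<and> \<phi> h - \<phi> 0 = (h - 0) * (?gu ((x + h *\<^sub>R v) + s *\<^sub>R u) - ?gu (x + s *\<^sub>R u))"
    by (rule MVT2[OF h]) (unfold \<phi>_def, intro DERIV_diff line g1)
  then obtain s where s: "0 < s" "s < h"
    "\<phi> h - \<phi> 0 = h * (?gu ((x + h *\<^sub>R v) + s *\<^sub>R u) - ?gu (x + s *\<^sub>R u))" by auto
  have "\<exists>t. 0 < t \<and> t < h \<and> ?gu ((x + s *\<^sub>R u) + h *\<^sub>R v) - ?gu ((x + s *\<^sub>R u) + 0 *\<^sub>R v)
     = (h - 0) * frechet_derivative ?gu (at ((x + s *\<^sub>R u) + t *\<^sub>R v)) v"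
    by (rule MVT2[OF h]) (intro line g2)
  then obtain t where t: "0 < t" "t < h" "?gu ((x + s *\<^sub>R u) + h *\<^sub>R v) - ?gu (x + s *\<^sub>R u)
     = h * frechet_derivative ?gu (at ((x + s *\<^sub>R u) + t *\<^sub>R v)) v" by auto
  show ?thesis
    by (rule that[OF s(1,2) t(1,2)]) (use s(3) t(3) in \<open>simp add: \<phi>_def algebra_simps\<close>)
qed

text \<open>The second difference does not change when \<open>u\<close> and \<open>v\<close> are
  exchanged. Divided by \<open>h * h\<close> it is a value of each mixed derivative at points
  arbitrarily near \<open>x\<close>, so continuity forces the two to agree at
  \<open>x\<close>.\<close>

lemma frechet_derivative_symmetric_real:
  fixes g :: "'a::euclidean_space \<Rightarrow> real"
  assumes g: "Ck 2 g"
  shows "frechet_derivative (\<lambda>x. frechet_derivative g (at x) u) (at x) v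
       = frechet_derivative (\<lambda>x. frechet_derivative g (at x) v) (at x) u"
proof (rule ccontr)
  define D where "D u v x = frechet_derivative (\<lambda>x. frechet_derivative g (at x) u) (at x) v" for u v x
  assume "\<not> ?thesis"
  then have e: "\<bar>D u v x - D v u x\<bar> / 2 > 0" (is "?e > 0") by (simp add: D_def)
  have "continuous_on UNIV (D u v)" for u v
    using g Ck_continuous[of 0] by (simp add: numeral_2_eq_2 D_def[abs_def])
  then have "isCont (D u v) x" for u v
    by (simp add: continuous_on_eq_continuous_at)
  then obtain d1 d2 where d: "d1 > 0" "d2 > 0"
    "\<And>y. dist y x < d1 \<Longrightarrow> \<bar>D u v y - D u v x\<bar> < ?e"
    "\<And>y. dist y x < d2 \<Longrightarrow> \<bar>D v u y - D v u x\<bar> < ?e"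
    unfolding continuous_at_eps_delta dist_real_def using e by metis
  \<comment> \<open>All points \<open>x + s u + t v\<close> with \<open>s\<close> and
    \<open>t\<close> below \<open>h\<close> then lie within both continuity radii; the summand 1
    keeps the denominator positive even if \<open>u\<close> and \<open>v\<close> vanish.\<close>
  define h where "h = min d1 d2 / (norm u + norm v + 1)"
  have nn: "norm u + norm v + 1 > 0" by (smt (verit) norm_ge_zero)
  have h: "h > 0" unfolding h_def using d nn by simp
  have hd: "h * (norm u + norm v) < min d1 d2"
  proof -
    have "h * (norm u + norm v) < h * (norm u + norm v + 1)" using h by simp
    also have "\<dots> = min d1 d2" unfolding h_def using nn by simp
    finally show ?thesis .
  qed
  have close: "dist (x + s *\<^sub>R u + t *\<^sub>R v) x < min d1 d2" if "0 < s" "s < h" "0 < t" "t < h" for s t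
  proof -
    have "dist (x + s *\<^sub>R u + t *\<^sub>R v) x = norm (s *\<^sub>R u + t *\<^sub>R v)" by (simp add: dist_norm)
    also have "\<dots> \<le> s * norm u + t * norm v"
      using that by (metis abs_of_pos norm_scaleR norm_triangle_ineq)
    also have "\<dots> \<le> h * norm u + h * norm v"
      using that by (intro add_mono mult_right_mono) auto
    finally show ?thesis using hd by (simp add: algebra_simps)
  qed
  obtain s t where st: "0 < s" "s < h" "0 < t" "t < h"
    "g (x + h *\<^sub>R u + h *\<^sub>R v) - g (x + h *\<^sub>R u) - g (x + h *\<^sub>R v) + g x = h * h * D u v (x + s *\<^sub>R u + t *\<^sub>R v)"
    using second_difference_mean_value[OF g h] unfolding D_def by metis
  obtain s' t' where st': "0 < s'" "s' < h" "0 < t'" "t' < h"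
    "g (x + h *\<^sub>R v + h *\<^sub>R u) - g (x + h *\<^sub>R v) - g (x + h *\<^sub>R u) + g x = h * h * D v u (x + s' *\<^sub>R v + t' *\<^sub>R u)"
    using second_difference_mean_value[OF g h] unfolding D_def by metis
  have "h * h * D u v (x + s *\<^sub>R u + t *\<^sub>R v) = h * h * D v u (x + t' *\<^sub>R u + s' *\<^sub>R v)"
    using st(5) st'(5) by (simp add: algebra_simps)
  then have "D u v (x + s *\<^sub>R u + t *\<^sub>R v) = D v u (x + t' *\<^sub>R u + s' *\<^sub>R v)" using h by simp
  moreover have "\<bar>D u v (x + s *\<^sub>R u + t *\<^sub>R v) - D u v x\<bar> < ?e"
    by (rule d(3)) (use close[OF st(1-4)] in auto)
  moreover have "\<bar>D v u (x + t' *\<^sub>R u + s' *\<^sub>R v) - D v u x\<bar> < ?e"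
    by (rule d(4)) (use close[OF st'(3,4,1,2)] in auto)
  moreover have "\<bar>D u v x - D v u x\<bar> \<le> \<bar>D u v y - D u v x\<bar> + \<bar>D u v y - D v u x\<bar>" for y
    by linarith
  ultimately show False by (smt (verit) field_sum_of_halves)
qed

lemma frechet_derivative_symmetric:
  fixes g :: "'a::euclidean_space \<Rightarrow> 'b::euclidean_space"
  assumes g: "smooth g"
  shows "frechet_derivative (\<lambda>x. frechet_derivative g (at x) u) (at x) v
       = frechet_derivative (\<lambda>x. frechet_derivative g (at x) v) (at x) u"
proof (rule euclidean_eqI)
  fix b :: 'b
  have 1: "frechet_derivative (\<lambda>x. k x \<bullet> b) (at x) = (\<lambda>u. frechet_derivative k (at x) u \<bullet> b)"
    if "smooth k" for k :: "'a \<Rightarrow> 'b" and x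
    using frechet_derivative_at[OF bounded_linear.has_derivative[OF bounded_linear_inner_left smooth_has_derivative[OF that]]]
    by simp
  have "frechet_derivative (\<lambda>x. frechet_derivative g (at x) u) (at x) v \<bullet> b
     = frechet_derivative (\<lambda>x. frechet_derivative (\<lambda>x. g x \<bullet> b) (at x) u) (at x) v" for u v
    by (simp add: 1[OF g] 1[OF smooth_frechet_derivative[OF g]])
  moreover have "Ck 2 (\<lambda>x. g x \<bullet> b)"
    by (rule Ck_bounded_linear[OF bounded_linear_inner_left smooth_Ck[OF g]])
  ultimately show "frechet_derivative (\<lambda>x. frechet_derivative g (at x) u) (at x) v \<bullet> b
     = frechet_derivative (\<lambda>x. frechet_derivative g (at x) v) (at x) u \<bullet> b"
    using frechet_derivative_symmetric_real by metis
qed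

section \<open>A smooth bump function\<close>

definition flat_exp :: "real poly \<Rightarrow> real \<Rightarrow> real" where
  "flat_exp p t = (if t > 0 then poly p (1 / t) * exp (- (1 / t)) else 0)"

lemma poly_times_exp_uminus_tendsto_0:
  "((\<lambda>s. poly p s * exp (- s)) \<longlongrightarrow> (0::real)) at_top"
proof -
  have "((\<lambda>s. \<Sum>i\<le>degree p. coeff p i * (s ^ i / exp s)) \<longlongrightarrow> (\<Sum>i\<le>degree p. coeff p i * 0)) at_top"
    by (intro tendsto_sum tendsto_mult tendsto_const tendsto_power_div_exp_0)
  then show ?thesis
    by (simp add: poly_altdef sum_distrib_right exp_minus divide_inverse mult.assoc)
qed

text \<open>With \<open>s = 1 / t\<close> the chain rule produces the factor \<open>s^2\<close>,
  which is the polynomial \<open>[:0, 0, 1:]\<close>. The family is thus closed under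
  differentiation, and smoothness follows by an induction that treats all \<open>p\<close> at
  once.\<close>

lemma flat_exp_has_derivative:
  "(flat_exp p has_field_derivative flat_exp ([:0, 0, 1:] * (p - pderiv p)) t) (at t)"
proof -
  consider "t > 0" | "t < 0" | "t = 0" by linarith
  then show ?thesis
  proof cases
    case 1
    have "((\<lambda>t. poly p (1 / t) * exp (- (1 / t))) has_field_derivative
        flat_exp ([:0, 0, 1:] * (p - pderiv p)) t) (at t)"
      using 1 by (auto intro!: derivative_eq_intros DERIV_chain2[OF poly_DERIV]
        simp: flat_exp_def field_simps power2_eq_square)
    then show ?thesis
      by (rule has_field_derivative_transform_within_open[where S = "{0<..}"])
         (use 1 in \<open>auto simp: flat_exp_def\<close>)
  next
    case 2
    have "((\<lambda>t. 0) has_field_derivative flat_exp ([:0, 0, 1:] * (p - pderiv p)) t) (at t)"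
      using 2 by (simp add: flat_exp_def)
    then show ?thesis
      by (rule has_field_derivative_transform_within_open[where S = "{..<0}"])
         (use 2 in \<open>auto simp: flat_exp_def\<close>)
  next
    case 3
    \<comment> \<open>With \<open>s = 1 / h\<close> the right difference quotient at 0 is
      \<open>s * poly p s * exp (- s)\<close>; the extra factor \<open>s\<close> is the shift
      \<open>pCons 0 p\<close>.\<close>
    have "((\<lambda>h. poly (pCons 0 p) (inverse h) * exp (- inverse h)) \<longlongrightarrow> 0) (at_right 0)"
      by (rule filterlim_compose[OF poly_times_exp_uminus_tendsto_0 filterlim_inverse_at_top_right])
    moreover have "\<forall>\<^sub>F h in at_right 0. poly (pCons 0 p) (inverse h) * exp (- inverse h) = flat_exp p h / h"
      unfolding eventually_at_right_field by (auto intro!: exI[of _ 1] simp: flat_exp_def field_simps)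
    ultimately have r: "((\<lambda>h. flat_exp p h / h) \<longlongrightarrow> 0) (at_right 0)"
      by (rule Lim_transform_eventually)
    have "\<forall>\<^sub>F h in at_left 0. 0 = flat_exp p h / h"
      unfolding eventually_at_left_field by (auto intro!: exI[of _ "-1"] simp: flat_exp_def)
    then have l: "((\<lambda>h. flat_exp p h / h) \<longlongrightarrow> 0) (at_left 0)"
      by (rule Lim_transform_eventually[OF tendsto_const])
    have "(\<lambda>h. (flat_exp p (0 + h) - flat_exp p 0) / h) \<midarrow>0\<rightarrow> 0"
      using r l by (simp add: filterlim_split_at flat_exp_def)
    then show ?thesis using 3 by (simp add: DERIV_def flat_exp_def)
  qed
qed

lemma Ck_flat_exp: "Ck k (\<lambda>x::'a::euclidean_space. flat_exp p (1 - x \<bullet> x))"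
proof (induction k arbitrary: p)
  case 0
  have "continuous_on UNIV (flat_exp p)"
    using flat_exp_has_derivative DERIV_isCont continuous_at_imp_continuous_on by blast
  then show ?case by (auto intro!: continuous_intros continuous_on_compose2[of UNIV "flat_exp p"])
next
  case (Suc k)
  let ?q = "[:0, 0, 1:] * (p - pderiv p)"
  show ?case
  proof (rule Ck_SucI)
    fix x :: 'a
    have "((\<lambda>x. 1 - x \<bullet> x) has_derivative (\<lambda>v. - 2 * (x \<bullet> v))) (at x)"
      by (auto intro!: derivative_eq_intros simp: inner_commute)
    from has_derivative_compose[OF this flat_exp_has_derivative[unfolded has_field_derivative_def]]
    show "((\<lambda>x. flat_exp p (1 - x \<bullet> x)) has_derivative
        (\<lambda>v. flat_exp ?q (1 - x \<bullet> x) * (- 2 * (x \<bullet> v)))) (at x)" .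
  next
    fix v :: 'a
    have "bounded_linear (\<lambda>x::'a. - 2 * (x \<bullet> v))"
      by (intro bounded_linear_const_mult bounded_linear_inner_left)
    then show "Ck k (\<lambda>x. flat_exp ?q (1 - x \<bullet> x) * (- 2 * (x \<bullet> v)))"
      by (intro Ck_mult Suc Ck_linear)
  qed
qed

definition bump0 :: "'a::euclidean_space \<Rightarrow> real" where
  "bump0 x = flat_exp 1 (1 - x \<bullet> x)"

text \<open>The kernel serves twice: as a density of mass one in the degree integral and, rescaled,
  as a mollifier. The radius 1 of its support is the origin of the bound in all later conditions
  \<open>norm (g x) > 1\<close>.\<close>

definition bump :: "'a::euclidean_space \<Rightarrow> real" where
  "bump x = bump0 x / integral UNIV (bump0 :: 'a \<Rightarrow> real)"

lemma bump0_zero: "norm x \<ge> 1 \<Longrightarrow> bump0 x = 0"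
  by (simp add: bump0_def flat_exp_def dot_square_norm power_le_one_iff not_less one_le_power)

lemma bump0_nonneg: "bump0 x \<ge> 0"
  by (simp add: bump0_def flat_exp_def)

lemma bump0_continuous: "continuous_on S bump0"
  using Ck_continuous[OF Ck_flat_exp[of 0 1]] continuous_on_subset
  unfolding bump0_def[abs_def] by blast

text \<open>A bridge between the gauge integral, over a box or over the whole space, and the
  Lebesgue integral with respect to \<open>lborel\<close>. Any box that contains the support may be
  used.\<close>

lemma continuous_compact_support_integrable:
  fixes f :: "'a::euclidean_space \<Rightarrow> 'b::euclidean_space"
  assumes "continuous_on UNIV f" "\<And>x. x \<notin> cbox a b \<Longrightarrow> f x = 0"
  shows "f absolutely_integrable_on UNIV" "integrable lborel f"
    "integral UNIV f = integral (cbox a b) f" "integral\<^sup>L lborel f = integral UNIV f"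
proof -
  have f: "f absolutely_integrable_on cbox a b"
    using absolutely_integrable_continuous assms(1) continuous_on_subset by blast
  have eq: "(\<lambda>x. if x \<in> cbox a b then f x else 0) = f" using assms(2) by auto
  show 1: "f absolutely_integrable_on UNIV"
    using absolutely_integrable_restrict_UNIV[of "cbox a b" f] f eq by simp
  show 2: "integral UNIV f = integral (cbox a b) f"
    using integral_restrict_UNIV[of "cbox a b" f] eq by simp
  have m: "f \<in> borel_measurable borel"
    using assms(1) by (rule borel_measurable_continuous_onI)
  have "integrable lebesgue f" using 1 by (simp add: set_integrable_def)
  then show 3: "integrable lborel f" using m integrable_completion[of f lborel] by simp
  show "integral\<^sup>L lborel f = integral UNIV f"
    using has_integral_integral_lborel[OF 3] by (simp add: integral_unique)
qed

lemma norm_ge_1_of_notin_unit_cbox: "x \<notin> cbox (-One) (One::'a::euclidean_space) \<Longrightarrow> norm x \<ge> 1"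
proof -
  assume "x \<notin> cbox (-One) (One::'a)"
  then obtain i where i: "i \<in> Basis" "\<bar>x \<bullet> i\<bar> > 1" by (auto simp: mem_box abs_if; force)
  with Basis_le_norm[OF i(1), of x] show ?thesis by linarith
qed

lemma integral_bump0_pos: "integral UNIV (bump0::'a::euclidean_space \<Rightarrow> real) > 0"
proof -
  have eq: "integral UNIV (bump0::'a \<Rightarrow> real) = integral (cbox (-One) (One::'a)) bump0"
    by (rule continuous_compact_support_integrable(3)[OF bump0_continuous])
       (use norm_ge_1_of_notin_unit_cbox bump0_zero in blast)
  have "integral (cbox (-One) (One::'a)) bump0 \<noteq> 0"
  proof
    assume "integral (cbox (-One) (One::'a)) bump0 = 0"
    then have "(bump0 has_integral 0) (cbox (-One) (One::'a))"
      using integrable_continuous[OF bump0_continuous[of "cbox (-One) (One::'a)"]] by (metis integrable_integral)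
    then have "bump0 (0::'a) = 0"
      using has_integral_0_cbox_imp_0[OF bump0_continuous, of "-One" "One::'a" 0]
      by (auto simp: mem_box bump0_nonneg box_ne_empty)
    then show False by (simp add: bump0_def flat_exp_def)
  qed
  moreover have "integral (cbox (-One) (One::'a)) bump0 \<ge> 0"
    by (rule integral_nonneg) (auto intro: integrable_continuous bump0_continuous bump0_nonneg)
  ultimately show ?thesis unfolding eq by linarith
qed

lemma bump_zero: "norm x \<ge> 1 \<Longrightarrow> bump x = 0"
  by (simp add: bump_def bump0_zero)

lemma bump_nonneg: "bump (x::'a::euclidean_space) \<ge> 0"
  using integral_bump0_pos[where 'a='a] by (simp add: bump_def bump0_nonneg)

lemma bump_smooth: "smooth bump"
  unfolding smooth_def bump_def[abs_def] bump0_def divide_inverse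
  by (auto intro: Ck_mult Ck_flat_exp Ck_const)

lemma bump_integral: "integral\<^sup>L lborel (bump::'a::euclidean_space \<Rightarrow> real) = 1"
proof -
  have "integral\<^sup>L lborel (bump::'a \<Rightarrow> real) = integral UNIV (bump::'a \<Rightarrow> real)"
    by (rule continuous_compact_support_integrable(4)[of _ "-One" One, OF smooth_continuous[OF bump_smooth]])
       (use norm_ge_1_of_notin_unit_cbox bump_zero in blast)
  also have "\<dots> = 1"
    unfolding bump_def[abs_def] using integral_bump0_pos[where 'a='a] by simp
  finally show ?thesis .
qed

lemma bump_uminus: "bump (- x) = bump x"
  by (simp add: bump_def bump0_def)

section \<open>The integral formula for the degree\<close>

definition pd :: "'n \<Rightarrow> (real^'n \<Rightarrow> 'b::real_normed_vector) \<Rightarrow> real^'n \<Rightarrow> 'b" where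
  "pd j g x = frechet_derivative g (at x) (axis j 1)"

text \<open>The transpose puts the partial derivatives into the rows, so that the determinant can be
  handled by multilinearity, one direction of differentiation per row.\<close>

lemma jacobian_det_pd: "jacobian_det g x = det (\<chi> j. pd j g x)"
proof -
  have "matrix (frechet_derivative g (at x)) = transpose (\<chi> j. pd j g x)"
    by (simp add: matrix_def transpose_def pd_def)
  then show ?thesis by (simp add: jacobian_det_def)
qed

lemma pd_smooth: "smooth g \<Longrightarrow> smooth (pd j g)"
  unfolding pd_def[abs_def] by (rule smooth_frechet_derivative)

lemma pd_commute:
  fixes g :: "real^'n \<Rightarrow> 'b::euclidean_space"
  shows "smooth g \<Longrightarrow> pd i (pd j g) x = pd j (pd i g) x"
  unfolding pd_def[abs_def] by (rule frechet_derivative_symmetric)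

lemma pd_add_scaleR:
  assumes "smooth g" "smooth h"
  shows "pd i (\<lambda>x. g x + t *\<^sub>R h x) x = pd i g x + t *\<^sub>R pd i h x"
proof -
  have "((\<lambda>x. g x + t *\<^sub>R h x) has_derivative
    (\<lambda>v. frechet_derivative g (at x) v + t *\<^sub>R frechet_derivative h (at x) v)) (at x)"
    using smooth_has_derivative[OF assms(1)] smooth_has_derivative[OF assms(2)]
    by (auto intro!: derivative_eq_intros)
  from frechet_derivative_at[OF this] show ?thesis unfolding pd_def by metis
qed

lemma smooth_add_scaleR: "smooth g \<Longrightarrow> smooth h \<Longrightarrow> smooth (\<lambda>x. g x + t *\<^sub>R h x)"
  unfolding smooth_def by (auto intro!: Ck_add Ck_bounded_linear[OF bounded_linear_scaleR_right])

lemma has_vector_derivative_along_axis: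
  assumes "smooth g"
  shows "((\<lambda>s. g (x + s *\<^sub>R axis j 1)) has_vector_derivative pd j g (x + s *\<^sub>R axis j 1)) (at s)"
proof -
  have "((\<lambda>s. g (x + s *\<^sub>R axis j 1)) has_derivative
      (\<lambda>r. frechet_derivative g (at (x + s *\<^sub>R axis j 1)) (r *\<^sub>R axis j 1))) (at s)"
    by (rule has_derivative_compose[OF _ smooth_has_derivative[OF assms]]) (auto intro!: derivative_eq_intros)
  moreover have "frechet_derivative g (at y) (r *\<^sub>R axis j 1) = r *\<^sub>R pd j g y" for r y
    using linear_cmul[OF has_derivative_linear[OF smooth_has_derivative[OF assms]]] by (simp add: pd_def)
  ultimately show ?thesis by (simp add: has_vector_derivative_def)
qed

section \<open>Derivatives and row operations of determinants\<close>

lemma has_real_derivative_det_rows: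
  fixes r :: "'n::finite \<Rightarrow> real \<Rightarrow> real^'n"
  assumes "\<And>i. (r i has_vector_derivative r' i) (at t)"
  shows "((\<lambda>t. det (\<chi> i. r i t)) has_real_derivative
     (\<Sum>k\<in>UNIV. det (\<chi> i. if i = k then r' i else r i t))) (at t)"
proof -
  have d: "((\<lambda>t. r i t $ k) has_real_derivative r' i $ k) (at t)" for i k
    using bounded_linear.has_vector_derivative[OF bounded_linear_vec_nth assms]
    by (simp add: has_real_derivative_iff_has_vector_derivative)
  have "((\<lambda>t. det (\<chi> i. r i t)) has_real_derivative
     (\<Sum>p | p permutes (UNIV::'n set). of_int (sign p) *
        (\<Sum>k\<in>UNIV. r' k $ p k * (\<Prod>i\<in>UNIV - {k}. r i t $ p i)))) (at t)"
    unfolding det_def vec_lambda_beta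
    by (intro DERIV_sum DERIV_cmult has_field_derivative_prod) (rule d)
  also have "(\<Sum>p | p permutes (UNIV::'n set). of_int (sign p) *
        (\<Sum>k\<in>UNIV. r' k $ p k * (\<Prod>i\<in>UNIV - {k}. r i t $ p i)))
     = (\<Sum>k\<in>UNIV. det (\<chi> i. if i = k then r' i else r i t))"
  proof -
    have "r' k $ p k * (\<Prod>i\<in>UNIV - {k}. r i t $ p i) = (\<Prod>i\<in>UNIV. (if i = k then r' i else r i t) $ p i)" for p k
      by (subst prod.remove[of UNIV k]) (auto intro!: prod.cong)
    then show ?thesis
      unfolding det_def vec_lambda_beta sum_distrib_left by (subst sum.swap) simp
  qed
  finally show ?thesis .
qed

lemma det_swap_two_rows:
  fixes a :: "'n::finite \<Rightarrow> real^'n"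
  assumes "j \<noteq> k"
  shows "det (\<chi> i. if i = j then u else if i = k then v else a i)
       = - det (\<chi> i. if i = j then v else if i = k then u else a i)"
proof -
  let ?A = "\<chi> i. if i = j then v else if i = k then u else a i"
  have "(\<chi> i. if i = j then u else if i = k then v else a i) = (\<chi> i. ?A $ Transposition.transpose j k i)"
    using assms by (auto simp: vec_eq_iff Transposition.transpose_def)
  then show ?thesis
    using det_permute_rows[OF permutes_swap_id[of j UNIV k], of ?A] assms by (simp add: sign_swap_id)
qed

lemma det_row_scale:
  fixes a :: "'n::finite \<Rightarrow> real^'n"
  shows "det (\<chi> i. if i = k then c *\<^sub>R u else a i) = c * det (\<chi> i. if i = k then u else a i)"
  using det_row_mul[of k c "\<lambda>_. u" a] by (simp only: scalar_mult_eq_scaleR)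

lemma det_row_plus:
  fixes a :: "'n::finite \<Rightarrow> real^'n"
  shows "det (\<chi> i. if i = k then u + v else a i)
    = det (\<chi> i. if i = k then u else a i) + det (\<chi> i. if i = k then v else a i)"
  using det_row_add[of k "\<lambda>_. u" "\<lambda>_. v" a] by simp

text \<open>
  Both sides are the derivative at \<open>t = 0\<close> of \<open>det (A (I + t c h\<^sup>T))\<close>; for invertible \<open>A\<close>
  this is Cramer's rule.
\<close>

lemma sum_det_replace_row:
  fixes a :: "'n::finite \<Rightarrow> real^'n"
  shows "(\<Sum>j\<in>UNIV. (c \<bullet> a j) * det (\<chi> i. if i = j then h else a i)) = (c \<bullet> h) * det (\<chi> i. a i)"
proof -
  let ?A = "\<chi> i. a i" and ?B = "\<lambda>t. \<chi> i. axis i 1 + t *\<^sub>R (c $ i *\<^sub>R h)"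
  have r: "((\<lambda>t. x + t *\<^sub>R y) has_vector_derivative y) (at 0)" for x y :: "real^'n"
    by (auto intro!: derivative_eq_intros)
  have eq: "(\<chi> i. a i + t *\<^sub>R ((c \<bullet> a i) *\<^sub>R h)) = ?A ** ?B t" for t
  proof -
    have "(\<Sum>k\<in>UNIV. a i $ k * (axis k 1 $ j + t * (c $ k * h $ j)))
        = a i $ j + t * ((c \<bullet> a i) * h $ j)" for i j
      by (simp add: distrib_left sum.distrib axis_def if_distrib[of "\<lambda>x. _ * x"] inner_vec_def
          sum_distrib_left sum_distrib_right algebra_simps cong: if_cong)
    then show ?thesis
      by (simp only: vec_eq_iff matrix_matrix_mult_def vec_lambda_beta vector_add_component
          vector_scaleR_component real_scaleR_def simp_thms)
  qed
  have "((\<lambda>t. det (\<chi> i. a i + t *\<^sub>R ((c \<bullet> a i) *\<^sub>R h))) has_real_derivative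
     (\<Sum>k\<in>UNIV. det (\<chi> i. if i = k then (c \<bullet> a i) *\<^sub>R h else a i + 0 *\<^sub>R ((c \<bullet> a i) *\<^sub>R h)))) (at 0)"
    by (rule has_real_derivative_det_rows) (rule r)
  also have "(\<Sum>k\<in>UNIV. det (\<chi> i. if i = k then (c \<bullet> a i) *\<^sub>R h else a i + 0 *\<^sub>R ((c \<bullet> a i) *\<^sub>R h)))
     = (\<Sum>j\<in>UNIV. (c \<bullet> a j) * det (\<chi> i. if i = j then h else a i))"
  proof (intro sum.cong refl)
    fix k
    have "(\<chi> i. if i = k then (c \<bullet> a i) *\<^sub>R h else a i + 0 *\<^sub>R ((c \<bullet> a i) *\<^sub>R h))
        = (\<chi> i. if i = k then (c \<bullet> a k) *\<^sub>R h else a i)" by (simp add: vec_eq_iff)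
    then show "det (\<chi> i. if i = k then (c \<bullet> a i) *\<^sub>R h else a i + 0 *\<^sub>R ((c \<bullet> a i) *\<^sub>R h))
        = (c \<bullet> a k) * det (\<chi> i. if i = k then h else a i)" by (simp only: det_row_scale)
  qed
  finally have 1: "((\<lambda>t. det (?A ** ?B t)) has_real_derivative
     (\<Sum>j\<in>UNIV. (c \<bullet> a j) * det (\<chi> i. if i = j then h else a i))) (at 0)" by (simp only: eq)
  have "((\<lambda>t. det (?B t)) has_real_derivative
     (\<Sum>k\<in>UNIV. det (\<chi> i. if i = k then c $ i *\<^sub>R h else axis i 1 + 0 *\<^sub>R (c $ i *\<^sub>R h)))) (at 0)"
    by (rule has_real_derivative_det_rows) (rule r)
  also have "(\<Sum>k\<in>UNIV. det (\<chi> i. if i = k then c $ i *\<^sub>R h else axis i 1 + 0 *\<^sub>R (c $ i *\<^sub>R h))) = c \<bullet> h"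
  proof -
    have row: "row i (mat 1 :: real^'n^'n) = axis i 1" for i
      by (simp add: row_def mat_def axis_def vec_eq_iff eq_commute)
    have "(\<Sum>i\<in>UNIV. h $ i *s row i (mat 1 :: real^'n^'n)) = h"
      unfolding row by (rule basis_expansion)
    then have "det (\<chi> i. if i = k then h else axis i 1) = h $ k" for k
      using cramer_lemma_transpose[of k h "mat 1 :: real^'n^'n"] by (simp add: row cong: if_cong)
    moreover have "det (\<chi> i. if i = k then c $ i *\<^sub>R h else axis i 1 + 0 *\<^sub>R (c $ i *\<^sub>R h))
      = c $ k * det (\<chi> i. if i = k then h else axis i 1)" for k
    proof -
      have "(\<chi> i. if i = k then c $ i *\<^sub>R h else axis i 1 + 0 *\<^sub>R (c $ i *\<^sub>R h))
          = (\<chi> i. if i = k then c $ k *\<^sub>R h else axis i 1)" by (simp add: vec_eq_iff)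
      then show ?thesis by (simp only: det_row_scale)
    qed
    ultimately show ?thesis by (simp add: inner_vec_def)
  qed
  finally have "((\<lambda>t. det ?A * det (?B t)) has_real_derivative det ?A * (c \<bullet> h)) (at 0)"
    by (rule DERIV_cmult)
  then show ?thesis
    using DERIV_unique[OF 1] by (simp add: det_mul mult.commute)
qed

lemma continuous_on_det_rows:
  fixes r :: "'n::finite \<Rightarrow> 'a::topological_space \<Rightarrow> real^'n"
  assumes "\<And>i. continuous_on S (r i)"
  shows "continuous_on S (\<lambda>x. det (\<chi> i. r i x))"
  unfolding det_def vec_lambda_beta by (intro continuous_intros assms)

lemma lborel_integral_translate:
  fixes f :: "'a::euclidean_space \<Rightarrow> real"
  assumes "f \<in> borel_measurable borel"
  shows "integral\<^sup>L lborel (\<lambda>x. f (x + c)) = integral\<^sup>L lborel f"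
proof -
  have "integral\<^sup>L lborel f = integral\<^sup>L (distr lborel borel ((+) c)) f"
    by (simp add: lborel_distr_plus)
  also have "\<dots> = integral\<^sup>L lborel (\<lambda>x. f (c + x))"
    by (rule integral_distr) (use assms in auto)
  finally show ?thesis by (simp add: add.commute)
qed

text \<open>The integral of \<open>w\<close> over the whole space is unchanged when \<open>w\<close>
  is translated along \<open>v\<close>. Differentiating under the integral sign at shift 0 yields
  the integral of \<open>w'\<close>.\<close>

lemma integral_directional_derivative_eq_0:
  fixes w :: "'a::euclidean_space \<Rightarrow> real"
  assumes der: "\<And>x. ((\<lambda>s. w (x + s *\<^sub>R v)) has_real_derivative w' x) (at 0)"
    and w: "continuous_on UNIV w" and w': "continuous_on UNIV w'"
    and supp: "\<And>x. x \<notin> cbox a b \<Longrightarrow> w x = 0" "\<And>x. x \<notin> cbox a b \<Longrightarrow> w' x = 0"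
  shows "integral UNIV w' = 0"
proof -
  \<comment> \<open>One box that contains the supports of all translates by less than 1, so that the
    parameter integral has a fixed domain.\<close>
  have "bounded ((\<lambda>(s, y). y - s *\<^sub>R v) ` (cbox (-1) 1 \<times> cbox a b))"
    by (intro compact_imp_bounded compact_continuous_image compact_Times compact_cbox)
       (auto simp: case_prod_unfold intro!: continuous_intros)
  then obtain c where c: "(\<lambda>(s, y). y - s *\<^sub>R v) ` (cbox (-1) 1 \<times> cbox a b) \<subseteq> cbox (-c) c"
    using bounded_subset_cbox_symmetric by metis
  have out: "x + s *\<^sub>R v \<notin> cbox a b" if "x \<notin> cbox (-c) c" "s \<in> {-1<..<1}" for x s
  proof
    assume "x + s *\<^sub>R v \<in> cbox a b"
    then have "x \<in> (\<lambda>(s, y). y - s *\<^sub>R v) ` (cbox (-1) 1 \<times> cbox a b)"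
      using that(2) by (intro image_eqI[of _ _ "(s, x + s *\<^sub>R v)"]) auto
    then show False using c that(1) by blast
  qed
  have der': "((\<lambda>s. w (x + s *\<^sub>R v)) has_real_derivative w' (x + s *\<^sub>R v)) (at s)" for x s
    using DERIV_shift[of "\<lambda>s. w (x + s *\<^sub>R v)" "w' (x + s *\<^sub>R v)" 0 s] der[of "x + s *\<^sub>R v"]
    by (simp add: algebra_simps)
  have cc: "continuous_on S (\<lambda>x. w (x + s *\<^sub>R v))" for s S
    by (intro continuous_on_compose2[OF w] continuous_intros) auto
  have "((\<lambda>s. integral (cbox (-c) c) (\<lambda>x. w (x + s *\<^sub>R v))) has_real_derivative
      integral (cbox (-c) c) (\<lambda>x. w' (x + 0 *\<^sub>R v))) (at 0 within {-1<..<1})"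
  proof (rule leibniz_rule_field_derivative)
    show "continuous_on ({-1<..<1} \<times> cbox (-c) c) (\<lambda>(s, x). w' (x + s *\<^sub>R v))"
      unfolding case_prod_unfold by (intro continuous_on_compose2[OF w'] continuous_intros) auto
  qed (auto intro: DERIV_subset[OF der'] integrable_continuous cc)
  then have "((\<lambda>s. integral (cbox (-c) c) (\<lambda>x. w (x + s *\<^sub>R v))) has_real_derivative
      integral (cbox (-c) c) w') (at 0)"
    by (simp add: at_within_open[of 0 "{-1<..<1::real}"])
  moreover have "integral (cbox (-c) c) (\<lambda>x. w (x + s *\<^sub>R v)) = integral\<^sup>L lborel w" if "s \<in> {-1<..<1}" for s
  proof -
    have z: "w (x + s *\<^sub>R v) = 0" if "x \<notin> cbox (-c) c" for x
      using out[OF that \<open>s \<in> _\<close>] supp by blast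
    show ?thesis
      using continuous_compact_support_integrable(3,4)[OF cc z]
        lborel_integral_translate[OF borel_measurable_continuous_onI[OF w], of "s *\<^sub>R v"] by simp
  qed
  then have "((\<lambda>s. integral (cbox (-c) c) (\<lambda>x. w (x + s *\<^sub>R v))) has_real_derivative 0) (at 0)"
    by (intro has_field_derivative_transform_within_open[OF DERIV_const, of "{-1<..<1}"]) auto
  ultimately have "integral (cbox (-c) c) w' = 0" using DERIV_unique by blast
  moreover have "w' x = 0" if "x \<notin> cbox (-c) c" for x
    using out[of x 0] that supp(2)[of x] by simp
  ultimately show ?thesis using continuous_compact_support_integrable(3)[OF w'] by metis
qed

definition bump_grad :: "real^'n \<Rightarrow> real^'n" where
  "bump_grad y = (\<chi> i. pd i bump y)"

lemma frechet_derivative_bump: "frechet_derivative bump (at y) v = bump_grad y \<bullet> v"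
proof -
  have "linear (frechet_derivative bump (at y))"
    by (rule has_derivative_linear[OF smooth_has_derivative[OF bump_smooth]])
  then have "frechet_derivative bump (at y) (\<Sum>i\<in>UNIV. (v $ i) *\<^sub>R axis i 1) = (\<Sum>i\<in>UNIV. v $ i * pd i bump y)"
    by (simp add: linear_sum linear_cmul pd_def)
  then show ?thesis
    using basis_expansion[of v] by (simp add: inner_vec_def bump_grad_def scalar_mult_eq_scaleR mult.commute)
qed

lemma bump_grad_zero: "norm y > 1 \<Longrightarrow> bump_grad y = 0"
proof -
  assume y: "norm y > 1"
  have o: "open {x::real^'n. 1 < norm x}" by (intro open_Collect_less continuous_intros)
  have "(bump has_derivative (\<lambda>_. 0)) (at y)"
    by (rule has_derivative_transform_within_open[OF has_derivative_const o]) (use y in \<open>auto simp: bump_zero\<close>)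
  then have "frechet_derivative bump (at y) = (\<lambda>_. 0)" by (metis frechet_derivative_at)
  then show ?thesis by (simp add: bump_grad_def pd_def vec_eq_iff)
qed

lemma bump_grad_continuous: "continuous_on S (bump_grad :: real^'n \<Rightarrow> real^'n)"
  unfolding bump_grad_def[abs_def]
  by (intro continuous_on_vec_lambda smooth_continuous pd_smooth bump_smooth)

lemma bump_along_axis:
  assumes "smooth g"
  shows "((\<lambda>s. bump (g (x + s *\<^sub>R axis j 1))) has_real_derivative bump_grad (g x) \<bullet> pd j g x) (at 0)"
proof -
  have "((\<lambda>s. bump (g (x + s *\<^sub>R axis j 1))) has_derivative
      (\<lambda>r. frechet_derivative bump (at (g (x + 0 *\<^sub>R axis j 1))) (r *\<^sub>R pd j g (x + 0 *\<^sub>R axis j 1)))) (at 0)"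
    by (rule has_derivative_compose[OF has_vector_derivative_along_axis[OF assms, unfolded has_vector_derivative_def]
          smooth_has_derivative[OF bump_smooth]])
  then show ?thesis
    by (simp add: frechet_derivative_bump has_field_derivative_def mult.commute[of _ "_ \<bullet> _"])
qed

text \<open>Pasting along two closed sets, over \<open>closure U\<close> and over the complement of
  \<open>U\<close>; they overlap over \<open>frontier U\<close>, where \<open>k\<close> vanishes.
  The projection \<open>P\<close> is the identity for functions of a point and \<open>snd\<close>
  for functions of a homotopy parameter and a point.\<close>

lemma continuous_on_extend_zero:
  fixes k :: "'a::topological_space \<Rightarrow> 'b::real_normed_vector"
  assumes "continuous_on T k" "closed T" "closed (T \<inter> P -` closure U)" "closed (T \<inter> P -` (- U))"
    "\<And>z. z \<in> T \<Longrightarrow> P z \<in> frontier U \<Longrightarrow> k z = 0" "open U"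
  shows "continuous_on T (\<lambda>z. if P z \<in> U then k z else 0)"
proof -
  have "continuous_on ((T \<inter> P -` closure U) \<union> (T \<inter> P -` (- U))) (\<lambda>z. if P z \<in> closure U \<and> P z \<in> U then k z else 0)"
  proof (rule continuous_on_subset[where s = "(T \<inter> P -` closure U) \<union> (T \<inter> P -` (- U))"])
    show "continuous_on ((T \<inter> P -` closure U) \<union> (T \<inter> P -` (- U)))
       (\<lambda>z. if P z \<in> closure U \<and> P z \<in> U then k z else 0)"
    proof (rule continuous_on_closed_Un[OF assms(3,4)])
      have *: "(if P z \<in> closure U \<and> P z \<in> U then k z else 0) = k z" if "z \<in> T \<inter> P -` closure U" for z
        using that assms(5)[of z] assms(6) by (auto simp: frontier_def interior_open)
      show "continuous_on (T \<inter> P -` closure U) (\<lambda>z. if P z \<in> closure U \<and> P z \<in> U then k z else 0)"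
        using continuous_on_subset[OF assms(1), of "T \<inter> P -` closure U"]
        by (subst continuous_on_cong[OF refl *]) auto
      show "continuous_on (T \<inter> P -` (- U)) (\<lambda>z. if P z \<in> closure U \<and> P z \<in> U then k z else 0)"
        by (subst continuous_on_cong[OF refl, where g = "\<lambda>_. 0"]) auto
    qed
  qed simp
  moreover have "(T \<inter> P -` closure U) \<union> (T \<inter> P -` (- U)) = T"
    using closure_subset by auto
  moreover have "(\<lambda>z. if P z \<in> closure U \<and> P z \<in> U then k z else 0) = (\<lambda>z. if P z \<in> U then k z else 0)"
    using closure_subset by (auto simp: fun_eq_iff)
  ultimately show ?thesis by (simp only:)
qed

lemma continuous_on_extend_zero_UNIV:
  fixes k :: "'a::euclidean_space \<Rightarrow> 'b::real_normed_vector"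
  assumes "continuous_on UNIV k" "\<And>z. z \<in> frontier U \<Longrightarrow> k z = 0" "open U"
  shows "continuous_on UNIV (\<lambda>z. if z \<in> U then k z else 0)"
  by (rule continuous_on_extend_zero[where P = "\<lambda>x. x" and T = UNIV])
     (simp_all add: assms closed_Compl)

text \<open>
  The integrand is the divergence of the field whose \<open>j\<close>-th component is the Jacobian
  determinant of \<open>G\<close> with its \<open>j\<close>-th row replaced by \<open>bump (G x) h x\<close>: the terms with second
  derivatives of \<open>G\<close> cancel in pairs.
\<close>

lemma integral_jacobian_variation_eq_0:
  fixes G h :: "real^'n \<Rightarrow> real^'n"
  assumes G: "smooth G" and h: "smooth h" and U: "open U" "bounded U"
    and bd: "\<And>x. x \<in> frontier U \<Longrightarrow> norm (G x) > 1"
  shows "integral UNIV (\<lambda>x. if x \<in> U then (bump_grad (G x) \<bullet> h x) * det (\<chi> i. pd i G x)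
      + bump (G x) * (\<Sum>k\<in>UNIV. det (\<chi> i. if i = k then pd i h x else pd i G x)) else 0) = 0"
proof -
  define R where "R j i x = (if i = j then bump (G x) *\<^sub>R h x else pd i G x)" for i j x
  define R' where "R' j k x = (if k = j then bump (G x) *\<^sub>R pd j h x + (bump_grad (G x) \<bullet> pd j G x) *\<^sub>R h x
      else pd j (pd k G) x)" for j k x
  define W where "W j x = det (\<chi> i. R j i x)" for j x
  define W' where "W' j x = (\<Sum>k\<in>UNIV. det (\<chi> i. if i = k then R' j i x else R j i x))" for j x
  obtain a where a: "U \<subseteq> cbox (-a) a" using U bounded_subset_cbox_symmetric by blast
  have cont: "continuous_on S G" "continuous_on S h" "continuous_on S (pd i G)" "continuous_on S (pd i h)"
    "continuous_on S (pd i (pd j G))" "continuous_on S (\<lambda>x. bump (G x))" "continuous_on S (\<lambda>x. bump_grad (G x))" for i j S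
    using G h smooth_continuous[OF G, of S]
    by (auto intro: smooth_continuous pd_smooth continuous_on_compose2[OF smooth_continuous[OF bump_smooth, of UNIV]]
      continuous_on_compose2[OF bump_grad_continuous[of UNIV]])
  have cR: "continuous_on S (R j i)" for S j i
    unfolding R_def[abs_def] by (cases "i = j") (auto intro!: continuous_intros cont)
  have cR': "continuous_on S (R' j i)" for S j i
    unfolding R'_def[abs_def] by (cases "i = j") (auto intro!: continuous_intros cont)
  have cW: "continuous_on S (W j)" for S j
    unfolding W_def[abs_def] by (intro continuous_on_det_rows cR)
  have cW': "continuous_on S (W' j)" for S j
    unfolding W'_def[abs_def]
  proof (intro continuous_on_sum continuous_on_det_rows)
    show "continuous_on S (\<lambda>x. if i = k then R' j i x else R j i x)" for i k
      by (cases "i = k") (simp_all add: cR cR')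
  qed
  have dW: "((\<lambda>s. W j (x + s *\<^sub>R axis j 1)) has_real_derivative W' j x) (at 0)" for j x
  proof -
    have "((\<lambda>s. R j i (x + s *\<^sub>R axis j 1)) has_vector_derivative R' j i x) (at 0)" for i
    proof (cases "i = j")
      case True
      have "((\<lambda>s. bump (G (x + s *\<^sub>R axis j 1)) *\<^sub>R h (x + s *\<^sub>R axis j 1)) has_vector_derivative
        bump (G (x + 0 *\<^sub>R axis j 1)) *\<^sub>R pd j h (x + 0 *\<^sub>R axis j 1) + (bump_grad (G x) \<bullet> pd j G x) *\<^sub>R h (x + 0 *\<^sub>R axis j 1)) (at 0)"
        by (intro has_vector_derivative_scaleR bump_along_axis G has_vector_derivative_along_axis h)
      then show ?thesis using True by (simp add: R_def R'_def)
    next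
      case False
      then show ?thesis
        using has_vector_derivative_along_axis[OF pd_smooth[OF G, of i], of x j 0] by (simp add: R_def R'_def)
    qed
    from has_real_derivative_det_rows[where r = "\<lambda>i s. R j i (x + s *\<^sub>R axis j 1)", OF this]
    show ?thesis unfolding W_def W'_def by (simp only: scaleR_zero_left add_0_right)
  qed
  have W0: "W j x = 0" if "norm (G x) \<ge> 1" for j x
  proof -
    have "row j (\<chi> i. R j i x) = 0" using that by (simp add: row_def R_def bump_zero vec_eq_iff)
    then show ?thesis unfolding W_def by (rule det_zero_row(1))
  qed
  have W'0: "W' j x = 0" if "norm (G x) > 1" for j x
  proof -
    have "row j (\<chi> i. if i = k then R' j i x else R j i x) = 0" for k
      using that by (simp add: row_def R_def R'_def bump_zero vec_eq_iff bump_grad_zero)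
    then have "det (\<chi> i. if i = k then R' j i x else R j i x) = 0" for k
      by (rule det_zero_row(1))
    then show ?thesis unfolding W'_def by simp
  qed
  \<comment> \<open>Every point off \<open>U\<close> has a neighbourhood on which the extension of
    \<open>W j\<close> by zero vanishes: either it avoids \<open>closure U\<close>, or
    \<open>norm (G y) > 1\<close> persists there. So the extension is differentiable along the axis
    even at frontier points.\<close>
  define O' where "O' = {y. norm (G y) > 1} \<union> - closure U"
  have O': "open O'" unfolding O'_def
    by (intro open_Un open_Collect_less continuous_intros cont) auto
  have OU: "x \<in> O'" if "x \<notin> U" for x
    using that bd[of x] U by (auto simp: O'_def frontier_def interior_open)
  have WO: "(if y \<in> U then W j y else 0) = 0" if "y \<in> O'" for y j
    using that W0[of y j] closure_subset[of U] by (auto simp: O'_def)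
  have line: "open {s. x + s *\<^sub>R v \<in> A}" if "open A" for A and x v :: "real^'n"
  proof -
    have "continuous_on UNIV (\<lambda>s. x + s *\<^sub>R v)" by (intro continuous_intros)
    from open_vimage[OF that this] show ?thesis by (simp add: vimage_def)
  qed
  have zero: "integral UNIV (\<lambda>x. if x \<in> U then W' j x else 0) = 0" for j
  proof (rule integral_directional_derivative_eq_0[where w = "\<lambda>x. if x \<in> U then W j x else 0" and v = "axis j 1"])
    fix x
    show "((\<lambda>s. if x + s *\<^sub>R axis j 1 \<in> U then W j (x + s *\<^sub>R axis j 1) else 0) has_real_derivative
          (if x \<in> U then W' j x else 0)) (at 0)"
    proof (cases "x \<in> U")
      case True
      show ?thesis
        by (rule has_field_derivative_transform_within_open[OF _ line[OF U(1), of x "axis j 1"]])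
           (use True dW[of j x] in auto)
    next
      case False
      have "((\<lambda>s. 0::real) has_real_derivative 0) (at 0)" by simp
      then have "((\<lambda>s. if x + s *\<^sub>R axis j 1 \<in> U then W j (x + s *\<^sub>R axis j 1) else 0) has_real_derivative 0) (at 0)"
        by (rule has_field_derivative_transform_within_open[OF _ line[OF O', of x "axis j 1"]])
           (use OU[OF False] WO in auto)
      then show ?thesis using False by simp
    qed
  next
    show "continuous_on UNIV (\<lambda>x. if x \<in> U then W j x else 0)"
      by (rule continuous_on_extend_zero_UNIV[OF cW _ U(1)]) (rule W0[OF less_imp_le[OF bd]])
    show "continuous_on UNIV (\<lambda>x. if x \<in> U then W' j x else 0)"
      by (rule continuous_on_extend_zero_UNIV[OF cW' _ U(1)]) (rule W'0[OF bd])
  qed (use a in auto)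
  have sum: "(\<Sum>j\<in>UNIV. W' j x) = (bump_grad (G x) \<bullet> h x) * det (\<chi> i. pd i G x)
      + bump (G x) * (\<Sum>k\<in>UNIV. det (\<chi> i. if i = k then pd i h x else pd i G x))" for x
  proof -
    define T where "T j k = det (\<chi> i. if i = k then R' j i x else R j i x)" for j k
    define S where "S j k = det (\<chi> i. if i = j then h x else if i = k then pd j (pd k G) x else pd i G x)" for j k
    have diag: "T j j = bump (G x) * det (\<chi> i. if i = j then pd i h x else pd i G x)
        + (bump_grad (G x) \<bullet> pd j G x) * det (\<chi> i. if i = j then h x else pd i G x)" for j
    proof -
      have "(\<chi> i. if i = j then R' j i x else R j i x)
         = (\<chi> i. if i = j then bump (G x) *\<^sub>R pd j h x + (bump_grad (G x) \<bullet> pd j G x) *\<^sub>R h x else pd i G x)"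
        by (simp add: vec_eq_iff R'_def R_def)
      moreover have "(\<chi> i. if i = j then pd j h x else pd i G x) = (\<chi> i. if i = j then pd i h x else pd i G x)"
        by (simp add: vec_eq_iff)
      ultimately show ?thesis
        unfolding T_def by (simp only: det_row_plus det_row_scale)
    qed
    have off: "T j k = bump (G x) * S j k" if "j \<noteq> k" for j k
    proof -
      have "(\<chi> i. if i = k then R' j i x else R j i x)
         = (\<chi> i. if i = j then bump (G x) *\<^sub>R h x else if i = k then pd j (pd k G) x else pd i G x)"
        using that by (simp add: vec_eq_iff R'_def R_def)
      then show ?thesis unfolding T_def S_def by (simp only: det_row_scale)
    qed
    have anti: "S j k = - S k j" if "j \<noteq> k" for j k
    proof -
      have "S j k = - det (\<chi> i. if i = j then pd j (pd k G) x else if i = k then h x else pd i G x)"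
        unfolding S_def by (rule det_swap_two_rows[OF that])
      also have "(\<chi> i. if i = j then pd j (pd k G) x else if i = k then h x else pd i G x)
         = (\<chi> i. if i = k then h x else if i = j then pd k (pd j G) x else pd i G x)"
        using that pd_commute[OF G, of j k x] by (auto simp: vec_eq_iff)
      finally show ?thesis unfolding S_def .
    qed
    \<comment> \<open>Clearing the diagonal makes the array antisymmetric without exception, so that
      its double sum equals its own negative.\<close>
    define S0 where "S0 j k = (if j = k then 0 else S j k)" for j k
    have S0_anti: "S0 j k = - S0 k j" for j k using anti[of j k] by (cases "j = k") (simp_all add: S0_def)
    have "(\<Sum>j\<in>UNIV. \<Sum>k\<in>UNIV. S0 j k) = (\<Sum>j\<in>UNIV. \<Sum>k\<in>UNIV. - S0 k j)"
      by (intro sum.cong refl S0_anti)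
    also have "\<dots> = - (\<Sum>j\<in>UNIV. \<Sum>k\<in>UNIV. S0 k j)"
      by (simp only: sum_negf)
    finally have "(\<Sum>j\<in>UNIV. \<Sum>k\<in>UNIV. S0 j k) = - (\<Sum>j\<in>UNIV. \<Sum>k\<in>UNIV. S0 k j)" .
    moreover have "(\<Sum>j\<in>UNIV. \<Sum>k\<in>UNIV. S0 k j) = (\<Sum>j\<in>UNIV. \<Sum>k\<in>UNIV. S0 j k)" by (rule sum.swap)
    ultimately have S0: "(\<Sum>j\<in>UNIV. \<Sum>k\<in>UNIV. S0 j k) = 0" by simp
    have T: "T j k = (if j = k then T j j else 0) + bump (G x) * S0 j k" for j k
      using off by (auto simp: S0_def)
    have "(\<Sum>j\<in>UNIV. W' j x) = (\<Sum>j\<in>UNIV. \<Sum>k\<in>UNIV. T j k)"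
      by (simp only: W'_def T_def)
    also have "\<dots> = (\<Sum>j\<in>UNIV. \<Sum>k\<in>UNIV. (if j = k then T j j else 0) + bump (G x) * S0 j k)"
      by (intro sum.cong refl T)
    also have "\<dots> = (\<Sum>j\<in>UNIV. T j j) + bump (G x) * (\<Sum>j\<in>UNIV. \<Sum>k\<in>UNIV. S0 j k)"
      by (simp add: sum.distrib sum_distrib_left)
    also have "\<dots> = (\<Sum>j\<in>UNIV. T j j)" unfolding S0 by simp
    also have "\<dots> = bump (G x) * (\<Sum>k\<in>UNIV. det (\<chi> i. if i = k then pd i h x else pd i G x))
        + (\<Sum>j\<in>UNIV. (bump_grad (G x) \<bullet> pd j G x) * det (\<chi> i. if i = j then h x else pd i G x))"
      unfolding diag sum.distrib sum_distrib_left ..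
    finally show ?thesis
      unfolding sum_det_replace_row[of "bump_grad (G x)" "\<lambda>j. pd j G x" "h x"] by (rule trans[OF _ add.commute])
  qed
  have int: "(\<lambda>x. if x \<in> U then W' j x else 0) integrable_on UNIV" for j
  proof -
    have "continuous_on UNIV (\<lambda>x. if x \<in> U then W' j x else 0)"
      by (rule continuous_on_extend_zero_UNIV[OF cW' _ U(1)]) (rule W'0[OF bd])
    then have "(\<lambda>x. if x \<in> U then W' j x else 0) absolutely_integrable_on UNIV"
      by (rule continuous_compact_support_integrable(1)) (use a in auto)
    then show ?thesis by (simp add: absolutely_integrable_on_def)
  qed
  have "integral UNIV (\<lambda>x. if x \<in> U then (\<Sum>j\<in>UNIV. W' j x) else 0)
      = integral UNIV (\<lambda>x. \<Sum>j\<in>UNIV. if x \<in> U then W' j x else 0)"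
    by (rule integral_cong) auto
  also have "\<dots> = 0"
    by (subst integral_sum) (use int zero in auto)
  finally show ?thesis unfolding sum .
qed

text \<open>The integral of the pull-back under \<open>g\<close> of a volume form of mass one
  supported in the unit ball. It is the degree of \<open>g\<close> at 0 provided that
  \<open>norm (g x) > 1\<close> on \<open>frontier U\<close>, since the image of the frontier then
  avoids that support.\<close>

definition deg_integral :: "(real^'n \<Rightarrow> real^'n) \<Rightarrow> (real^'n) set \<Rightarrow> real" where
  "deg_integral g U = integral UNIV (\<lambda>x. if x \<in> U then bump (g x) * jacobian_det g x else 0)"

text \<open>Along the straight homotopy \<open>G t\<close>, with \<open>h = g1 - g0\<close>, the
  time derivative \<open>E\<close> of the integrand is the integrand of
  \<open>integral_jacobian_variation_eq_0\<close>, so the degree integral is constant in time. The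
  bound on \<open>frontier U\<close> makes the extensions by zero jointly continuous, as the Leibniz
  rule demands.\<close>

lemma deg_integral_homotopy:
  fixes g0 g1 :: "real^'n \<Rightarrow> real^'n"
  assumes g: "smooth g0" "smooth g1" and U: "open U" "bounded U"
    and bd: "\<And>x t. x \<in> frontier U \<Longrightarrow> t \<in> {0..1} \<Longrightarrow> norm ((1 - t) *\<^sub>R g0 x + t *\<^sub>R g1 x) > 1"
  shows "deg_integral g0 U = deg_integral g1 U"
proof -
  define h where "h x = g1 x + (-1) *\<^sub>R g0 x" for x
  have h: "smooth h" unfolding h_def[abs_def] by (rule smooth_add_scaleR[OF g(2,1)])
  define G where "G t x = g0 x + t *\<^sub>R h x" for t x
  have G: "smooth (G t)" for t unfolding G_def by (rule smooth_add_scaleR[OF g(1) h])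
  have pG: "pd i (G t) x = pd i g0 x + t *\<^sub>R pd i h x" for i t x
    unfolding G_def by (rule pd_add_scaleR[OF g(1) h])
  have bd': "norm (G t x) > 1" if "x \<in> frontier U" "t \<in> {0..1}" for t x
  proof -
    have "(1 - t) *\<^sub>R g0 x + t *\<^sub>R g1 x = G t x"
      by (simp add: G_def h_def scaleR_left_diff_distrib scaleR_right_diff_distrib)
    then show ?thesis using bd[OF that] by simp
  qed
  obtain a where a: "U \<subseteq> cbox (-a) a" using U bounded_subset_cbox_symmetric by blast
  define K where "K t x = bump (G t x) * det (\<chi> i. pd i (G t) x)" for t x
  define E where "E t x = (bump_grad (G t x) \<bullet> h x) * det (\<chi> i. pd i (G t) x)
      + bump (G t x) * (\<Sum>k\<in>UNIV. det (\<chi> i. if i = k then pd i h x else pd i (G t) x))" for t x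
  have cont: "continuous_on S (\<lambda>z. g0 (snd z))" "continuous_on S (\<lambda>z. h (snd z))"
    "continuous_on S (\<lambda>z. pd i g0 (snd z))" "continuous_on S (\<lambda>z. pd i h (snd z))" for i and S :: "(real \<times> (real^'n)) set"
    by (rule continuous_on_compose2[OF smooth_continuous[of _ UNIV] continuous_on_snd[OF continuous_on_id]], use g h pd_smooth in auto)+
  have cG: "continuous_on S (\<lambda>z. G (fst z) (snd z))" and cpG: "continuous_on S (\<lambda>z. pd i (G (fst z)) (snd z))" for i S
    unfolding pG unfolding G_def by (intro continuous_intros cont)+
  have cbump: "continuous_on S (\<lambda>z. bump (G (fst z) (snd z)))" and cbumpg: "continuous_on S (\<lambda>z. bump_grad (G (fst z) (snd z)))" for S
    by (rule continuous_on_compose2[OF smooth_continuous[OF bump_smooth, of UNIV] cG], simp)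
       (rule continuous_on_compose2[OF bump_grad_continuous[of UNIV] cG], simp)
  have cK: "continuous_on S (\<lambda>z. K (fst z) (snd z))" for S
    unfolding K_def by (intro continuous_intros continuous_on_det_rows cpG cbump)
  have cE: "continuous_on S (\<lambda>z. E (fst z) (snd z))" for S
    unfolding E_def
  proof (intro continuous_intros continuous_on_det_rows cpG cbump cbumpg cont)
    show "continuous_on S (\<lambda>z. if i = k then pd i h (snd z) else pd i (G (fst z)) (snd z))" for i k
      by (cases "i = k") (simp_all add: cont cpG)
  qed
  have K0: "K t x = 0" and E0: "E t x = 0" if "norm (G t x) > 1" for t x
    using that by (auto simp: K_def E_def bump_zero bump_grad_zero)
  have dK: "((\<lambda>t. K t x) has_real_derivative E t x) (at t)" for t x
  proof -
    have "((\<lambda>t. G t x) has_vector_derivative h x) (at t)"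
      unfolding G_def by (auto intro!: derivative_eq_intros)
    then have "((\<lambda>t. bump (G t x)) has_derivative (\<lambda>r. frechet_derivative bump (at (G t x)) (r *\<^sub>R h x))) (at t)"
      unfolding has_vector_derivative_def by (rule has_derivative_compose[OF _ smooth_has_derivative[OF bump_smooth]])
    then have 1: "((\<lambda>t. bump (G t x)) has_real_derivative bump_grad (G t x) \<bullet> h x) (at t)"
      by (simp add: frechet_derivative_bump has_field_derivative_def mult.commute[of _ "_ \<bullet> _"])
    have 2: "((\<lambda>t. det (\<chi> i. pd i (G t) x)) has_real_derivative
        (\<Sum>k\<in>UNIV. det (\<chi> i. if i = k then pd i h x else pd i (G t) x))) (at t)"
      by (rule has_real_derivative_det_rows) (unfold pG, auto intro!: derivative_eq_intros)
    show ?thesis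
      unfolding K_def E_def by (rule DERIV_cong[OF DERIV_mult[OF 1 2]]) simp
  qed
  have clos: "continuous_on ({0..1} \<times> UNIV) (\<lambda>z. if snd z \<in> U then F (fst z) (snd z) else 0)"
    if F: "continuous_on ({0..1} \<times> UNIV) (\<lambda>z. F (fst z) (snd z))" "\<And>t x. norm (G t x) > 1 \<Longrightarrow> F t x = 0"
    for F :: "real \<Rightarrow> real^'n \<Rightarrow> real"
  proof (rule continuous_on_extend_zero[OF F(1)])
    have "{0..1} \<times> UNIV \<inter> snd -` closure U = {0..1::real} \<times> closure U" by auto
    then show "closed ({0..1::real} \<times> UNIV \<inter> snd -` closure U)" by (simp add: closed_Times)
    have "{0..1} \<times> UNIV \<inter> snd -` (- U) = {0..1::real} \<times> (- U)" by auto
    then show "closed ({0..1::real} \<times> UNIV \<inter> snd -` (- U))" using closed_Times[OF closed_atLeastAtMost closed_Compl[OF U(1)]] by metis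
  qed (use U F(2) bd' in \<open>auto intro: closed_Times\<close>)
  let ?I = "\<lambda>t. integral (cbox (-a) a) (\<lambda>x. if x \<in> U then K t x else 0)"
  have slice: "continuous_on UNIV (\<lambda>x. if x \<in> U then F t x else 0)"
    if "continuous_on ({0..1} \<times> UNIV) (\<lambda>z. if snd z \<in> U then F (fst z) (snd z) else 0)" "t \<in> {0..1}"
    for F :: "real \<Rightarrow> real^'n \<Rightarrow> real" and t
  proof -
    have "continuous_on UNIV (\<lambda>x. (\<lambda>z. if snd z \<in> U then F (fst z) (snd z) else 0) (t, x))"
      by (rule continuous_on_compose2[OF that(1)]) (use that(2) in \<open>auto intro!: continuous_intros\<close>)
    then show ?thesis by (simp cong: if_cong)
  qed
  have "(?I has_real_derivative 0) (at t within {0..1})" if t: "t \<in> {0..1}" for t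
  proof -
    have "(?I has_real_derivative integral (cbox (-a) a) (\<lambda>x. if x \<in> U then E t x else 0)) (at t within {0..1})"
    proof (rule leibniz_rule_field_derivative)
      show "((\<lambda>t. if x \<in> U then K t x else 0) has_real_derivative (if x \<in> U then E t x else 0)) (at t within {0..1})" for x t
        using DERIV_subset[OF dK] by auto
      show "(\<lambda>x. if x \<in> U then K t x else 0) integrable_on cbox (- a) a" if "t \<in> {0..1}" for t
        using slice[OF clos[OF cK K0] that] integrable_continuous continuous_on_subset by blast
      show "continuous_on ({0..1} \<times> cbox (- a) a) (\<lambda>(t, x). if x \<in> U then E t x else 0)"
        unfolding case_prod_unfold by (rule continuous_on_subset[OF clos[OF cE E0]]) auto
    qed (use t in auto)
    moreover have "integral (cbox (-a) a) (\<lambda>x. if x \<in> U then E t x else 0)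
       = integral UNIV (\<lambda>x. if x \<in> U then E t x else 0)"
      by (rule continuous_compact_support_integrable(3)[OF slice[OF clos[OF cE E0] t], symmetric]) (use a in auto)
    moreover have "\<dots> = 0"
      unfolding E_def by (rule integral_jacobian_variation_eq_0[OF G h U]) (use bd' t in auto)
    ultimately show ?thesis by simp
  qed
  then obtain c where c: "\<And>t. t \<in> {0..1} \<Longrightarrow> ?I t = c"
    using has_field_derivative_zero_constant[of "{0..1::real}" ?I] by auto
  have "deg_integral (G t) U = ?I t" if "t \<in> {0..1}" for t
    unfolding deg_integral_def jacobian_det_pd K_def[symmetric]
    by (rule continuous_compact_support_integrable(3)[OF slice[OF clos[OF cK K0] that]]) (use a in auto)
  then have "deg_integral (G 0) U = deg_integral (G 1) U" using c[of 0] c[of 1] by simp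
  moreover have "G 0 = g0" "G 1 = g1" by (auto simp: G_def h_def)
  ultimately show ?thesis by simp
qed

text \<open>Sard's theorem and the linear substitution rule are applied to vectors with a
  well-ordered index type. \<open>'a wo\<close> is a copy of the finite type \<open>'a\<close> with
  an arbitrary order, and \<open>to_wo\<close> and \<open>from_wo\<close> only rename
  coordinates.\<close>

typedef 'a wo = "UNIV :: 'a set" by simp

lemma bij_Rep_wo: "bij Rep_wo"
  by (rule bijI'[OF Rep_wo_inject]) (auto intro: Abs_wo_inverse[symmetric])

instance wo :: (finite) finite
  by standard (simp add: bij_betw_finite[OF bij_Rep_wo])

instantiation wo :: (finite) wellorder
begin

definition enum_wo :: "'a wo \<Rightarrow> nat" where
  "enum_wo = (SOME f. inj f)"

definition less_eq_wo :: "'a wo \<Rightarrow> 'a wo \<Rightarrow> bool" where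
  "less_eq_wo x y \<longleftrightarrow> enum_wo x \<le> enum_wo y"

definition less_wo :: "'a wo \<Rightarrow> 'a wo \<Rightarrow> bool" where
  "less_wo x y \<longleftrightarrow> enum_wo x < enum_wo y"

lemma inj_enum_wo: "inj (enum_wo :: 'a wo \<Rightarrow> nat)"
  unfolding enum_wo_def
proof (rule someI_ex[of inj])
  show "\<exists>f :: 'a wo \<Rightarrow> nat. inj f"
    using finite_imp_inj_to_nat_seg[of "UNIV :: 'a wo set"] by auto
qed

instance
proof intro_classes
  fix x y z :: "'a wo" and P :: "'a wo \<Rightarrow> bool"
  show "x < y \<longleftrightarrow> x \<le> y \<and> \<not> y \<le> x" by (auto simp: less_eq_wo_def less_wo_def)
  show "x \<le> x" by (simp add: less_eq_wo_def)
  show "x \<le> y \<Longrightarrow> y \<le> z \<Longrightarrow> x \<le> z" by (simp add: less_eq_wo_def)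
  show "x \<le> y \<Longrightarrow> y \<le> x \<Longrightarrow> x = y"
    using injD[OF inj_enum_wo] by (metis less_eq_wo_def order_antisym)
  show "x \<le> y \<or> y \<le> x" by (auto simp: less_eq_wo_def)
  assume step: "\<And>x. (\<And>y. y < x \<Longrightarrow> P y) \<Longrightarrow> P x"
  show "P x"
    by (rule measure_induct[of enum_wo P x]) (use step less_wo_def in blast)
qed

end

definition to_wo :: "'b^'n \<Rightarrow> 'b^'n wo" where
  "to_wo x = (\<chi> k. x $ Rep_wo k)"

definition from_wo :: "'b^'n wo \<Rightarrow> 'b^'n" where
  "from_wo x = (\<chi> i. x $ Abs_wo i)"

lemma from_to_wo [simp]: "from_wo (to_wo x) = x" "to_wo (from_wo y) = y"
  by (simp_all add: to_wo_def from_wo_def vec_eq_iff Abs_wo_inverse Rep_wo_inverse)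

lemma from_wo_axis: "from_wo (axis j x) = axis (Rep_wo j) x"
proof -
  have "Abs_wo i = j \<longleftrightarrow> i = Rep_wo j" for i
    by (metis Abs_wo_inverse Rep_wo_inverse UNIV_I)
  then show ?thesis by (simp add: from_wo_def vec_eq_iff axis_def)
qed

lemma linear_wo: "linear (to_wo :: real^'n \<Rightarrow> _)" "linear (from_wo :: real^'n wo \<Rightarrow> real^'n)"
  by (auto intro!: linearI simp: to_wo_def from_wo_def vec_eq_iff)

text \<open>As \<open>e\<close> joins two types, this is not conjugation within one group. The
  permutation is built up from transpositions, and relabelling turns each of them into a
  transposition again.\<close>

lemma sign_conj_bij:
  fixes e :: "'m::finite \<Rightarrow> 'n::finite"
  assumes e: "bij e" and p: "p permutes UNIV"
  shows "sign (inv e \<circ> p \<circ> e) = sign p"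
proof -
  have ie: "inv e (e x) = x" "e (inv e y) = y" for x y
    using e by (simp_all add: bij_is_inj bij_is_surj surj_f_inv_f)
  have inj: "inv e x = inv e y \<longleftrightarrow> x = y" for x y
    using ie(2) by metis
  have "permutation (inv e \<circ> p \<circ> e) \<and> sign (inv e \<circ> p \<circ> e) = sign p"
    using p finite_class.finite_UNIV
  proof (induction rule: permutes_induct)
    case id
    have "inv e \<circ> id \<circ> e = id" by (auto simp: ie)
    then show ?case by (simp add: permutation_id)
  next
    case (swap a b p)
    have eq: "inv e \<circ> (Transposition.transpose a b \<circ> p) \<circ> e
        = Transposition.transpose (inv e a) (inv e b) \<circ> (inv e \<circ> p \<circ> e)"
      by (rule ext) (simp add: Transposition.transpose_def ie inj)
    have "permutation p" using \<open>p permutes UNIV\<close> by (meson finite_class.finite_UNIV permutation_permutes)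
    then show ?case unfolding eq using swap.IH \<open>a \<noteq> b\<close>
      by (simp add: permutation_compose permutation_swap_id sign_compose sign_swap_id inj del: o_apply comp_apply)
  qed
  then show ?thesis by simp
qed

text \<open>Relabelling rows and columns alike conjugates the permutations in the Leibniz formula,
  which keeps their signs.\<close>

lemma det_reindex:
  fixes A :: "real^'n^'n" and e :: "'m::finite \<Rightarrow> 'n"
  assumes e: "bij e"
  shows "det (\<chi> i j. A $ e i $ e j) = det A"
proof -
  have ie: "inv e (e x) = x" "e (inv e y) = y" for x y
    using e by (simp_all add: bij_is_inj bij_is_surj surj_f_inv_f)
  have perm: "f permutes UNIV \<longleftrightarrow> bij f" for f :: "'x \<Rightarrow> 'x"
    by (simp add: permutes_def bij_iff)
  have "det A = (\<Sum>p | p permutes UNIV. of_int (sign p) * (\<Prod>i\<in>UNIV. A $ i $ p i))"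
    by (simp add: det_def)
  also have "\<dots> = (\<Sum>q | q permutes UNIV. of_int (sign q) * (\<Prod>i\<in>UNIV. A $ e i $ e (q i)))"
  proof (rule sum.reindex_bij_witness[where i = "\<lambda>q. e \<circ> q \<circ> inv e" and j = "\<lambda>p. inv e \<circ> p \<circ> e"])
    fix p :: "'n \<Rightarrow> 'n" assume p: "p \<in> {p. p permutes UNIV}"
    show "e \<circ> (inv e \<circ> p \<circ> e) \<circ> inv e = p" by (auto simp: ie)
    show "inv e \<circ> p \<circ> e \<in> {q. q permutes UNIV}"
      using p e by (simp add: perm bij_comp bij_imp_bij_inv)
    have "(\<Prod>i\<in>UNIV. A $ e i $ p (e i)) = (\<Prod>i\<in>UNIV. A $ i $ p i)"
      by (rule prod.reindex_bij_betw) (use e in simp)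
    then show "of_int (sign (inv e \<circ> p \<circ> e)) * (\<Prod>i\<in>UNIV. A $ e i $ e ((inv e \<circ> p \<circ> e) i))
      = of_int (sign p) * (\<Prod>i\<in>UNIV. A $ i $ p i)"
      using sign_conj_bij[OF e, of p] p by (simp add: ie)
  next
    fix q :: "'m \<Rightarrow> 'm" assume q: "q \<in> {q. q permutes UNIV}"
    show "inv e \<circ> (e \<circ> q \<circ> inv e) \<circ> e = q" by (auto simp: ie)
    show "e \<circ> q \<circ> inv e \<in> {p. p permutes UNIV}"
      using q e by (simp add: perm bij_comp bij_imp_bij_inv)
  qed
  finally show ?thesis by (simp add: det_def)
qed

lemma prod_Basis_cart:
  fixes x :: "real^'n"
  shows "(\<Prod>b\<in>Basis. x \<bullet> b) = (\<Prod>i\<in>UNIV. x $ i)"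
proof -
  have B: "Basis = range (\<lambda>i::'n. axis i (1::real))" by (auto simp: Basis_vec_def)
  have inj: "inj (\<lambda>i::'n. axis i (1::real))" by (auto simp: inj_on_def axis_eq_axis)
  show ?thesis unfolding B prod.reindex[OF inj] by (simp add: inner_axis)
qed

text \<open>Renaming coordinates turns boxes into boxes with the same side lengths, and the volumes
  of boxes determine Lebesgue measure.\<close>

lemma distr_from_wo: "distr lborel borel (from_wo :: real^'n wo \<Rightarrow> real^'n) = lborel"
proof (rule lborel_eqI[symmetric])
  have m: "from_wo \<in> borel_measurable (borel :: (real^'n wo) measure)"
    using linear_wo(2) by (intro borel_measurable_continuous_onI linear_continuous_on linear_conv_bounded_linear[THEN iffD1])
  fix l u :: "real^'n"
  assume le: "\<And>b. b \<in> Basis \<Longrightarrow> l \<bullet> b \<le> u \<bullet> b"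
  have le': "l $ i \<le> u $ i" for i using le[of "axis i 1"] by (simp add: inner_axis axis_in_Basis_iff)
  have "from_wo -` box l u = box (to_wo l) (to_wo u)"
    by (auto simp: mem_box_cart from_wo_def to_wo_def) (metis Abs_wo_inverse Rep_wo_inverse UNIV_I)+
  then have "emeasure (distr lborel borel from_wo) (box l u) = emeasure lborel (box (to_wo l) (to_wo u))"
    using m by (simp add: emeasure_distr)
  also have "\<dots> = (\<Prod>b\<in>Basis. (to_wo u - to_wo l) \<bullet> b)"
    by (rule emeasure_lborel_box) (auto simp: Basis_vec_def inner_axis to_wo_def le')
  also have "\<dots> = (\<Prod>b\<in>Basis. (u - l) \<bullet> b)"
    unfolding prod_Basis_cart using prod.reindex_bij_betw[OF bij_Rep_wo, of "\<lambda>i. (u - l) $ i"]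
    by (simp add: to_wo_def)
  finally show "emeasure (distr lborel borel from_wo) (box l u) = (\<Prod>b\<in>Basis. (u - l) \<bullet> b)" .
qed simp

lemma continuous_linear_compose:
  "continuous_on UNIV f \<Longrightarrow> linear L \<Longrightarrow> continuous_on UNIV (\<lambda>x. f (L x))" for L :: "'a::euclidean_space \<Rightarrow> 'b::euclidean_space"
  by (rule continuous_on_compose2[of UNIV f]) (auto intro: linear_continuous_on simp: linear_conv_bounded_linear[symmetric])

lemma lborel_integral_from_wo:
  fixes f :: "real^'n \<Rightarrow> real"
  assumes "continuous_on UNIV f"
  shows "integral\<^sup>L lborel (\<lambda>x. f (from_wo x)) = integral\<^sup>L lborel f"
proof -
  have "integral\<^sup>L lborel f = integral\<^sup>L (distr lborel borel from_wo) f" by (simp add: distr_from_wo)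
  also have "\<dots> = integral\<^sup>L lborel (\<lambda>x. f (from_wo x))"
    using assms linear_wo(2)
    by (intro integral_distr) (auto intro!: borel_measurable_continuous_onI linear_continuous_on simp: linear_conv_bounded_linear[symmetric])
  finally show ?thesis by simp
qed

section \<open>Linear substitution and critical values\<close>

lemma linear_bounded_below:
  fixes L :: "real^'n \<Rightarrow> real^'n"
  assumes "linear L" "det (matrix L) \<noteq> 0"
  obtains B where "B > 0" "\<And>x. B * norm x \<le> norm (L x)"
  using linear_inj_bounded_below_pos[OF assms(1)] assms det_nz_iff_inj by metis

lemma integral_bump_linear:
  fixes L :: "real^'n \<Rightarrow> real^'n"
  assumes L: "linear L" and det: "det (matrix L) \<noteq> 0"
  shows "\<bar>det (matrix L)\<bar> * integral UNIV (\<lambda>x. bump (L x)) = 1"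
proof -
  have cb: "continuous_on UNIV (bump :: real^'n \<Rightarrow> real)" by (rule smooth_continuous[OF bump_smooth])
  \<comment> \<open>\<open>L\<close> transported to the well-ordered copy, where the substitution
    rule applies. The determinant is unchanged by \<open>det_reindex\<close>, the integrals by
    \<open>lborel_integral_from_wo\<close>.\<close>
  define M where "M y = to_wo (L (from_wo y))" for y
  have M: "linear M" unfolding M_def
    using linear_compose[OF linear_compose[OF linear_wo(2) L] linear_wo(1)] by (simp add: o_def)
  have mat: "matrix M = (\<chi> i j. matrix L $ Rep_wo i $ Rep_wo j)"
  proof -
    show ?thesis by (simp add: from_wo_axis matrix_def M_def to_wo_def vec_eq_iff)
  qed
  have detM: "det (matrix M) = det (matrix L)" unfolding mat by (rule det_reindex[OF bij_Rep_wo])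
  have vanish: "\<exists>a. \<forall>x. x \<notin> cbox (-a) a \<longrightarrow> bump (A x) = 0"
    if A: "linear A" "inj A" for A :: "'c::euclidean_space \<Rightarrow> real^'n"
  proof -
    obtain B where B: "B > 0" "\<And>x. B * norm x \<le> norm (A x)"
      using linear_inj_bounded_below_pos[OF A] by metis
    obtain a where a: "cball 0 (1/B) \<subseteq> cbox (-a) (a::'c)"
      using bounded_subset_cbox_symmetric[OF bounded_cball] by metis
    have "bump (A x) = 0" if "x \<notin> cbox (-a) a" for x
    proof -
      have "norm x > 1/B" using that a by (auto simp: not_le[symmetric])
      then have "B * norm x \<ge> 1" using B(1) by (simp add: field_simps)
      then show ?thesis using B(2)[of x] by (intro bump_zero) linarith
    qed
    then show ?thesis by blast
  qed
  have eqint: "integral UNIV (\<lambda>x. bump (A x)) = integral\<^sup>L lborel (\<lambda>x. bump (A x))"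
    if A: "linear A" "inj A" for A :: "'c::euclidean_space \<Rightarrow> real^'n"
    using vanish[OF A] continuous_compact_support_integrable(4)[OF continuous_linear_compose[OF cb A(1)]] by metis
  have absint: "(\<lambda>x. bump (A x)) absolutely_integrable_on UNIV"
    if A: "linear A" "inj A" for A :: "'c::euclidean_space \<Rightarrow> real^'n"
    using vanish[OF A] continuous_compact_support_integrable(1)[OF continuous_linear_compose[OF cb A(1)]] by metis
  have iL: "inj L" using det det_nz_iff_inj[OF L] by simp
  have ifr: "inj (from_wo :: real^'n wo \<Rightarrow> real^'n)" by (metis from_to_wo(2) injI)
  have sM: "surj M"
    using det M detM det_nz_iff_inj linear_injective_imp_surjective by metis
  \<comment> \<open>The rule is applied to an integrand with values in \<open>real^1\<close>; the
    scalar identity is its only component.\<close>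
  let ?v = "\<lambda>x. vec (bump (from_wo x)) :: real^1"
  have cont_eq: "\<bar>det (matrix M)\<bar> *\<^sub>R integral UNIV (?v \<circ> M) = integral (range M) ?v"
    by (rule integral_change_of_variables_linear[OF M, symmetric])
      (use absint[OF linear_wo(2) ifr] sM in \<open>simp add: absolutely_integrable_on_1_iff\<close>)
  have comp1: "integral UNIV v $ 1 = integral UNIV (\<lambda>x. v x $ 1)" for v :: "real^'n wo \<Rightarrow> real^1"
    by (simp add: integral_on_1_eq)
  have "\<bar>det (matrix M)\<bar> * integral UNIV (\<lambda>x. bump (from_wo (M x))) = integral UNIV (\<lambda>x::real^'n wo. bump (from_wo x))"
    using arg_cong[OF cont_eq, of "\<lambda>v. v $ 1"] sM by (simp add: comp1 o_def)
  moreover have "from_wo (M x) = L (from_wo x)" for x by (simp add: M_def)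
  moreover have "integral UNIV (\<lambda>x::real^'n wo. bump (L (from_wo x))) = integral UNIV (\<lambda>x. bump (L x))"
    using eqint[OF linear_compose[OF linear_wo(2) L]] eqint[OF L iL] iL ifr
      lborel_integral_from_wo[OF continuous_linear_compose[OF cb L]] by (simp add: o_def inj_compose[unfolded o_def])
  moreover have "integral UNIV (\<lambda>x::real^'n wo. bump (from_wo x)) = 1"
    using eqint[OF linear_wo(2) ifr] lborel_integral_from_wo[OF cb] bump_integral by simp
  ultimately show ?thesis by (simp add: detM)
qed

text \<open>\<open>baby_Sard\<close> is applied to the conjugate \<open>h\<close> of
  \<open>g\<close>. Returning with \<open>from_wo\<close> keeps null sets null, because it is a
  differentiable map between spaces of equal dimension.\<close>

lemma negligible_critical_values:
  fixes g :: "real^'n \<Rightarrow> real^'n"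
  assumes g: "smooth g"
  shows "negligible (g ` {x. jacobian_det g x = 0})"
proof -
  define h where "h y = to_wo (g (from_wo y))" for y
  define h' where "h' y v = to_wo (frechet_derivative g (at (from_wo y)) (from_wo v))" for y v
  have bl: "bounded_linear (to_wo :: real^'n \<Rightarrow> _)" "bounded_linear (from_wo :: real^'n wo \<Rightarrow> real^'n)"
    using linear_wo by (simp_all add: linear_conv_bounded_linear)
  have dh: "(h has_derivative h' y) (at y)" for y
    unfolding h_def h'_def
    by (rule bounded_linear.has_derivative[OF bl(1)])
       (rule has_derivative_compose[OF bounded_linear_imp_has_derivative[OF bl(2)] smooth_has_derivative[OF g]])
  have mat: "matrix (h' y) = (\<chi> i j. matrix (frechet_derivative g (at (from_wo y))) $ Rep_wo i $ Rep_wo j)" for y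
  proof -
    show ?thesis by (simp add: from_wo_axis matrix_def h'_def to_wo_def vec_eq_iff)
  qed
  have det: "det (matrix (h' y)) = jacobian_det g (from_wo y)" for y
    unfolding mat jacobian_det_def by (rule det_reindex[OF bij_Rep_wo])
  have "negligible (h ` {y. jacobian_det g (from_wo y) = 0})"
    by (rule baby_Sard[where f' = h'])
       (simp_all add: has_derivative_at_withinI[OF dh] det_eq_0_rank[symmetric] det)
  then have "negligible (from_wo ` (h ` {y. jacobian_det g (from_wo y) = 0}))"
    by (rule negligible_differentiable_image_negligible[rotated])
       (auto intro!: linear_imp_differentiable_on linear_wo simp: bij_betw_same_card[OF bij_Rep_wo])
  moreover have "from_wo ` (h ` {y. jacobian_det g (from_wo y) = 0}) = g ` {x. jacobian_det g x = 0}"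
  proof
    show "g ` {x. jacobian_det g x = 0} \<subseteq> from_wo ` (h ` {y. jacobian_det g (from_wo y) = 0})"
    proof clarify
      fix x assume "jacobian_det g x = 0"
      then show "g x \<in> from_wo ` (h ` {y. jacobian_det g (from_wo y) = 0})"
        by (intro image_eqI[of _ _ "h (to_wo x)"] imageI) (simp_all add: h_def)
    qed
  qed (auto simp: h_def)
  ultimately show ?thesis by simp
qed

section \<open>Brouwer degree\<close>

lemma smooth_scaleR: "smooth g \<Longrightarrow> smooth (\<lambda>x. k *\<^sub>R g x)"
  unfolding smooth_def by (auto intro!: Ck_bounded_linear[OF bounded_linear_scaleR_right])

lemma smooth_diff_const: "smooth g \<Longrightarrow> smooth (\<lambda>x. g x - y)"
  using smooth_add_scaleR[of g "\<lambda>_. - y" 1] by (auto simp: smooth_def[of "\<lambda>_. _"])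

lemma jacobian_det_continuous: "smooth g \<Longrightarrow> continuous_on S (jacobian_det g)"
  unfolding jacobian_det_pd[abs_def]
  by (intro continuous_on_det_rows smooth_continuous pd_smooth)

lemma smooth_approximation:
  fixes F :: "'a::euclidean_space \<Rightarrow> 'b::euclidean_space"
  assumes "compact K" "continuous_on K F" "e > 0"
  obtains p where "smooth p" "\<And>x. x \<in> K \<Longrightarrow> norm (p x - F x) < e"
  using Stone_Weierstrass_polynomial_function[OF assms] polynomial_function_smooth
  by (metis norm_minus_commute)

lemma compact_positive_minorant:
  fixes F :: "'a::topological_space \<Rightarrow> real"
  assumes "compact K" "continuous_on K F" "\<And>x. x \<in> K \<Longrightarrow> F x > 0"
  obtains m where "m > 0" "\<And>x. x \<in> K \<Longrightarrow> m \<le> F x"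
proof (cases "K = {}")
  case True
  then show ?thesis using that[of 1] by auto
next
  case False
  obtain x where "x \<in> K" "\<forall>y\<in>K. F x \<le> F y"
    using continuous_attains_inf[OF assms(1) False assms(2)] by blast
  then show ?thesis using that[of "F x"] assms(3) by blast
qed

text \<open>On \<open>K\<close> the ball around \<open>c *\<^sub>R F x\<close> that reaches as far
  as \<open>g x\<close> misses the closed unit ball, where \<open>bump\<close> is supported. The
  scale \<open>c\<close> makes room for this however small \<open>F\<close> is, and convexity of the
  ball makes straight homotopies between representatives admissible.\<close>

definition represents :: "(real^'n \<Rightarrow> real^'n) \<Rightarrow> real \<Rightarrow> (real^'n \<Rightarrow> real^'n) \<Rightarrow> (real^'n) set \<Rightarrow> bool" where
  "represents g c F K \<longleftrightarrow> smooth g \<and> c > 0 \<and> (\<forall>x\<in>K. norm (g x - c *\<^sub>R F x) + 1 < c * norm (F x))"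

text \<open>The degree at the value 0. It is a relation because existence and uniqueness have
  separate hypotheses, and its value is real because integrality emerges only from the comparison
  with a count of preimages.\<close>

definition has_degree :: "(real^'n \<Rightarrow> real^'n) \<Rightarrow> (real^'n) set \<Rightarrow> real \<Rightarrow> bool" where
  "has_degree F U d \<longleftrightarrow> (\<exists>g c. represents g c F (frontier U) \<and> deg_integral g U = d)"

lemma represents_subset: "represents g c F K \<Longrightarrow> K' \<subseteq> K \<Longrightarrow> represents g c F K'"
  by (auto simp: represents_def)

lemma represents_norm_gt_1:
  assumes "represents g c F K" "x \<in> K"
  shows "norm (g x) > 1"
proof -
  have "norm (g x - c *\<^sub>R F x) + 1 < norm (c *\<^sub>R F x)" using assms by (auto simp: represents_def)
  then show ?thesis using norm_triangle_ineq3[of "g x" "c *\<^sub>R F x"] by linarith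
qed

text \<open>Since \<open>C / c\<close> is at least 1, multiplication by it can only enlarge the
  margin 1. Two representatives can thus be brought to a common scale.\<close>

lemma represents_rescale:
  assumes g: "represents g c F K" and C: "C \<ge> c"
  shows "represents (\<lambda>x. (C / c) *\<^sub>R g x) C F K"
proof -
  have c: "c > 0" and sg: "smooth g" using g by (auto simp: represents_def)
  have "norm ((C / c) *\<^sub>R g x - C *\<^sub>R F x) + 1 < C * norm (F x)" if "x \<in> K" for x
  proof -
    have "(C / c) *\<^sub>R g x - C *\<^sub>R F x = (C / c) *\<^sub>R (g x - c *\<^sub>R F x)"
      using c by (simp add: scaleR_diff_right)
    then have "norm ((C / c) *\<^sub>R g x - C *\<^sub>R F x) + 1 \<le> (C / c) * (norm (g x - c *\<^sub>R F x) + 1)"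
      using c C by (simp add: distrib_left)
    also have "\<dots> < (C / c) * (c * norm (F x))"
      using g that c C by (intro mult_strict_left_mono) (auto simp: represents_def)
    finally show ?thesis using c by simp
  qed
  then show ?thesis using smooth_scaleR[OF sg] c C by (simp add: represents_def)
qed

lemma deg_integral_rescale:
  assumes g: "represents g c F (frontier U)" and C: "C \<ge> c" and U: "open U" "bounded U"
  shows "deg_integral (\<lambda>x. (C / c) *\<^sub>R g x) U = deg_integral g U"
proof (rule deg_integral_homotopy[symmetric])
  have c: "c > 0" and sg: "smooth g" using g by (auto simp: represents_def)
  show "smooth g" "smooth (\<lambda>x. (C / c) *\<^sub>R g x)" using sg smooth_scaleR by auto
  fix x t assume x: "x \<in> frontier U" and t: "t \<in> {0..1::real}"
  have "(1 - t) *\<^sub>R g x + t *\<^sub>R (C / c) *\<^sub>R g x = (1 + t * (C / c - 1)) *\<^sub>R g x"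
    by (simp add: algebra_simps)
  moreover have "t * (C / c - 1) \<ge> 0" using t c C by (intro mult_nonneg_nonneg) auto
  moreover have "(1 + s) * norm (g x) > 1" if "s \<ge> 0" for s
    using represents_norm_gt_1[OF g x] that by (smt (verit) mult_less_cancel_right2 distrib_right mult_nonneg_nonneg)
  ultimately show "1 < norm ((1 - t) *\<^sub>R g x + t *\<^sub>R (C / c) *\<^sub>R g x)" by simp
qed (use U in auto)

lemma represents_convex:
  assumes "represents g c F K" "represents g' c F K" "x \<in> K" "t \<in> {0..1}"
  shows "norm ((1 - t) *\<^sub>R g x + t *\<^sub>R g' x) > 1"
proof -
  let ?h = "(1 - t) *\<^sub>R g x + t *\<^sub>R g' x"
  have "?h - c *\<^sub>R F x = (1 - t) *\<^sub>R (g x - c *\<^sub>R F x) + t *\<^sub>R (g' x - c *\<^sub>R F x)"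
    by (simp add: algebra_simps)
  then have "norm (?h - c *\<^sub>R F x) \<le> (1 - t) * norm (g x - c *\<^sub>R F x) + t * norm (g' x - c *\<^sub>R F x)"
    using assms(4) by (metis (no_types, lifting) abs_of_nonneg atLeastAtMost_iff diff_ge_0_iff_ge norm_scaleR norm_triangle_ineq)
  also have "\<dots> \<le> max (norm (g x - c *\<^sub>R F x)) (norm (g' x - c *\<^sub>R F x))"
    using assms(4) by (intro convex_bound_le) auto
  also have "\<dots> < norm (c *\<^sub>R F x) - 1"
    using assms by (auto simp: represents_def)
  finally show ?thesis using norm_triangle_ineq3[of ?h "c *\<^sub>R F x"] by linarith
qed

text \<open>At the scale \<open>max c c'\<close> both representatives lie in balls around the same
  point, so the segment between them avoids the unit ball.\<close>

lemma has_degree_unique: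
  assumes "has_degree F U d" "has_degree F U d'" "open U" "bounded U"
  shows "d = d'"
proof -
  obtain g c g' c' where g: "represents g c F (frontier U)" "deg_integral g U = d"
    and g': "represents g' c' F (frontier U)" "deg_integral g' U = d'"
    using assms(1,2) unfolding has_degree_def by auto
  let ?C = "max c c'"
  have r: "represents (\<lambda>x. (?C / c) *\<^sub>R g x) ?C F (frontier U)" "represents (\<lambda>x. (?C / c') *\<^sub>R g' x) ?C F (frontier U)"
    by (rule represents_rescale[OF g(1)], simp) (rule represents_rescale[OF g'(1)], simp)
  have "deg_integral (\<lambda>x. (?C / c) *\<^sub>R g x) U = deg_integral (\<lambda>x. (?C / c') *\<^sub>R g' x) U"
    by (rule deg_integral_homotopy) (use r represents_convex[OF r] assms in \<open>auto simp: represents_def\<close>)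
  then show ?thesis
    using deg_integral_rescale[OF g(1) _ assms(3,4)] deg_integral_rescale[OF g'(1) _ assms(3,4)] g g' by simp
qed

lemma represents_exists:
  fixes F :: "real^'n \<Rightarrow> real^'n"
  assumes C: "compact C" "continuous_on C F" and K: "compact K" "K \<subseteq> C" "\<And>x. x \<in> K \<Longrightarrow> F x \<noteq> 0"
  obtains g c where "represents g c F K"
proof -
  obtain m where m: "m > 0" "\<And>x. x \<in> K \<Longrightarrow> m \<le> norm (F x)"
    using compact_positive_minorant[of K "\<lambda>x. norm (F x)"] K C(2) continuous_on_subset
    by (metis continuous_on_norm zero_less_norm_iff)
  obtain p where p: "smooth p" "\<And>x. x \<in> C \<Longrightarrow> norm (p x - F x) < m / 2"
    using smooth_approximation[OF C, of "m/2"] m by auto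
  \<comment> \<open>The scale \<open>4/m\<close> turns the lower bound \<open>m\<close> of
    \<open>norm (F x)\<close> into 4 and the error \<open>m/2\<close> into 2; the required margin is
    2 + 1 < 4.\<close>
  have "norm ((4/m) *\<^sub>R p x - (4/m) *\<^sub>R F x) + 1 < (4/m) * norm (F x)" if "x \<in> K" for x
  proof -
    have "norm ((4/m) *\<^sub>R p x - (4/m) *\<^sub>R F x) = (4/m) * norm (p x - F x)"
      using m by (simp add: scaleR_diff_right[symmetric])
    also have "\<dots> < (4/m) * (m / 2)" using p(2)[of x] that K m by (intro mult_strict_left_mono) auto
    also have "\<dots> = 2" using m by simp
    finally have "norm ((4/m) *\<^sub>R p x - (4/m) *\<^sub>R F x) < 2" .
    moreover have "4 \<le> (4/m) * norm (F x)" using m(2)[OF that] m(1) by (simp add: field_simps)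
    ultimately show ?thesis by linarith
  qed
  then show ?thesis using that[of "\<lambda>x. (4/m) *\<^sub>R p x" "4/m"] m smooth_scaleR[OF p(1)] by (auto simp: represents_def)
qed

lemma has_degree_exists:
  assumes "bounded U" "continuous_on (frontier U) F" "\<And>x. x \<in> frontier U \<Longrightarrow> F x \<noteq> 0"
  obtains d where "has_degree F U d"
  using represents_exists[of "frontier U" F "frontier U"] assms compact_frontier_bounded
  unfolding has_degree_def by (metis order_refl)

text \<open>A single smooth \<open>g\<close> represents both \<open>F\<close> and \<open>G\<close>
  at one scale, so both degrees are the number \<open>deg_integral g U\<close>. By compactness the
  strict inequality has a gap \<open>m\<close>, which pays for the approximation error.\<close>

lemma has_degree_Rouche:
  fixes F G :: "real^'n \<Rightarrow> real^'n"
  assumes d: "has_degree F U d" and U: "open U" "bounded U"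
    and cont: "continuous_on (frontier U) F" "continuous_on (frontier U) G"
    and lt: "\<And>x. x \<in> frontier U \<Longrightarrow> norm (F x - G x) < norm (F x)"
  shows "has_degree G U d"
proof -
  have K: "compact (frontier U)" using U compact_frontier_bounded by blast
  obtain m where m: "m > 0" "\<And>x. x \<in> frontier U \<Longrightarrow> m \<le> norm (F x) - norm (F x - G x)"
    by (rule compact_positive_minorant[OF K, of "\<lambda>x. norm (F x) - norm (F x - G x)"])
       (use cont lt in \<open>auto intro!: continuous_intros\<close>)
  obtain p where p: "smooth p" "\<And>x. x \<in> frontier U \<Longrightarrow> norm (p x - G x) < m / 2"
    using smooth_approximation[OF K cont(2), of "m/2"] m by auto
  \<comment> \<open>Scaling by \<open>4 / m\<close> turns the gap \<open>m\<close> into 4, which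
    covers the approximation error 2 and the margin 1 for \<open>F\<close> and for
    \<open>G\<close>.\<close>
  define c g where "c = 4 / m" and "g = (\<lambda>x. c *\<^sub>R p x)"
  have c: "c > 0" "c * m = 4" using m by (auto simp: c_def)
  have g: "smooth g" unfolding g_def by (rule smooth_scaleR[OF p(1)])
  have gG: "norm (g x - c *\<^sub>R G x) < 2" if "x \<in> frontier U" for x
  proof -
    have "norm (g x - c *\<^sub>R G x) = c * norm (p x - G x)"
      using c by (simp add: g_def scaleR_diff_right[symmetric])
    also have "\<dots> < c * (m / 2)" using p(2)[OF that] c by (intro mult_strict_left_mono) auto
    finally show ?thesis using c by simp
  qed
  have F4: "4 \<le> c * norm (F x) - c * norm (F x - G x)" if "x \<in> frontier U" for x
    using mult_left_mono[OF m(2)[OF that], of c] c by (simp add: algebra_simps)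
  have "represents g c G (frontier U)"
  proof -
    have "norm (g x - c *\<^sub>R G x) + 1 < c * norm (G x)" if "x \<in> frontier U" for x
    proof -
      have "norm (F x) \<le> norm (F x - G x) + norm (G x)" using norm_triangle_sub[of "F x" "G x"] by linarith
      from mult_left_mono[OF this, of c] c(1) F4[OF that] gG[OF that] show ?thesis
        by (simp add: distrib_left)
    qed
    then show ?thesis using g c by (auto simp: represents_def)
  qed
  then have G: "has_degree G U (deg_integral g U)" by (auto simp: has_degree_def)
  have "represents g c F (frontier U)"
  proof -
    have "norm (g x - c *\<^sub>R F x) + 1 < c * norm (F x)" if "x \<in> frontier U" for x
    proof -
      have "norm (g x - c *\<^sub>R F x) \<le> norm (g x - c *\<^sub>R G x) + norm (c *\<^sub>R G x - c *\<^sub>R F x)"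
        using norm_triangle_ineq[of "g x - c *\<^sub>R G x" "c *\<^sub>R G x - c *\<^sub>R F x"] by simp
      also have "norm (c *\<^sub>R G x - c *\<^sub>R F x) = c * norm (F x - G x)"
        using c by (simp add: scaleR_diff_right[symmetric] norm_minus_commute)
      finally show ?thesis using F4[OF that] gG[OF that] by linarith
    qed
    then show ?thesis using g c by (auto simp: represents_def)
  qed
  then have "has_degree F U (deg_integral g U)" by (auto simp: has_degree_def)
  then show ?thesis using G has_degree_unique[OF d _ U] by metis
qed

text \<open>On the compact frontier \<open>H\<close> keeps distance at least \<open>m\<close> from 0
  and moves by less than \<open>m\<close> during a time step \<open>1 / N\<close>. So Rouche's
  condition holds in each of the \<open>N\<close> steps.\<close>

lemma has_degree_homotopy:
  fixes H :: "real \<Rightarrow> real^'n \<Rightarrow> real^'n"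
  assumes d: "has_degree (H 0) U d" and U: "open U" "bounded U"
    and cont: "continuous_on ({0..1} \<times> frontier U) (\<lambda>(t, x). H t x)"
    and nz: "\<And>t x. t \<in> {0..1} \<Longrightarrow> x \<in> frontier U \<Longrightarrow> H t x \<noteq> 0"
  shows "has_degree (H 1) U d"
proof -
  have K: "compact ({0..1::real} \<times> frontier U)"
    using U compact_frontier_bounded by (intro compact_Times) auto
  obtain m where m: "m > 0" "\<And>z. z \<in> {0..1} \<times> frontier U \<Longrightarrow> m \<le> norm (case z of (t, x) \<Rightarrow> H t x)"
    by (rule compact_positive_minorant[OF K, of "\<lambda>z. norm (case z of (t, x) \<Rightarrow> H t x)"])
       (use cont nz in \<open>auto intro!: continuous_on_norm\<close>)
  have "uniformly_continuous_on ({0..1} \<times> frontier U) (\<lambda>(t, x). H t x)"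
    by (rule compact_uniformly_continuous[OF cont K])
  then obtain e where e: "e > 0" "\<And>z z'. z \<in> {0..1} \<times> frontier U \<Longrightarrow> z' \<in> {0..1} \<times> frontier U \<Longrightarrow> dist z' z < e
      \<Longrightarrow> dist (case z' of (t, x) \<Rightarrow> H t x) (case z of (t, x) \<Rightarrow> H t x) < m"
    unfolding uniformly_continuous_on_def using m(1) by metis
  obtain N where N: "N > 0" "1 / real N < e"
    using reals_Archimedean[OF e(1)] by (metis inverse_eq_divide zero_less_Suc)
  have slice: "continuous_on (frontier U) (H t)" if "t \<in> {0..1}" for t
  proof -
    have "continuous_on (frontier U) (\<lambda>x. case (t, x) of (t, x) \<Rightarrow> H t x)"
      by (rule continuous_on_compose2[OF cont]) (use that in \<open>auto intro!: continuous_intros\<close>)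
    then show ?thesis by simp
  qed
  have "has_degree (H (real k / real N)) U d" if "k \<le> N" for k
    using that
  proof (induction k)
    case 0
    then show ?case using d by simp
  next
    case (Suc k)
    have t: "real k / real N \<in> {0..1}" "real (Suc k) / real N \<in> {0..1}"
      using Suc.prems N by (auto simp: divide_simps)
    show ?case
    proof (rule has_degree_Rouche[OF Suc.IH U slice[OF t(1)] slice[OF t(2)]])
      fix x assume x: "x \<in> frontier U"
      have "dist (real k / real N, x) (real (Suc k) / real N, x) = 1 / real N"
        using N(1) by (simp add: dist_Pair_Pair dist_real_def diff_divide_distrib[symmetric] add_divide_distrib)
      then have "dist (H (real k / real N) x) (H (real (Suc k) / real N) x) < m"
        using e(2)[of "(real (Suc k) / real N, x)" "(real k / real N, x)"] x t N(2) by simp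
      also have "m \<le> norm (H (real k / real N) x)" using m(2)[of "(real k / real N, x)"] x t by simp
      finally show "norm (H (real k / real N) x - H (real (Suc k) / real N) x) < norm (H (real k / real N) x)"
        by (simp add: dist_norm)
    qed (use Suc in auto)
  qed
  from this[of N] show ?thesis using N by simp
qed

lemma frontier_subset_Diff:
  assumes "open V" "V \<subseteq> U" shows "frontier V \<subseteq> closure U - V"
  using closure_mono[OF assms(2)] assms(1) by (auto simp: frontier_def interior_open)

text \<open>One \<open>g\<close> represents \<open>F\<close> on all of \<open>K\<close>, hence on
  every frontier involved. Since \<open>norm (g x) > 1\<close> on \<open>K\<close>, the degree
  integrand vanishes there, and its integral over \<open>U\<close> splits into those over the sets
  \<open>V i\<close>.\<close>

lemma has_degree_additive:
  fixes F :: "real^'n \<Rightarrow> real^'n"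
  assumes d: "\<And>i. i \<in> I \<Longrightarrow> has_degree F (V i) (d i)" and U: "open U" "bounded U"
    and V: "\<And>i. i \<in> I \<Longrightarrow> open (V i)" "\<And>i. i \<in> I \<Longrightarrow> V i \<subseteq> U" "disjoint_family_on V I" and I: "finite I"
    and cont: "continuous_on (closure U) F" and nz: "\<And>x. x \<in> closure U - (\<Union>i\<in>I. V i) \<Longrightarrow> F x \<noteq> 0"
  shows "has_degree F U (\<Sum>i\<in>I. d i)"
proof -
  define K where "K = closure U - (\<Union>i\<in>I. V i)"
  have cU: "compact (closure U)" using U by (simp add: compact_closure)
  have K: "compact K" unfolding K_def using V(1) by (intro compact_diff cU open_UN) auto
  obtain g c where g: "represents g c F K"
    using represents_exists[OF cU cont K] nz K_def by blast
  have sg: "smooth g" using g by (simp add: represents_def)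
  have fU: "frontier U \<subseteq> K"
    using V(2) frontier_subset_Diff[OF U(1) order_refl] by (auto simp: K_def)
  have fV: "frontier (V i) \<subseteq> K" if i: "i \<in> I" for i
  proof -
    have "frontier (V i) \<inter> V j = {}" if j: "j \<in> I" for j
    proof (cases "j = i")
      case True
      then show ?thesis using V(1)[OF i] by (auto simp: frontier_def interior_open)
    next
      case False
      then have "V i \<inter> V j = {}" using V(3) i j by (auto simp: disjoint_family_on_def)
      then have "closure (V i) \<inter> V j = {}" using V(1)[OF j] by (metis open_Int_closure_eq_empty inf_commute)
      then show ?thesis by (auto simp: frontier_def)
    qed
    then show ?thesis using frontier_subset_Diff[OF V(1,2)] i by (auto simp: K_def)
  qed
  have eq: "deg_integral g (V i) = d i" if "i \<in> I" for i
  proof -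
    have "has_degree F (V i) (deg_integral g (V i))"
      using represents_subset[OF g fV[OF that]] by (auto simp: has_degree_def)
    then show ?thesis
      using has_degree_unique[OF _ d[OF that] V(1)[OF that]] bounded_subset[OF U(2) V(2)[OF that]] by blast
  qed
  let ?k = "\<lambda>x. bump (g x) * jacobian_det g x"
  have k0: "?k x = 0" if "x \<in> K" for x
    using represents_norm_gt_1[OF g that] by (simp add: bump_zero)
  have ck: "continuous_on UNIV ?k"
    by (intro continuous_intros jacobian_det_continuous[OF sg] continuous_on_compose2[OF smooth_continuous[OF bump_smooth, of UNIV] smooth_continuous[OF sg]]) auto
  obtain a where a: "U \<subseteq> cbox (-a) a" using U bounded_subset_cbox_symmetric by blast
  have int: "(\<lambda>x. if x \<in> V i then ?k x else 0) integrable_on UNIV" if "i \<in> I" for i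
  proof -
    have "continuous_on UNIV (\<lambda>x. if x \<in> V i then ?k x else 0)"
      using V(1) that fV[OF that] k0 by (intro continuous_on_extend_zero_UNIV ck) auto
    then have "(\<lambda>x. if x \<in> V i then ?k x else 0) absolutely_integrable_on UNIV"
      by (rule continuous_compact_support_integrable(1)[where a = "-a" and b = a]) (use a V(2)[OF that] in auto)
    then show ?thesis by (simp add: absolutely_integrable_on_def)
  qed
  have "(if x \<in> U then ?k x else 0) = (\<Sum>i\<in>I. if x \<in> V i then ?k x else 0)" for x
  proof (cases "\<exists>i\<in>I. x \<in> V i")
    case True
    then obtain i where i: "i \<in> I" "x \<in> V i" by blast
    then have "(x \<in> V j) = (j = i)" if "j \<in> I" for j using V(3) that by (auto simp: disjoint_family_on_def)
    then have "(\<Sum>j\<in>I. if x \<in> V j then ?k x else 0) = (\<Sum>j\<in>I. if j = i then ?k x else 0)"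
      by (intro sum.cong) auto
    then show ?thesis using i I V(2) by auto
  next
    case False
    then have z: "x \<in> U \<Longrightarrow> ?k x = 0" using k0[of x] closure_subset[of U] unfolding K_def by blast
    have "(\<Sum>j\<in>I. if x \<in> V j then ?k x else 0) = 0" using False by (intro sum.neutral) auto
    then show ?thesis using z by auto
  qed
  then have "deg_integral g U = (\<Sum>i\<in>I. deg_integral g (V i))"
    unfolding deg_integral_def by (simp only: integral_sum[OF I int])
  also have "\<dots> = (\<Sum>i\<in>I. d i)" using eq by simp
  finally show ?thesis
    using represents_subset[OF g fU] by (auto simp: has_degree_def)
qed

lemma has_degree_excision:
  fixes F :: "real^'n \<Rightarrow> real^'n"
  assumes "has_degree F V d" "open U" "bounded U" "open V" "V \<subseteq> U"
    "continuous_on (closure U) F" "\<And>x. x \<in> closure U - V \<Longrightarrow> F x \<noteq> 0"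
  shows "has_degree F U d"
  using has_degree_additive[of "{()}" F "\<lambda>_. V" "\<lambda>_. d" U] assms
  by (auto simp: disjoint_family_on_def)

section \<open>The degree of linear maps and at regular values\<close>

lemma has_degree_linear:
  fixes L :: "real^'n \<Rightarrow> real^'n"
  assumes L: "linear L" and det: "det (matrix L) \<noteq> 0" and r: "r > 0"
  shows "has_degree (\<lambda>x. L (x - z)) (ball z r) (sgn (det (matrix L)))"
proof -
  obtain B where B: "B > 0" "\<And>x. B * norm x \<le> norm (L x)" using linear_bounded_below[OF L det] by blast
  \<comment> \<open>This scale gives \<open>norm (M (x - z)) \<ge> 2\<close> off the ball. On the
    sphere that exceeds the margin 1, and off the ball it makes the bump vanish, so the integral may
    be extended to the whole space.\<close>
  define c where "c = 2 / (B * r)"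
  have c: "c > 0" using B r by (simp add: c_def)
  define M where "M x = c *\<^sub>R L x" for x
  have M: "linear M" unfolding M_def by (rule linear_compose_scale_right[OF L])
  have blM: "bounded_linear M" using M by (simp add: linear_conv_bounded_linear)
  have "matrix M = c *\<^sub>R matrix L" by (simp add: matrix_def M_def vec_eq_iff)
  then have "matrix M = (\<chi> i. c *s (matrix L $ i))" by (simp add: vec_eq_iff)
  then have detM: "det (matrix M) = c ^ CARD('n) * det (matrix L)"
    using det_rows_mul[of "\<lambda>_. c" "\<lambda>i. matrix L $ i"] by simp
  define g where "g x = M (x - z)" for x
  have sg: "smooth g"
  proof -
    have "smooth (\<lambda>x. M x - M z)"
      by (rule smooth_diff_const) (use Ck_linear[OF blM] in \<open>auto simp: smooth_def\<close>)
    then show ?thesis unfolding g_def[abs_def] by (simp add: linear_diff[OF M])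
  qed
  have big: "c * norm (L (x - z)) \<ge> 2" if "norm (x - z) \<ge> r" for x
  proof -
    have "c * (B * r) \<le> c * norm (L (x - z))"
      using B(2)[of "x - z"] mult_left_mono[OF that, of B] B(1) c by (intro mult_left_mono) linarith+
    then show ?thesis using B r by (simp add: c_def)
  qed
  have "represents g c (\<lambda>x. L (x - z)) (frontier (ball z r))"
    using big c sg r by (force simp: represents_def g_def M_def dist_norm norm_minus_commute)
  moreover have "deg_integral g (ball z r) = sgn (det (matrix L))"
  proof -
    have "(g has_derivative M) (at x)" for x
      unfolding g_def by (auto intro!: derivative_eq_intros bounded_linear.has_derivative[OF blM])
    then have "frechet_derivative g (at x) = M" for x by (metis frechet_derivative_at)
    then have J: "jacobian_det g x = det (matrix M)" for x by (simp add: jacobian_det_def)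
    have "(if x \<in> ball z r then bump (g x) * jacobian_det g x else 0) = det (matrix M) * bump (M (x - z))" for x
    proof (cases "x \<in> ball z r")
      case False
      then have "norm (x - z) \<ge> r" by (simp add: dist_norm norm_minus_commute)
      from big[OF this] have "norm (M (x - z)) \<ge> 1" using c by (simp add: M_def)
      then show ?thesis using False by (simp add: bump_zero)
    qed (simp add: J g_def)
    then have "deg_integral g (ball z r) = det (matrix M) * integral UNIV (\<lambda>x. bump (M (x - z)))"
      by (simp add: deg_integral_def)
    also have "integral UNIV (\<lambda>x. bump (M (x - z))) = integral UNIV (\<lambda>x. bump (M x))"
    proof -
      have cM: "continuous_on UNIV (\<lambda>x. bump (M x))"
        by (rule continuous_linear_compose[OF smooth_continuous[OF bump_smooth] M])
      then have cM': "continuous_on UNIV (\<lambda>x. bump (M (x - z)))"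
        by (rule continuous_on_compose2[where g = "\<lambda>x. bump (M x)"]) (auto intro!: continuous_intros)
      have M0: "bump (M x) = 0" if "norm x \<ge> r" for x
      proof -
        have "norm (M x) \<ge> 1" using big[of "x + z"] that c by (simp add: M_def)
        then show ?thesis by (rule bump_zero)
      qed
      obtain a where a: "cball 0 r \<union> cball z r \<subseteq> cbox (-a) a"
        using bounded_subset_cbox_symmetric[OF bounded_Un[THEN iffD2]] by (metis bounded_cball)
      have "bump (M x) = 0" "bump (M (x - z)) = 0" if "x \<notin> cbox (-a) a" for x
        using that a M0[of x] M0[of "x - z"] by (force simp: dist_norm norm_minus_commute)+
      from continuous_compact_support_integrable(4)[OF cM this(1)] continuous_compact_support_integrable(4)[OF cM' this(2)]
      show ?thesis using lborel_integral_translate[OF borel_measurable_continuous_onI[OF cM], of "-z"] by simp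
    qed
    also have "det (matrix M) * integral UNIV (\<lambda>x. bump (M x)) = sgn (det (matrix M))"
    proof -
      have nz: "det (matrix M) \<noteq> 0" using detM det c by simp
      have "\<bar>det (matrix M)\<bar> * integral UNIV (\<lambda>x. bump (M x)) = 1" by (rule integral_bump_linear[OF M nz])
      then have "sgn (det (matrix M)) * (\<bar>det (matrix M)\<bar> * integral UNIV (\<lambda>x. bump (M x))) = sgn (det (matrix M))" by simp
      then show ?thesis by (metis mult.assoc mult_sgn_abs)
    qed
    also have "\<dots> = sgn (det (matrix L))" using c by (simp add: detM sgn_mult)
    finally show ?thesis .
  qed
  ultimately show ?thesis by (auto simp: has_degree_def)
qed

text \<open>Near \<open>x\<close> the linearisation error is at most half of the lower bound
  \<open>B * norm (z - x)\<close>, so Rouche compares \<open>g\<close> with its derivative. All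
  radii up to \<open>r\<close> are covered because the finitely many preimages of a value have to
  share one radius.\<close>

lemma has_degree_local:
  fixes g :: "real^'n \<Rightarrow> real^'n"
  assumes g: "smooth g" and U: "open U" "x \<in> U" and det: "jacobian_det g x \<noteq> 0"
  shows "\<exists>r>0. cball x r \<subseteq> U \<and> (\<forall>z\<in>cball x r. g z = g x \<longrightarrow> z = x)
    \<and> (\<forall>s. 0 < s \<longrightarrow> s \<le> r \<longrightarrow> has_degree (\<lambda>z. g z - g x) (ball x s) (sgn (jacobian_det g x)))"
proof -
  define L where "L = frechet_derivative g (at x)"
  have dL: "(g has_derivative L) (at x)" unfolding L_def by (rule smooth_has_derivative[OF g])
  have L: "linear L" by (rule has_derivative_linear[OF dL])
  have detL: "det (matrix L) = jacobian_det g x" by (simp add: jacobian_det_def L_def)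
  obtain B where B: "B > 0" "\<And>x. B * norm x \<le> norm (L x)"
    using linear_bounded_below[OF L] det unfolding detL by blast
  obtain d where d: "d > 0" "\<And>z. norm (z - x) < d \<Longrightarrow> norm (g z - g x - L (z - x)) \<le> B / 2 * norm (z - x)"
    using dL half_gt_zero[OF B(1)] unfolding has_derivative_at_alt by blast
  obtain r0 where r0: "r0 > 0" "cball x r0 \<subseteq> U" using U open_contains_cball by metis
  define r where "r = min r0 (d / 2)"
  have r: "r > 0" "r < d" "r \<le> r0" using r0 d by (auto simp: r_def)
  have close: "norm (L (z - x) - (g z - g x)) < norm (L (z - x))" if "z \<in> cball x r" "z \<noteq> x" for z
  proof -
    have "norm (z - x) < d" using that r by (simp add: dist_norm norm_minus_commute)
    from d(2)[OF this] have "norm (L (z - x) - (g z - g x)) \<le> B / 2 * norm (z - x)"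
      by (simp add: norm_minus_commute)
    also have "\<dots> < B * norm (z - x)" using B(1) that by simp
    finally show ?thesis using B(2)[of "z - x"] by linarith
  qed
  show ?thesis
  proof (intro exI[of _ r] conjI ballI allI impI r(1))
    show "cball x r \<subseteq> U" using subset_trans[OF subset_cball[OF r(3)] r0(2)] .
    show "z = x" if "z \<in> cball x r" "g z = g x" for z
      using close[OF that(1)] that(2) by auto
    fix s assume s: "0 < s" "s \<le> r"
    have "has_degree (\<lambda>z. L (z - x)) (ball x s) (sgn (jacobian_det g x))"
      using has_degree_linear[OF L _ s(1), of x] det unfolding detL by blast
    then show "has_degree (\<lambda>z. g z - g x) (ball x s) (sgn (jacobian_det g x))"
    proof (rule has_degree_Rouche)
      show "continuous_on (frontier (ball x s)) (\<lambda>z. L (z - x))"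
        by (intro linear_continuous_on_compose[OF _ L] continuous_intros)
      show "continuous_on (frontier (ball x s)) (\<lambda>z. g z - g x)"
        by (intro continuous_intros smooth_continuous[OF g])
      show "norm (L (z - x) - (g z - g x)) < norm (L (z - x))" if "z \<in> frontier (ball x s)" for z
        using that s by (intro close) auto
    qed auto
  qed
qed

text \<open>Regular preimages are isolated, hence finite in number in the compact closure. With
  \<open>m\<close> below all isolation radii, balls of radius \<open>m / 2\<close> are disjoint, and
  the degree is the sum of the local ones.\<close>

lemma has_degree_regular_value:
  fixes g :: "real^'n \<Rightarrow> real^'n"
  assumes g: "smooth g" and U: "open U" "bounded U"
    and bd: "\<And>x. x \<in> frontier U \<Longrightarrow> g x \<noteq> y" and reg: "\<And>x. x \<in> U \<Longrightarrow> g x = y \<Longrightarrow> jacobian_det g x \<noteq> 0"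
  shows "has_degree (\<lambda>x. g x - y) U (\<Sum>x | x \<in> U \<and> g x = y. sgn (jacobian_det g x))"
proof -
  define Z where "Z = {x. x \<in> U \<and> g x = y}"
  have ex: "\<exists>r>0. cball x r \<subseteq> U \<and> (\<forall>z\<in>cball x r. g z = y \<longrightarrow> z = x)
      \<and> (\<forall>s. 0 < s \<longrightarrow> s \<le> r \<longrightarrow> has_degree (\<lambda>z. g z - y) (ball x s) (sgn (jacobian_det g x)))"
    if "x \<in> Z" for x
  proof -
    have x: "x \<in> U" "g x = y" using that by (auto simp: Z_def)
    show ?thesis using has_degree_local[OF g U(1) x(1) reg[OF x]] by (simp only: x(2))
  qed
  obtain r where r': "\<forall>x\<in>Z. r x > 0 \<and> cball x (r x) \<subseteq> U \<and> (\<forall>z\<in>cball x (r x). g z = y \<longrightarrow> z = x)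
      \<and> (\<forall>s. 0 < s \<longrightarrow> s \<le> r x \<longrightarrow> has_degree (\<lambda>z. g z - y) (ball x s) (sgn (jacobian_det g x)))"
    using bchoice[OF ballI[OF ex]] ..
  have r: "\<And>x. x \<in> Z \<Longrightarrow> r x > 0" "\<And>x. x \<in> Z \<Longrightarrow> cball x (r x) \<subseteq> U"
    "\<And>x z. x \<in> Z \<Longrightarrow> z \<in> cball x (r x) \<Longrightarrow> g z = y \<Longrightarrow> z = x"
    "\<And>x s. x \<in> Z \<Longrightarrow> 0 < s \<Longrightarrow> s \<le> r x \<Longrightarrow> has_degree (\<lambda>z. g z - y) (ball x s) (sgn (jacobian_det g x))"
    using r' by simp_all
  have Z_eq: "Z = {x \<in> closure U. g x = y}"
    using bd closure_subset[of U] U(1) by (auto simp: Z_def frontier_def interior_open)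
  have "closed {x. g x = y}" by (intro closed_Collect_eq continuous_intros smooth_continuous[OF g])
  then have "closed (closure U \<inter> {x. g x = y})" by (intro closed_Int) auto
  then have clZ: "closed Z" by (simp add: Z_eq Collect_conj_eq)
  have finZ: "finite Z"
  proof (rule ccontr)
    assume "infinite Z"
    moreover have "compact (closure U)" using U by (simp add: compact_closure)
    ultimately obtain x where x: "x islimpt Z"
      unfolding compact_eq_Bolzano_Weierstrass using Z_eq by (metis (no_types, lifting) mem_Collect_eq subsetI)
    then have xZ: "x \<in> Z" using clZ closed_limpt by blast
    then obtain z where "z \<in> Z" "z \<noteq> x" "dist z x < r x"
      using x r(1) islimpt_approachable by blast
    then show False using r(3)[OF xZ, of z] by (auto simp: Z_def dist_commute)
  qed
  obtain m where m: "m > 0" "\<And>x. x \<in> Z \<Longrightarrow> m \<le> r x"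
    by (rule compact_positive_minorant[of Z r]) (use finZ r(1) in \<open>auto intro: finite_imp_compact continuous_on_finite\<close>)
  show ?thesis unfolding Z_def[symmetric]
  proof (rule has_degree_additive[where V = "\<lambda>x. ball x (m / 2)"])
    show "has_degree (\<lambda>x. g x - y) (ball x (m / 2)) (sgn (jacobian_det g x))" if "x \<in> Z" for x
      using r(4)[OF that, of "m/2"] m(1) m(2)[OF that] by simp
    show "ball x (m / 2) \<subseteq> U" if "x \<in> Z" for x
      using r(2)[OF that] m(1) m(2)[OF that] by (force simp: subset_iff)
    have "ball x (m/2) \<inter> ball x' (m/2) = {}" if "x \<in> Z" "x' \<in> Z" "x \<noteq> x'" for x x'
    proof -
      have "dist x x' > r x" using r(3)[OF that(1), of x'] that by (force simp: Z_def not_le[symmetric])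
      then have "dist x x' \<ge> m" using m(2)[OF that(1)] by linarith
      then show ?thesis by (simp add: disjoint_ballI)
    qed
    then show "disjoint_family_on (\<lambda>x. ball x (m / 2)) Z" by (simp add: disjoint_family_on_def)
    show "continuous_on (closure U) (\<lambda>x. g x - y)" by (intro continuous_intros smooth_continuous[OF g])
    show "g x - y \<noteq> 0" if "x \<in> closure U - (\<Union>x\<in>Z. ball x (m / 2))" for x
    proof
      assume "g x - y = 0"
      then have "x \<in> Z" using that by (auto simp: Z_eq)
      then show False using that m(1) by auto
    qed
  qed (use U finZ in auto)
qed

section \<open>Agreement with the topological degree\<close>

lemma degree_approximant_exists:
  fixes f :: "real^'n \<Rightarrow> real^'n"
  assumes U: "bounded U" and f: "continuous_on (closure U) f" and D: "infdist y (f ` frontier U) > 0"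
  obtains g where "degree_approximant f y U g"
proof -
  define D where "D = infdist y (f ` frontier U)"
  have D0: "D > 0" using D by (simp add: D_def)
  obtain p where p: "smooth p" "\<And>x. x \<in> closure U \<Longrightarrow> norm (p x - f x) < D / 2"
    by (rule smooth_approximation[of "closure U" f "D/2"]) (use U f D0 in \<open>auto simp: compact_closure\<close>)
  \<comment> \<open>A ball is not a null set, so by Sard it contains a regular value
    \<open>w\<close> of \<open>p\<close>. Subtracting \<open>w - y\<close> turns \<open>y\<close>
    into a regular value at a cost below \<open>D / 2\<close>.\<close>
  have "\<not> negligible (ball y (D / 2))" by (rule open_not_negligible) (use D0 in auto)
  then have "\<not> ball y (D / 2) \<subseteq> p ` {x. jacobian_det p x = 0}"
    using negligible_critical_values[OF p(1)] negligible_subset by blast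
  then obtain w where w: "w \<in> ball y (D / 2)" "w \<notin> p ` {x. jacobian_det p x = 0}" by blast
  define g where "g x = p x - (w - y)" for x
  have g: "smooth g" unfolding g_def by (rule smooth_diff_const[OF p(1)])
  have "(g has_derivative frechet_derivative p (at x)) (at x)" for x
    unfolding g_def using smooth_has_derivative[OF p(1), of x] by (auto intro!: derivative_eq_intros)
  then have "frechet_derivative g (at x) = frechet_derivative p (at x)" for x
    using frechet_derivative_at by metis
  then have J: "jacobian_det g x = jacobian_det p x" for x by (simp add: jacobian_det_def)
  have "degree_approximant f y U g"
    unfolding degree_approximant_def D_def[symmetric]
  proof (intro conjI ballI impI g)
    fix x assume x: "x \<in> closure U"
    have "g x - f x = (p x - f x) - (w - y)" by (simp add: g_def)
    then have "norm (g x - f x) \<le> norm (p x - f x) + norm (w - y)" using norm_triangle_ineq4 by metis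
    also have "norm (w - y) < D / 2" using w(1) by (simp add: dist_norm norm_minus_commute)
    finally show "dist (g x) (f x) < D" using p(2)[OF x] by (simp add: dist_norm)
  next
    fix x assume "g x = y"
    then show "jacobian_det g x \<noteq> 0" using w(2) by (auto simp: g_def J)
  qed
  then show ?thesis by (rule that)
qed

lemma has_degree_topological_degree:
  fixes f :: "real^'n \<Rightarrow> real^'n"
  assumes U: "open U" "bounded U" "U \<noteq> {}" and f: "continuous_on (closure U) f"
    and y: "y \<notin> f ` frontier U"
  shows "has_degree (\<lambda>x. f x - y) U (real_of_int (topological_degree f y U))"
proof -
  \<comment> \<open>The frontier has to be nonempty because \<open>infdist\<close> to the empty set
    is 0, which would leave no room for approximants.\<close>
  have fr: "frontier U \<subseteq> closure U" and fr2: "frontier U \<noteq> {}"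
    using U not_bounded_UNIV[where 'a = "real^'n"] frontier_eq_empty[of U] by (auto simp: frontier_def)
  have cf: "continuous_on (frontier U) f" using f fr continuous_on_subset by blast
  have cl: "closed (f ` frontier U)"
    using cf U compact_frontier_bounded compact_continuous_image compact_imp_closed by blast
  have D: "infdist y (f ` frontier U) > 0"
    using infdist_pos_not_in_closed[OF cl _ y] fr2 by blast
  have cfy: "continuous_on (frontier U) (\<lambda>x. f x - y)" by (intro continuous_intros cf)
  obtain d where d: "has_degree (\<lambda>x. f x - y) U d"
    by (rule has_degree_exists[OF U(2) cfy]) (use y in auto)
  have S: "(\<Sum>x | x \<in> U \<and> g x = y. sgn (jacobian_det g x)) = d" if g: "degree_approximant f y U g" for g
  proof -
    have sg: "smooth g" using g by (simp add: degree_approximant_def)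
    have lt: "dist (g x) (f x) < norm (f x - y)" if x: "x \<in> frontier U" for x
    proof -
      have "dist (g x) (f x) < infdist y (f ` frontier U)" using g x fr by (auto simp: degree_approximant_def)
      also have "\<dots> \<le> dist y (f x)" using x by (intro infdist_le) auto
      finally show ?thesis by (simp add: dist_norm norm_minus_commute)
    qed
    have "has_degree (\<lambda>x. g x - y) U (\<Sum>x | x \<in> U \<and> g x = y. sgn (jacobian_det g x))"
      by (rule has_degree_regular_value[OF sg U(1,2)])
        (use lt g in \<open>force simp: degree_approximant_def dist_commute dist_norm[symmetric]\<close>)+
    moreover have "has_degree (\<lambda>x. g x - y) U d"
      by (rule has_degree_Rouche[OF d U(1,2) cfy])
        (use lt in \<open>auto intro!: continuous_intros smooth_continuous[OF sg] simp: dist_norm norm_minus_commute\<close>)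
    ultimately show ?thesis using has_degree_unique U by blast
  qed
  \<comment> \<open>An approximant must exist: it shows that \<open>d\<close> is an integer, and
    without one the description in \<open>topological_degree\<close> would hold for every
    integer.\<close>
  obtain g where g: "degree_approximant f y U g" by (rule degree_approximant_exists[OF U(2) f D])
  have "(\<Sum>x | x \<in> U \<and> g x = y. sgn (jacobian_det g x)) \<in> \<int>"
    by (intro Ints_sum) (auto simp: sgn_if)
  then have "d \<in> \<int>" using S[OF g] by simp
  then obtain k where k: "d = real_of_int k" by (elim Ints_cases)
  have "topological_degree f y U = k"
    unfolding topological_degree_def
    by (rule the_equality) (use S k g in \<open>auto simp: S\<close>)
  then show ?thesis using d k by simp
qed

text \<open>On a small sphere around \<open>z\<close> the homotopy moves the first argument of
  \<open>f\<close> from \<open>x\<close> to \<open>A x\<close> and the second from \<open>z\<close>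
  to \<open>B x\<close>, within the convex set \<open>C\<close>. The difference of the arguments
  keeps a positive inner product with \<open>x - z\<close>, so they stay distinct, and injectivity
  passes this on to the values. Excision leads from the ball to \<open>U\<close>.\<close>

lemma has_degree_of_difference:
  fixes f A B :: "real^'n \<Rightarrow> real^'n"
  assumes d: "has_degree (\<lambda>x. f x - f z) (ball z \<rho>) d" and \<rho>: "\<rho> > 0"
    and C: "convex C" and f: "continuous_on C f" "inj_on f C"
    and U: "open U" "bounded U" and A: "continuous_on (closure U) A" "A ` closure U \<subseteq> C"
    and B: "continuous_on (closure U) B" "B ` closure U \<subseteq> C" and ball: "cball z \<rho> \<subseteq> C" "cball z \<rho> \<subseteq> U"
    and zero: "\<And>x. x \<in> closure U \<Longrightarrow> A x = B x \<Longrightarrow> x = z"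
    and pos: "\<And>x. x \<in> cball z \<rho> \<Longrightarrow> x \<noteq> z \<Longrightarrow> (A x - B x) \<bullet> (x - z) > 0"
  shows "has_degree (\<lambda>x. f (A x) - f (B x)) U d"
proof -
  define a b where "a t x = (1 - t) *\<^sub>R x + t *\<^sub>R A x" and "b t x = (1 - t) *\<^sub>R z + t *\<^sub>R B x" for t x
  have sub: "frontier (ball z \<rho>) \<subseteq> closure U" "frontier (ball z \<rho>) \<subseteq> cball z \<rho>"
    using \<rho> ball(2) closure_subset[of U] by auto
  have zC: "z \<in> C" using ball(1) \<rho> by auto
  have in_C: "a t x \<in> C" "b t x \<in> C" if "t \<in> {0..1}" "x \<in> frontier (ball z \<rho>)" for t x
  proof -
    have x: "x \<in> closure U" "x \<in> C" using that sub ball(1) by auto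
    then have "A x \<in> C" "B x \<in> C" using A(2) B(2) by auto
    then show "a t x \<in> C" "b t x \<in> C"
      unfolding a_def b_def using that(1) x zC by (auto intro!: convexD[OF C])
  qed
  have c2: "continuous_on ({0..1} \<times> frontier (ball z \<rho>)) (\<lambda>w. K (snd w))"
    if "continuous_on (closure U) K" for K :: "real^'n \<Rightarrow> real^'n"
    by (rule continuous_on_compose2[OF that]) (use sub in \<open>auto intro!: continuous_intros\<close>)
  have ca: "continuous_on ({0..1} \<times> frontier (ball z \<rho>)) (\<lambda>w. a (fst w) (snd w))"
    and cb: "continuous_on ({0..1} \<times> frontier (ball z \<rho>)) (\<lambda>w. b (fst w) (snd w))"
    unfolding a_def b_def by (intro continuous_intros c2 A B)+
  have "has_degree (\<lambda>x. f (a 1 x) - f (b 1 x)) (ball z \<rho>) d"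
  proof (rule has_degree_homotopy[where H = "\<lambda>t x. f (a t x) - f (b t x)"])
    show "has_degree (\<lambda>x. f (a 0 x) - f (b 0 x)) (ball z \<rho>) d" using d by (simp add: a_def b_def)
    show "continuous_on ({0..1} \<times> frontier (ball z \<rho>)) (\<lambda>(t, x). f (a t x) - f (b t x))"
      unfolding case_prod_unfold
      by (intro continuous_on_diff continuous_on_compose2[OF f(1) ca] continuous_on_compose2[OF f(1) cb])
         (use in_C in auto)
    fix t x assume t: "t \<in> {0..1::real}" and x: "x \<in> frontier (ball z \<rho>)"
    have xz: "x \<in> cball z \<rho>" "x \<noteq> z" using x \<rho> by auto
    have "(a t x - b t x) \<bullet> (x - z) = (1 - t) * ((x - z) \<bullet> (x - z)) + t * ((A x - B x) \<bullet> (x - z))"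
      by (simp add: a_def b_def inner_diff_left inner_add_left algebra_simps)
    moreover have "(1 - t) * ((x - z) \<bullet> (x - z)) + t * ((A x - B x) \<bullet> (x - z)) > 0"
    proof (cases "t = 1")
      case False
      then have "(1 - t) * ((x - z) \<bullet> (x - z)) > 0" using t xz by simp
      moreover have "t * ((A x - B x) \<bullet> (x - z)) \<ge> 0" using t pos[OF xz] by simp
      ultimately show ?thesis by linarith
    qed (use pos[OF xz] in simp)
    ultimately have "a t x \<noteq> b t x" by auto
    then show "f (a t x) - f (b t x) \<noteq> 0" using in_C[OF t x] f(2) by (auto dest: inj_onD)
  qed auto
  then have "has_degree (\<lambda>x. f (A x) - f (B x)) (ball z \<rho>) d" by (simp add: a_def b_def)
  then show ?thesis
  proof (rule has_degree_excision)
    show "ball z \<rho> \<subseteq> U" using ball(2) by auto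
    show "continuous_on (closure U) (\<lambda>x. f (A x) - f (B x))"
      by (intro continuous_on_diff continuous_on_compose2[OF f(1)] A B)
    show "f (A x) - f (B x) \<noteq> 0" if "x \<in> closure U - ball z \<rho>" for x
    proof
      assume "f (A x) - f (B x) = 0"
      then have "A x = B x" using f(2) A(2) B(2) that by (auto dest!: inj_onD[OF f(2)])
      then show False using zero[of x] that \<rho> by auto
    qed
  qed (use U in auto)
qed

section \<open>Linked loops in a lattice\<close>

text \<open>The half-side 2 makes room for the square loop of side 2 in
  \<open>grid_crossing_3\<close>, which passes through 0 and extends to the coordinate - 2.\<close>

definition grid_box :: "(real^'n) set" where
  "grid_box = {x. \<forall>i. \<bar>x $ i\<bar> \<le> 2}"

text \<open>The one-skeleton of the integer lattice within the box; \<open>k\<close> is the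
  direction of the edge.\<close>

definition grid :: "(real^'n) set" where
  "grid = {x \<in> grid_box. \<exists>k. \<forall>i. i \<noteq> k \<longrightarrow> x $ i \<in> \<int>}"

text \<open>A lattice line in direction \<open>k\<close> meets the box in a segment whose midpoint
  has \<open>p $ k = 0\<close>. Measuring from the midpoint treats every such segment once and as a
  whole.\<close>

definition grid_oscillation :: "(real^'n \<Rightarrow> 'b::real_normed_vector) \<Rightarrow> real \<Rightarrow> bool" where
  "grid_oscillation u \<delta> \<longleftrightarrow> (\<forall>p k s. p \<in> grid_box \<longrightarrow> (\<forall>i. p $ i \<in> \<int>) \<longrightarrow> p $ k = 0 \<longrightarrow> \<bar>s\<bar> \<le> 2 \<longrightarrow>
     norm (u (p + s *\<^sub>R axis k 1) - u p) \<le> \<delta>)"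

text \<open>A walk from 0 to \<open>x\<close> changes one coordinate at a time and leaves the
  possibly non-integral coordinate \<open>k\<close> to the end. Each of the \<open>CARD('n)\<close>
  moves then starts at a lattice point whose coordinate in the direction of the move is 0.\<close>

lemma grid_oscillation_norm_le:
  fixes u :: "real^'n \<Rightarrow> 'b::real_normed_vector"
  assumes osc: "grid_oscillation u \<delta>" and x: "x \<in> grid"
  shows "norm (u x - u 0) \<le> real CARD('n) * \<delta>"
proof -
  obtain k where k: "\<And>i. i \<noteq> k \<Longrightarrow> x $ i \<in> \<int>" and xb: "\<And>i. \<bar>x $ i\<bar> \<le> 2"
    using x by (auto simp: grid_def grid_box_def)
  define v where "v S = (\<chi> i. if i \<in> S then x $ i else 0)" for S
  have step: "norm (u (v (insert j S)) - u (v S)) \<le> \<delta>" if "j \<notin> S" "k \<notin> S" for j S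
  proof -
    have "v (insert j S) = v S + (x $ j) *\<^sub>R axis j 1"
      using that by (auto simp: v_def vec_eq_iff axis_def)
    moreover have "x $ i \<in> \<int>" if "i \<in> S" for i using k[of i] that \<open>k \<notin> S\<close> by blast
    then have "v S \<in> grid_box" "\<forall>i. v S $ i \<in> \<int>" "v S $ j = 0"
      using xb \<open>j \<notin> S\<close> by (auto simp: v_def grid_box_def)
    ultimately show ?thesis using osc xb[of j] unfolding grid_oscillation_def by metis
  qed
  have "norm (u (v S) - u (v {})) \<le> real (card S) * \<delta>" if "finite S" "k \<notin> S" for S
    using that
  proof (induction rule: finite_induct)
    case (insert j S)
    have "norm (u (v (insert j S)) - u (v {})) \<le> norm (u (v (insert j S)) - u (v S)) + norm (u (v S) - u (v {}))"
      using norm_triangle_ineq[of "u (v (insert j S)) - u (v S)" "u (v S) - u (v {})"] by simp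
    also have "\<dots> \<le> \<delta> + real (card S) * \<delta>"
      using step[of j S] insert by (intro add_mono) auto
    finally show ?case using insert by (simp add: algebra_simps)
  qed simp
  from this[of "UNIV - {k}"] have "norm (u (v (UNIV - {k})) - u (v {})) \<le> real (CARD('n) - 1) * \<delta>"
    by (simp add: card_Diff_singleton)
  moreover have "norm (u (v (insert k (UNIV - {k}))) - u (v (UNIV - {k}))) \<le> \<delta>" by (rule step) auto
  moreover have "norm (u (v (insert k (UNIV - {k}))) - u (v {})) \<le> norm (u (v (insert k (UNIV - {k}))) - u (v (UNIV - {k}))) + norm (u (v (UNIV - {k})) - u (v {}))"
    using norm_triangle_ineq[of "u (v (insert k (UNIV - {k}))) - u (v (UNIV - {k}))" "u (v (UNIV - {k})) - u (v {})"] by simp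
  moreover have "v (insert k (UNIV - {k})) = x" "v {} = 0" by (auto simp: v_def vec_eq_iff)
  moreover have "real (CARD('n) - 1) = real CARD('n) - 1" by (simp add: of_nat_diff)
  ultimately show ?thesis by (simp add: algebra_simps)
qed

text \<open>The data for \<open>has_degree_of_difference\<close> with \<open>z = 0\<close> and
  \<open>C = grid_box\<close>, together with the requirement that the frontier is mapped into the
  edges, where oscillation is under control.\<close>

definition grid_crossing :: "(real^'n) set \<Rightarrow> (real^'n \<Rightarrow> real^'n) \<Rightarrow> (real^'n \<Rightarrow> real^'n) \<Rightarrow> real \<Rightarrow> bool" where
  "grid_crossing U A B \<rho> \<longleftrightarrow> open U \<and> bounded U \<and> continuous_on (closure U) A \<and> continuous_on (closure U) B \<and>
     A ` closure U \<subseteq> grid_box \<and> B ` closure U \<subseteq> grid_box \<and> \<rho> > 0 \<and> cball 0 \<rho> \<subseteq> U \<inter> grid_box \<and>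
     (\<forall>x\<in>closure U. A x = B x \<longrightarrow> x = 0) \<and> (\<forall>x\<in>cball 0 \<rho>. x \<noteq> 0 \<longrightarrow> (A x - B x) \<bullet> x > 0) \<and>
     A ` frontier U \<subseteq> grid \<and> B ` frontier U \<subseteq> grid"

text \<open>In the plane the frontier of a square already consists of edges: one coordinate is 1 or
  - 1 and only the other is free. So the identity and the constant 0 suffice.\<close>

lemma grid_crossing_2:
  assumes "CARD('n) = 2"
  obtains U :: "(real^'n) set" and A B \<rho> where "grid_crossing U A B \<rho>"
proof -
  define U :: "(real^'n) set" where "U = {x. \<forall>i. \<bar>x $ i\<bar> < 1}"
  have U_box: "U = box (- 1) 1" by (auto simp: U_def mem_box_cart abs_less_iff)
  have cU: "closure U \<subseteq> {x. \<forall>i. \<bar>x $ i\<bar> \<le> 1}"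
  proof -
    have "closure U \<subseteq> cbox (-1) 1" unfolding U_box by (meson box_subset_cbox closed_cbox closure_minimal)
    then show ?thesis by (auto simp: mem_box_cart abs_le_iff)
  qed
  have small: "\<bar>x $ i\<bar> \<le> 1/2" if "x \<in> cball 0 (1/2)" for x :: "real^'n" and i
    using component_le_norm_cart[of x i] that by simp
  have fr: "x \<in> grid" if x: "x \<in> frontier U" for x
  proof -
    have xb: "\<bar>x $ i\<bar> \<le> 1" for i using x cU by (auto simp: frontier_def)
    have "x \<notin> U" using x by (simp add: frontier_def U_box interior_open[OF open_box])
    then obtain i where "\<not> \<bar>x $ i\<bar> < 1" by (auto simp: U_def)
    with xb[of i] have "\<bar>x $ i\<bar> = 1" by linarith
    then have "x $ i = 1 \<or> x $ i = - 1" by linarith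
    then have i: "x $ i \<in> \<int>" by auto
    obtain a b :: 'n where ab: "UNIV = {a, b}" using assms by (auto simp: card_2_iff)
    have "i = a \<or> i = b" using ab UNIV_I[of i] by blast
    then obtain k where "UNIV = {i, k}" using ab by blast
    then have "\<forall>j. j \<noteq> k \<longrightarrow> j = i" by (metis UNIV_I insertE singletonD)
    then have "\<exists>k. \<forall>j. j \<noteq> k \<longrightarrow> x $ j \<in> \<int>" using i by metis
    moreover have "x \<in> grid_box" using order_trans[OF xb, of 2] by (simp add: grid_box_def)
    ultimately show ?thesis by (simp add: grid_def)
  qed
  have "grid_crossing U (\<lambda>x. x) (\<lambda>_. 0) (1/2)"
    unfolding grid_crossing_def
  proof (intro conjI)
    show "open U" "bounded U" unfolding U_box by auto
    show "(\<lambda>x. x) ` closure U \<subseteq> grid_box" using cU order_trans[of _ 1 2] by (force simp: grid_box_def)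
    show "cball 0 (1/2) \<subseteq> U \<inter> grid_box"
      using order_le_less_trans[OF small, of _ 1] order_trans[OF small, of _ 2] by (auto simp: U_def grid_box_def)
    show "(\<lambda>x. x) ` frontier U \<subseteq> grid" using fr by auto
  qed (auto simp: grid_box_def grid_def)
  then show ?thesis by (rule that)
qed

text \<open>
  \<open>A\<close> maps the solid square torus \<open>U\<close> onto its cross section, a square in the \<open>a\<close>-\<open>c\<close>-plane, and
  \<open>B\<close> onto its core, a square loop in the \<open>a\<close>-\<open>b\<close>-plane which meets the former square in \<open>0\<close> only.
  So the degree of \<open>f \<circ> A - f \<circ> B\<close> is the linking number of the images under \<open>f\<close> of
  the two linked loops \<open>A ` frontier U\<close> and \<open>B ` U\<close>.
\<close>

lemma grid_crossing_3:
  assumes "CARD('n) = 3"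
  obtains U :: "(real^'n) set" and A B \<rho> where "grid_crossing U A B \<rho>"
proof -
  obtain a b c :: 'n where abc: "UNIV = {a, b, c}" and ne: "a \<noteq> b" "a \<noteq> c" "b \<noteq> c"
    using assms by (auto simp: card_3_iff)
  have all: "(\<forall>i. P i) \<longleftrightarrow> P a \<and> P b \<and> P c" for P using abc by (metis UNIV_I insertE singletonD)
  \<comment> \<open>The max-norm distance in the \<open>a\<close>-\<open>b\<close>-plane from the
    point with \<open>a = - 2\<close> and \<open>b = 0\<close>. Thus 0 lies on the core
    \<open>\<sigma> x = 2\<close>, and near 0 simply \<open>\<sigma> x = x $ a + 2\<close>.\<close>
  define \<sigma> where "\<sigma> x = max \<bar>x $ a + 2\<bar> \<bar>x $ b\<bar>" for x :: "real^'n"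
  define U where "U = {x :: real^'n. 1 < \<sigma> x \<and> \<sigma> x < 3 \<and> \<bar>x $ c\<bar> < 1}"
  define A where "A x = (\<chi> i. if i = a then \<sigma> x - 2 else if i = c then x $ c else 0)" for x
  \<comment> \<open>Radial projection onto a square loop of half-side 1, shifted so that the loop
    passes through 0. The minus sign reflects the loop in \<open>b\<close>; this gives
    \<open>A - B\<close> the component \<open>x $ b / \<sigma> x\<close> and hence the right
    orientation at 0.\<close>
  define B where "B x = (\<chi> i. if i = a then (x $ a + 2) / \<sigma> x - 1 else if i = b then - (x $ b) / \<sigma> x else 0)" for x
  have c\<sigma>: "continuous_on S \<sigma>" for S unfolding \<sigma>_def by (intro continuous_intros)
  have opU: "open U"
    unfolding U_def by (intro open_Collect_conj open_Collect_less continuous_intros c\<sigma>)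
  have clU: "closure U \<subseteq> {x. 1 \<le> \<sigma> x \<and> \<sigma> x \<le> 3 \<and> \<bar>x $ c\<bar> \<le> 1}"
    by (rule closure_minimal) (auto simp: U_def intro!: closed_Collect_conj closed_Collect_le continuous_intros c\<sigma>)
  have b\<sigma>: "1 \<le> \<sigma> x" "\<sigma> x \<le> 3" "\<bar>x $ c\<bar> \<le> 1" if "x \<in> closure U" for x using clU that by auto
  have ratio: "\<bar>(x $ a + 2) / \<sigma> x\<bar> \<le> 1" "\<bar>x $ b / \<sigma> x\<bar> \<le> 1" if "x \<in> closure U" for x
    using b\<sigma>(1)[OF that] by (auto simp: \<sigma>_def abs_mult divide_le_eq_1)
  have bdU: "bounded U"
  proof (rule bounded_subset[OF bounded_cbox])
    have "\<bar>x $ a\<bar> \<le> 5 \<and> \<bar>x $ b\<bar> \<le> 5 \<and> \<bar>x $ c\<bar> \<le> 5" if "x \<in> U" for x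
      using that by (auto simp: U_def \<sigma>_def)
    then show "U \<subseteq> cbox (\<chi> i. -5) (\<chi> i. 5)" by (force simp: mem_box_cart all abs_le_iff)
  qed
  have small: "\<bar>x $ i\<bar> \<le> 1/2" if "x \<in> cball 0 (1/2)" for x :: "real^'n" and i
    using component_le_norm_cart[of x i] that by simp
  have \<sigma>_small: "\<sigma> x = x $ a + 2" if "x \<in> cball 0 (1/2)" for x
    using small[OF that, of a] small[OF that, of b] by (auto simp: \<sigma>_def max_def)
  have "grid_crossing U A B (1/2)"
    unfolding grid_crossing_def
  proof (intro conjI ballI impI)
    show "continuous_on (closure U) A"
      unfolding A_def
    proof (rule continuous_on_vec_lambda)
      show "continuous_on (closure U) (\<lambda>x. if i = a then \<sigma> x - 2 else if i = c then x $ c else 0)" for i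
        by (cases "i = a"; cases "i = c") (auto intro!: continuous_intros c\<sigma>)
    qed
    show "continuous_on (closure U) B"
      unfolding B_def
    proof (rule continuous_on_vec_lambda)
      have nz: "\<sigma> x \<noteq> 0" if "x \<in> closure U" for x using b\<sigma>[OF that] by linarith
      show "continuous_on (closure U) (\<lambda>x. if i = a then (x $ a + 2) / \<sigma> x - 1 else if i = b then - (x $ b) / \<sigma> x else 0)" for i
        by (cases "i = a"; cases "i = b") (auto intro!: continuous_intros c\<sigma> nz)
    qed
    show A_box: "A ` closure U \<subseteq> grid_box"
      using b\<sigma> ne by (force simp: grid_box_def A_def all abs_le_iff)
    show B_box: "B ` closure U \<subseteq> grid_box"
    proof
      fix y assume "y \<in> B ` closure U"
      then obtain x where x: "x \<in> closure U" "y = B x" by blast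
      have "(x $ a + 2) / \<sigma> x \<le> 1" "- 1 \<le> (x $ a + 2) / \<sigma> x" "x $ b / \<sigma> x \<le> 1" "- 1 \<le> x $ b / \<sigma> x"
        using ratio[OF x(1)] by linarith+
      then show "y \<in> grid_box"
        using ne unfolding x(2) by (auto simp: grid_box_def B_def all abs_le_iff)
    qed
    show "cball 0 (1/2) \<subseteq> U \<inter> grid_box"
    proof
      fix x :: "real^'n" assume x: "x \<in> cball 0 (1/2)"
      have "x \<in> U" using small[OF x, of a] small[OF x, of c] by (auto simp: U_def \<sigma>_small[OF x] abs_le_iff)
      moreover have "x \<in> grid_box" using order_trans[OF small[OF x], of 2] by (auto simp: grid_box_def)
      ultimately show "x \<in> U \<inter> grid_box" by simp
    qed
    show "x = 0" if x: "x \<in> closure U" and eq: "A x = B x" for x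
    proof -
      have e: "A x $ a = B x $ a" "A x $ b = B x $ b" "A x $ c = B x $ c" using eq by auto
      have s: "\<sigma> x \<noteq> 0" using b\<sigma>[OF x] by linarith
      have xb: "x $ b = 0" and xc: "x $ c = 0" using e(2,3) ne s by (auto simp: A_def B_def)
      have s2: "\<sigma> x - 2 = (x $ a + 2) / \<sigma> x - 1" using e(1) ne by (simp add: A_def B_def)
      have abs: "\<sigma> x = \<bar>x $ a + 2\<bar>" by (simp add: \<sigma>_def xb)
      \<comment> \<open>This excludes the far side of the loop, where \<open>B x\<close> has
        coordinate - 2 in direction \<open>a\<close>, whereas that of \<open>A x\<close> is at least
        - 1.\<close>
      have "x $ a + 2 > 0"
      proof (rule ccontr)
        assume "\<not> x $ a + 2 > 0"
        then have "x $ a + 2 = - \<sigma> x" using abs by linarith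
        then have "\<sigma> x - 2 = - 1 - 1" using s2 s by simp
        then show False using b\<sigma>(1)[OF x] by linarith
      qed
      then have "x $ a + 2 = \<sigma> x" using abs by linarith
      then have "\<sigma> x = 2" using s2 s by simp
      then have "x $ a = 0" using \<open>x $ a + 2 = \<sigma> x\<close> by simp
      then show ?thesis using xb xc by (simp add: vec_eq_iff all)
    qed
    show "(A x - B x) \<bullet> x > 0" if x: "x \<in> cball 0 (1/2)" and nz: "x \<noteq> 0" for x
    proof -
      have p: "x $ a + 2 > 0" using small[OF x, of a] by linarith
      have "(A x - B x) \<bullet> x = (x $ a)\<^sup>2 + (x $ b)\<^sup>2 / (x $ a + 2) + (x $ c)\<^sup>2"
        using p ne by (simp add: inner_vec_def abc A_def B_def \<sigma>_small[OF x] power2_eq_square)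
      moreover have "x $ a \<noteq> 0 \<or> x $ b \<noteq> 0 \<or> x $ c \<noteq> 0" using nz by (simp add: vec_eq_iff all)
      moreover have "(x $ b)\<^sup>2 / (x $ a + 2) \<ge> 0" using p by simp
      moreover have "x $ b \<noteq> 0 \<Longrightarrow> (x $ b)\<^sup>2 / (x $ a + 2) > 0" using p by simp
      ultimately show ?thesis
        by (smt (verit) zero_le_power2 zero_less_power2)
    qed
    have fr: "x \<in> closure U" "x \<notin> U" if "x \<in> frontier U" for x
      using that opU by (auto simp: frontier_def interior_open)
    show "A ` frontier U \<subseteq> grid"
    proof
      fix y assume "y \<in> A ` frontier U"
      then obtain x where x: "x \<in> frontier U" "y = A x" by blast
      have "\<sigma> x = 1 \<or> \<sigma> x = 3 \<or> \<bar>x $ c\<bar> = 1"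
        using b\<sigma>[OF fr(1)[OF x(1)]] fr(2)[OF x(1)] by (auto simp: U_def)
      then have "\<sigma> x = 1 \<or> \<sigma> x = 3 \<or> x $ c = 1 \<or> x $ c = - 1" by linarith
      then have "A x $ a \<in> \<int> \<or> A x $ c \<in> \<int>"
        using ne by (auto simp: A_def)
      moreover have "A x $ b \<in> \<int>" using ne by (simp add: A_def)
      ultimately have "\<exists>k. \<forall>i. i \<noteq> k \<longrightarrow> A x $ i \<in> \<int>"
        unfolding all using exI[of _ a] exI[of _ c] by blast
      then show "y \<in> grid" using A_box fr(1)[OF x(1)] x(2) by (auto simp: grid_def)
    qed
    show "B ` frontier U \<subseteq> grid"
    proof
      fix y assume "y \<in> B ` frontier U"
      then obtain x where x: "x \<in> frontier U" "y = B x" by blast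
      have s: "\<sigma> x \<ge> 1" using b\<sigma>[OF fr(1)[OF x(1)]] by simp
      have "\<bar>x $ a + 2\<bar> = \<sigma> x \<or> \<bar>x $ b\<bar> = \<sigma> x" by (auto simp: \<sigma>_def max_def)
      then have "(x $ a + 2) / \<sigma> x = 1 \<or> (x $ a + 2) / \<sigma> x = -1 \<or> x $ b / \<sigma> x = 1 \<or> x $ b / \<sigma> x = -1"
        using s by (auto simp: abs_if divide_eq_eq eq_divide_eq split: if_splits)
      then have "B x $ a \<in> \<int> \<or> B x $ b \<in> \<int>"
        using ne by (auto simp: B_def)
      moreover have "B x $ c \<in> \<int>" using ne by (simp add: B_def)
      ultimately have "\<exists>k. \<forall>i. i \<noteq> k \<longrightarrow> B x $ i \<in> \<int>"
        unfolding all using exI[of _ a] exI[of _ b] by blast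
      then show "y \<in> grid" using B_box fr(1)[OF x(1)] x(2) by (auto simp: grid_def)
    qed
  qed (use opU bdU in auto)
  then show ?thesis by (rule that)
qed

lemma grid_box_convex: "convex (grid_box :: (real^'n) set)"
proof -
  have "\<bar>t\<bar> \<le> 2 \<longleftrightarrow> - 2 \<le> t \<and> t \<le> 2" for t :: real by linarith
  then have "grid_box = cbox (\<chi> i. - 2) (\<chi> i::'n. 2)"
    by (simp add: grid_box_def mem_box_cart set_eq_iff)
  then show ?thesis by (metis convex_box(1))
qed

text \<open>The threshold \<open>\<eta>\<close> is fixed by \<open>L\<close> and the crossing,
  before domain, map, centre and scale, so that a scale can later be chosen to meet it.
  \<open>has_degree_of_difference\<close> is used with the same data for \<open>f\<close> and for
  \<open>L\<close>, and Rouche equates the two degrees.\<close>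

lemma det_pos_of_grid_oscillation:
  fixes L :: "real^'n^'n"
  assumes card: "CARD('n) = 2 \<or> CARD('n) = 3" and L: "det L \<noteq> 0"
  shows "\<exists>\<eta>>0. \<forall>\<Omega> (f :: real^'n \<Rightarrow> real^'n) x' r. r > 0 \<longrightarrow> sense_preserving \<Omega> f \<longrightarrow>
     continuous_on \<Omega> f \<longrightarrow> inj_on f \<Omega> \<longrightarrow> (\<lambda>y. x' + r *\<^sub>R y) ` grid_box \<subseteq> \<Omega> \<longrightarrow>
     grid_oscillation (\<lambda>y. f (x' + r *\<^sub>R y) - L *v (r *\<^sub>R y)) (\<eta> * r) \<longrightarrow> det L > 0"
proof -
  have "\<exists>U A B \<rho>. grid_crossing (U :: (real^'n) set) A B \<rho>"
    using card
  proof
    assume "CARD('n) = 2"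
    then show ?thesis by (rule grid_crossing_2) (intro exI)
  next
    assume "CARD('n) = 3"
    then show ?thesis by (rule grid_crossing_3) (intro exI)
  qed
  then obtain U :: "(real^'n) set" and A B \<rho> where cr: "grid_crossing U A B \<rho>" by (elim exE)
  have U: "open U" "bounded U" and A: "continuous_on (closure U) A" "A ` closure U \<subseteq> grid_box"
    and B: "continuous_on (closure U) B" "B ` closure U \<subseteq> grid_box" and \<rho>: "\<rho> > 0"
    and ball: "cball 0 \<rho> \<subseteq> U" "cball 0 \<rho> \<subseteq> (grid_box :: (real^'n) set)"
    and zero: "\<And>x. x \<in> closure U \<Longrightarrow> A x = B x \<Longrightarrow> x = 0"
    and pos: "\<And>x. x \<in> cball 0 \<rho> \<Longrightarrow> x \<noteq> 0 \<Longrightarrow> (A x - B x) \<bullet> x > 0"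
    and grid: "A ` frontier U \<subseteq> grid" "B ` frontier U \<subseteq> grid"
    using cr unfolding grid_crossing_def by auto
  have fr: "x \<in> closure U" "x \<notin> U" if "x \<in> frontier U" for x
    using that U by (auto simp: frontier_def interior_open)
  have injL: "inj ((*v) L)"
    using det_nz_iff_inj[OF matrix_vector_mul_linear, of L] L by simp
  have L0: "L *v w \<noteq> 0" if "w \<noteq> 0" for w
    using injD[OF injL, of w 0] that by auto
  have zU: "0 \<in> U" using ball \<rho> by auto
  obtain M where M: "M > 0" "\<And>x. x \<in> frontier U \<Longrightarrow> M \<le> norm (L *v (A x - B x))"
  proof (rule compact_positive_minorant[of "frontier U" "\<lambda>x. norm (L *v (A x - B x))"])
    show "compact (frontier U)" using U compact_frontier_bounded by blast
    show "continuous_on (frontier U) (\<lambda>x. norm (L *v (A x - B x)))"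
      using A B fr by (intro continuous_on_norm matrix_vector_mult_linear_continuous_on linear_continuous_on_compose[OF _ matrix_vector_mul_linear] continuous_on_diff)
        (auto intro: continuous_on_subset)
    show "norm (L *v (A x - B x)) > 0" if "x \<in> frontier U" for x
    proof -
      have "A x \<noteq> B x" using zero[of x] fr[OF that] zU by blast
      then show ?thesis using L0[of "A x - B x"] by simp
    qed
  qed blast
  \<comment> \<open>\<open>M\<close> is a lower bound of \<open>norm (L *v (A x - B x))\<close> on
    the frontier. The two edge points contribute at most \<open>CARD('n) * \<eta>\<close> each,
    together \<open>M / 2\<close>, up to the common factor \<open>r\<close>.\<close>
  define \<eta> where "\<eta> = M / (4 * real CARD('n))"
  have \<eta>: "\<eta> > 0" "2 * (real CARD('n) * \<eta>) < M" using M(1) by (auto simp: \<eta>_def)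
  have "det L > 0"
    if r: "r > 0" and sp: "sense_preserving \<Omega> f" and f: "continuous_on \<Omega> f" "inj_on f \<Omega>"
      and sub: "(\<lambda>y. x' + r *\<^sub>R y) ` grid_box \<subseteq> \<Omega>"
      and osc: "grid_oscillation (\<lambda>y. f (x' + r *\<^sub>R y) - L *v (r *\<^sub>R y)) (\<eta> * r)"
    for \<Omega> and f :: "real^'n \<Rightarrow> real^'n" and x' r
  proof -
    \<comment> \<open>\<open>T\<close> undoes the dilation, so \<open>A'\<close> and
      \<open>B'\<close> are the crossing transplanted to the centre \<open>x'\<close> and the scale
      \<open>r\<close>.\<close>
    define T where "T z = (1 / r) *\<^sub>R (z - x')" for z
    define C where "C = (\<lambda>y. x' + r *\<^sub>R y) ` (grid_box :: (real^'n) set)"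
    define V where "V = T -` U"
    define A' B' where "A' z = x' + r *\<^sub>R A (T z)" and "B' z = x' + r *\<^sub>R B (T z)" for z
    have T_inv: "x' + r *\<^sub>R T z = z" for z using r by (simp add: T_def)
    have cT: "continuous_on S T" for S unfolding T_def by (intro continuous_intros)
    have C: "convex C" unfolding C_def by (rule convex_affinity[OF grid_box_convex])
    have CO: "C \<subseteq> \<Omega>" using sub by (simp add: C_def)
    have V: "open V" unfolding V_def by (rule open_vimage[OF U(1) cT])
    have clV: "T z \<in> closure U" if "z \<in> closure V" for z
    proof -
      have "closure V \<subseteq> T -` closure U"
        unfolding V_def by (intro closure_minimal vimage_mono closure_subset closed_vimage cT closed_closure)
      then show ?thesis using that by blast
    qed
    have frV: "T z \<in> frontier U" if "z \<in> frontier V" for z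
      using that clV[of z] V U by (auto simp: frontier_def interior_open V_def)
    have bdV: "bounded V"
    proof (rule bounded_subset)
      show "bounded ((\<lambda>y. x' + y) ` (\<lambda>y. r *\<^sub>R y) ` U)" by (intro bounded_translation bounded_scaling U)
      show "V \<subseteq> (\<lambda>y. x' + y) ` (\<lambda>y. r *\<^sub>R y) ` U"
        using T_inv by (auto simp: V_def image_image) (metis image_eqI)
    qed
    have cA: "continuous_on (closure V) A'" and cB: "continuous_on (closure V) B'"
      unfolding A'_def B'_def using clV
      by (auto intro!: continuous_intros continuous_on_compose2[OF A(1) cT] continuous_on_compose2[OF B(1) cT])
    have iA: "A' ` closure V \<subseteq> C" and iB: "B' ` closure V \<subseteq> C"
      by (rule image_subsetI, unfold A'_def C_def, rule imageI, use clV A(2) in blast)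
         (rule image_subsetI, unfold B'_def C_def, rule imageI, use clV B(2) in blast)
    have Tball: "T z \<in> cball 0 \<rho>" if "z \<in> cball x' (r * \<rho>)" for z
      using that r by (simp add: T_def dist_norm norm_minus_commute divide_le_eq mult.commute)
    have ballC: "cball x' (r * \<rho>) \<subseteq> C"
    proof
      fix z assume "z \<in> cball x' (r * \<rho>)"
      then have "T z \<in> grid_box" using Tball ball(2) by blast
      then show "z \<in> C" unfolding C_def using T_inv[of z] by (metis imageI)
    qed
    have ballV: "cball x' (r * \<rho>) \<subseteq> V" using Tball ball(1) unfolding V_def by blast
    have zero': "z = x'" if "z \<in> closure V" "A' z = B' z" for z
    proof -
      have "A (T z) = B (T z)" using that(2) r by (simp add: A'_def B'_def)
      then have "T z = 0" using zero clV[OF that(1)] by blast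
      then show ?thesis using T_inv[of z] by simp
    qed
    have pos': "(A' z - B' z) \<bullet> (z - x') > 0" if "z \<in> cball x' (r * \<rho>)" "z \<noteq> x'" for z
    proof -
      have "T z \<noteq> 0" using T_inv[of z] that(2) by auto
      from pos[OF Tball[OF that(1)] this] have "r * r * ((A (T z) - B (T z)) \<bullet> T z) > 0" using r by simp
      moreover have "z - x' = r *\<^sub>R T z" using T_inv[of z] by (simp add: algebra_simps)
      ultimately show ?thesis by (simp add: A'_def B'_def scaleR_diff_right[symmetric])
    qed
    have r\<rho>: "r * \<rho> > 0" using r \<rho> by simp
    have fC: "continuous_on C f" "inj_on f C" using f CO continuous_on_subset inj_on_subset by blast+
    have "has_degree (\<lambda>x. f x - f x') (ball x' (r * \<rho>)) 1"
    proof -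
      have x'C: "x' \<in> C" using ballC r\<rho> by auto
      have cl: "closure (ball x' (r * \<rho>)) = cball x' (r * \<rho>)" using r\<rho> by simp
      have "topological_degree f (f x') (ball x' (r * \<rho>)) = 1"
        using sp r\<rho> x'C CO ballC unfolding sense_preserving_def by (auto simp: cl subset_iff)
      moreover have "has_degree (\<lambda>x. f x - f x') (ball x' (r * \<rho>))
          (real_of_int (topological_degree f (f x') (ball x' (r * \<rho>))))"
      proof (rule has_degree_topological_degree)
        show "continuous_on (closure (ball x' (r * \<rho>))) f" unfolding cl using fC ballC continuous_on_subset by blast
        show "f x' \<notin> f ` frontier (ball x' (r * \<rho>))"
        proof
          assume "f x' \<in> f ` frontier (ball x' (r * \<rho>))"
          then obtain z where z: "dist x' z = r * \<rho>" "f x' = f z" using r\<rho> by auto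
          then have "z \<in> C" using ballC by auto
          then have "x' = z" using inj_onD[OF fC(2) z(2) x'C] by simp
          then have "dist x' z = 0" by simp
          then show False using z(1) r\<rho> by linarith
        qed
      qed (use r\<rho> in auto)
      ultimately show ?thesis by simp
    qed
    then have degf: "has_degree (\<lambda>x. f (A' x) - f (B' x)) V 1"
      by (rule has_degree_of_difference[OF _ r\<rho> C fC V bdV cA iA cB iB ballC ballV zero' pos'])
    have matL: "matrix ((*v) L) = L" by (rule matrix_of_matrix_vector_mul)
    have "has_degree (\<lambda>x. L *v (x - x')) (ball x' (r * \<rho>)) (sgn (det L))"
      using has_degree_linear[OF matrix_vector_mul_linear _ r\<rho>, of L x'] L unfolding matL by blast
    then have "has_degree (\<lambda>x. L *v x - L *v x') (ball x' (r * \<rho>)) (sgn (det L))"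
      by (simp add: matrix_vector_mult_diff_distrib)
    then have degL: "has_degree (\<lambda>x. L *v (A' x) - L *v (B' x)) V (sgn (det L))"
      by (rule has_degree_of_difference[OF _ r\<rho> C _ _ V bdV cA iA cB iB ballC ballV zero' pos'])
         (use injL in \<open>auto intro: matrix_vector_mult_linear_continuous_on inj_on_subset\<close>)
    define u where "u y = f (x' + r *\<^sub>R y) - L *v (r *\<^sub>R y)" for y
    have "has_degree (\<lambda>x. f (A' x) - f (B' x)) V (sgn (det L))"
    proof (rule has_degree_Rouche[OF degL V bdV])
      have sub: "frontier V \<subseteq> closure V" by (auto simp: frontier_def)
      have cA': "continuous_on (frontier V) A'" and cB': "continuous_on (frontier V) B'"
        using cA cB sub continuous_on_subset by blast+
      show "continuous_on (frontier V) (\<lambda>x. L *v A' x - L *v B' x)"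
        by (intro continuous_on_diff linear_continuous_on_compose[OF _ matrix_vector_mul_linear] cA' cB')
      show "continuous_on (frontier V) (\<lambda>x. f (A' x) - f (B' x))"
        by (intro continuous_on_diff continuous_on_compose2[OF fC(1) cA'] continuous_on_compose2[OF fC(1) cB'])
          (use iA iB sub in blast)+
      fix z assume z: "z \<in> frontier V"
      let ?y = "T z"
      have g: "A ?y \<in> grid" "B ?y \<in> grid" using grid frV[OF z] by blast+
      have "norm (u (A ?y) - u (B ?y)) \<le> norm (u (A ?y) - u 0) + norm (u (B ?y) - u 0)"
        using norm_triangle_ineq4[of "u (A ?y) - u 0" "u (B ?y) - u 0"] by simp
      also have "\<dots> \<le> real CARD('n) * (\<eta> * r) + real CARD('n) * (\<eta> * r)"
        using grid_oscillation_norm_le[OF osc g(1)] grid_oscillation_norm_le[OF osc g(2)]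
        unfolding u_def[symmetric] by (intro add_mono)
      also have "\<dots> = 2 * (real CARD('n) * \<eta>) * r" by simp
      also have "\<dots> < M * r" using \<eta>(2) r by (intro mult_strict_right_mono)
      finally have 1: "norm (u (A ?y) - u (B ?y)) < M * r" .
      have e: "L *v A' z - L *v B' z = r *\<^sub>R (L *v (A ?y - B ?y))"
        by (simp add: A'_def B'_def matrix_vector_right_distrib matrix_vector_mult_diff_distrib
            matrix_vector_mult_scaleR scaleR_diff_right)
      have "M * r \<le> norm (L *v A' z - L *v B' z)"
        unfolding e using M(2)[OF frV[OF z]] r by (simp add: mult.commute)
      moreover have "u (A ?y) - u (B ?y) = (f (A' z) - f (B' z)) - (L *v A' z - L *v B' z)"
        by (simp add: u_def A'_def B'_def matrix_vector_right_distrib)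
      then have "norm (L *v A' z - L *v B' z - (f (A' z) - f (B' z))) = norm (u (A ?y) - u (B ?y))"
        by (metis norm_minus_commute)
      ultimately show "norm (L *v A' z - L *v B' z - (f (A' z) - f (B' z))) < norm (L *v A' z - L *v B' z)"
        using 1 by linarith
    qed
    then have "sgn (det L) = 1" using has_degree_unique[OF degf _ V bdV] by simp
    then show ?thesis by (simp add: sgn_1_pos)
  qed
  then show ?thesis using \<eta>(1) by (intro exI[of _ \<eta>]) blast
qed

section \<open>Total variation and singular part\<close>

lemma borel_subsets_eq_sets:
  "\<Omega> \<in> sets borel \<Longrightarrow> borel_subsets \<Omega> = sets (restrict_space borel \<Omega>)"
  by (auto simp: borel_subsets_def sets_restrict_space_iff)

lemma sigma_algebra_borel_subsets: "\<Omega> \<in> sets borel \<Longrightarrow> sigma_algebra \<Omega> (borel_subsets \<Omega>)"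
  using sets.sigma_algebra_axioms[of "restrict_space borel \<Omega>"]
  by (simp add: borel_subsets_eq_sets space_restrict_space)

lemma borel_subsets_mono: "A \<subseteq> B \<Longrightarrow> borel_subsets A \<subseteq> borel_subsets B"
  by (auto simp: borel_subsets_def)

lemma borel_subsets_intros [intro]:
  "{} \<in> borel_subsets A" "B \<in> borel_subsets A \<Longrightarrow> C \<in> borel_subsets A \<Longrightarrow> B \<inter> C \<in> borel_subsets A"
  "B \<in> borel_subsets A \<Longrightarrow> C \<in> borel_subsets A \<Longrightarrow> B - C \<in> borel_subsets A"
  "B \<in> borel_subsets A \<Longrightarrow> C \<in> borel_subsets A \<Longrightarrow> B \<union> C \<in> borel_subsets A"
  by (auto simp: borel_subsets_def)

lemma vector_measure_empty:
  assumes "vector_measure \<Omega> \<nu>" shows "\<nu> {} = 0"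
proof -
  have "range (\<lambda>i::nat. {}) \<subseteq> borel_subsets \<Omega> \<and> disjoint_family (\<lambda>i::nat. {})"
    by (auto simp: disjoint_family_on_def)
  then have "(\<lambda>i::nat. \<nu> {}) sums \<nu> (\<Union>i::nat. {})"
    using assms unfolding vector_measure_def by blast
  then show ?thesis by (auto dest: sums_summable simp: summable_const_iff)
qed

lemma vector_measure_Un:
  assumes "vector_measure \<Omega> \<nu>" "B \<in> borel_subsets \<Omega>" "C \<in> borel_subsets \<Omega>" "B \<inter> C = {}"
  shows "\<nu> (B \<union> C) = \<nu> B + \<nu> C"
proof -
  have "range (binaryset B C) \<subseteq> borel_subsets \<Omega> \<and> disjoint_family (binaryset B C)"
    using assms(2-4) by (auto simp: range_binaryset_eq disjoint_family_on_def binaryset_def split: if_splits)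
  then have "(\<lambda>i. \<nu> (binaryset B C i)) sums \<nu> (\<Union>i. binaryset B C i)"
    using assms(1) unfolding vector_measure_def by blast
  moreover have "(\<lambda>i. \<nu> (binaryset B C i)) sums (\<nu> B + \<nu> C)"
    by (rule binaryset_sums[of \<nu>, OF vector_measure_empty[OF assms(1)]])
  ultimately show ?thesis by (simp add: UN_binaryset_eq sums_unique2)
qed

lemma vector_measure_Diff:
  assumes "vector_measure \<Omega> \<nu>" "B \<in> borel_subsets \<Omega>" "C \<in> borel_subsets \<Omega>" "C \<subseteq> B"
  shows "\<nu> B = \<nu> C + \<nu> (B - C)"
  using vector_measure_Un[OF assms(1,3), of "B - C"] assms by (auto simp: Un_absorb1)

lemma vector_measure_uminus: "vector_measure \<Omega> \<nu> \<Longrightarrow> vector_measure \<Omega> (\<lambda>B. - \<nu> B)"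
  unfolding vector_measure_def by (auto intro: sums_minus)

lemma vector_measure_entry:
  fixes \<mu> :: "'a::topological_space set \<Rightarrow> real^'n^'m"
  shows "vector_measure \<Omega> \<mu> \<Longrightarrow> vector_measure \<Omega> (\<lambda>B. \<mu> B $ i $ j)"
  unfolding vector_measure_def
  by (auto intro!: bounded_linear.sums[OF bounded_linear_vec_nth] bounded_linear.sums[OF bounded_linear_vec_nth, of "\<lambda>B. \<mu> _ $ i"])

section \<open>The Jordan decomposition of a real-valued measure\<close>

definition pos_part :: "('a::topological_space set \<Rightarrow> real) \<Rightarrow> 'a set \<Rightarrow> ennreal" where
  "pos_part \<nu> B = (SUP C \<in> borel_subsets B. ennreal (\<nu> C))"

lemma pos_part_upper: "C \<in> borel_subsets B \<Longrightarrow> ennreal (\<nu> C) \<le> pos_part \<nu> B"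
  unfolding pos_part_def by (rule SUP_upper)

lemma pos_part_mono: "A \<subseteq> B \<Longrightarrow> pos_part \<nu> A \<le> pos_part \<nu> B"
  unfolding pos_part_def by (rule SUP_subset_mono[OF borel_subsets_mono]) auto

text \<open>The union of competitors \<open>D\<close> for \<open>B\<close> and \<open>E\<close> for
  \<open>C\<close> competes for \<open>B \<union> C\<close>. A competitor of negative value counts
  as 0 in \<open>ennreal\<close> and is dropped instead, which accounts for the four sign
  cases.\<close>

lemma pos_part_superadditive:
  assumes \<nu>: "vector_measure \<Omega> \<nu>" and B: "B \<subseteq> \<Omega>" "C \<subseteq> \<Omega>" "B \<inter> C = {}"
  shows "pos_part \<nu> B + pos_part \<nu> C \<le> pos_part \<nu> (B \<union> C)"
proof -
  have "ennreal (\<nu> D) + ennreal (\<nu> E) \<le> pos_part \<nu> (B \<union> C)"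
    if D: "D \<in> borel_subsets B" and E: "E \<in> borel_subsets C" for D E
  proof -
    have m: "D \<in> borel_subsets (B \<union> C)" "E \<in> borel_subsets (B \<union> C)" "D \<union> E \<in> borel_subsets (B \<union> C)"
      using D E by (auto simp: borel_subsets_def)
    have "\<nu> (D \<union> E) = \<nu> D + \<nu> E"
      using D E B by (intro vector_measure_Un[OF \<nu>]) (auto simp: borel_subsets_def)
    then show ?thesis
      using pos_part_upper[OF m(1), of \<nu>] pos_part_upper[OF m(2), of \<nu>] pos_part_upper[OF m(3), of \<nu>]
      by (cases "\<nu> D \<ge> 0"; cases "\<nu> E \<ge> 0") (simp_all add: ennreal_neg)
  qed
  then have "pos_part \<nu> B + ennreal (\<nu> E) \<le> pos_part \<nu> (B \<union> C)" if "E \<in> borel_subsets C" for E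
    using that unfolding pos_part_def[of \<nu> B]
    by (subst ennreal_SUP_add_left[symmetric]) (auto intro!: SUP_least)
  then show ?thesis
    unfolding pos_part_def[of \<nu> C]
    by (subst ennreal_SUP_add_right) (auto intro!: SUP_least)
qed

lemma ennreal_add_le: "ennreal (a + b) \<le> ennreal a + ennreal b"
  by (cases "a \<ge> 0"; cases "b \<ge> 0") (auto simp: ennreal_neg intro: ennreal_leI)

lemma ennreal_sum_le: "ennreal (\<Sum>i<n. a i) \<le> (\<Sum>i<(n::nat). ennreal (a i))"
proof (induction n)
  case (Suc n)
  have "ennreal (\<Sum>i<Suc n. a i) \<le> ennreal (\<Sum>i<n. a i) + ennreal (a n)"
    using ennreal_add_le by simp
  also have "\<dots> \<le> (\<Sum>i<Suc n. ennreal (a i))" using Suc by (simp add: add_right_mono)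
  finally show ?case .
qed simp

text \<open>One inequality comes from superadditivity on finite unions. For the other, a competitor
  \<open>C\<close> for the whole union is cut into the pieces \<open>C \<inter> A i\<close>.\<close>

lemma pos_part_countably_additive:
  assumes \<nu>: "vector_measure \<Omega> \<nu>"
  shows "countably_additive (borel_subsets \<Omega>) (pos_part \<nu>)"
  unfolding countably_additive_def
proof (intro allI impI antisym)
  fix A :: "nat \<Rightarrow> 'a set"
  assume A: "range A \<subseteq> borel_subsets \<Omega>" "disjoint_family A" "\<Union>(range A) \<in> borel_subsets \<Omega>"
  have AO: "A i \<subseteq> \<Omega>" "A i \<in> sets borel" for i using A(1) by (auto simp: borel_subsets_def)
  have fin: "(\<Sum>i<n. pos_part \<nu> (A i)) \<le> pos_part \<nu> (\<Union>i<n. A i)" for n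
  proof (induction n)
    case (Suc n)
    have "(\<Sum>i<Suc n. pos_part \<nu> (A i)) \<le> pos_part \<nu> (\<Union>i<n. A i) + pos_part \<nu> (A n)"
      using Suc by (simp add: add_right_mono)
    also have "\<dots> \<le> pos_part \<nu> ((\<Union>i<n. A i) \<union> A n)"
    proof (rule pos_part_superadditive[OF \<nu>])
      have "A i \<inter> A n = {}" if "i < n" for i using A(2) that by (auto simp: disjoint_family_on_def)
      then show "(\<Union>i<n. A i) \<inter> A n = {}" by blast
    qed (use AO in auto)
    finally show ?case by (simp add: lessThan_Suc Un_commute)
  qed simp
  show "(\<Sum>i. pos_part \<nu> (A i)) \<le> pos_part \<nu> (\<Union>(range A))"
    unfolding suminf_eq_SUP
  proof (rule SUP_least)
    fix n :: nat
    show "(\<Sum>i<n. pos_part \<nu> (A i)) \<le> pos_part \<nu> (\<Union>(range A))"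
      by (rule order_trans[OF fin pos_part_mono]) auto
  qed
  show "pos_part \<nu> (\<Union>(range A)) \<le> (\<Sum>i. pos_part \<nu> (A i))"
    unfolding pos_part_def[of \<nu> "\<Union>(range A)"]
  proof (rule SUP_least)
    fix C assume C: "C \<in> borel_subsets (\<Union>(range A))"
    have r: "range (\<lambda>i. C \<inter> A i) \<subseteq> borel_subsets \<Omega>" "disjoint_family (\<lambda>i. C \<inter> A i)"
      using C A(2) AO by (auto simp: borel_subsets_def disjoint_family_on_def)
    have CU: "(\<Union>i. C \<inter> A i) = C" using C by (auto simp: borel_subsets_def)
    have "(\<lambda>i. \<nu> (C \<inter> A i)) sums \<nu> C"
      using \<nu> r CU unfolding vector_measure_def by metis
    then have lim: "(\<lambda>n. ennreal (\<Sum>i<n. \<nu> (C \<inter> A i))) \<longlonglongrightarrow> ennreal (\<nu> C)"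
      unfolding sums_def by (rule tendsto_ennrealI)
    have "ennreal (\<Sum>i<n. \<nu> (C \<inter> A i)) \<le> (\<Sum>i. pos_part \<nu> (A i))" for n
    proof -
      have "ennreal (\<Sum>i<n. \<nu> (C \<inter> A i)) \<le> (\<Sum>i<n. ennreal (\<nu> (C \<inter> A i)))" by (rule ennreal_sum_le)
      also have "\<dots> \<le> (\<Sum>i<n. pos_part \<nu> (A i))"
        using C AO by (intro sum_mono pos_part_upper) (auto simp: borel_subsets_def)
      also have "\<dots> \<le> (\<Sum>i. pos_part \<nu> (A i))"
        unfolding suminf_eq_SUP by (rule SUP_upper) simp
      finally show ?thesis .
    qed
    then show "ennreal (\<nu> C) \<le> (\<Sum>i. pos_part \<nu> (A i))"
      by (intro LIMSEQ_le_const2[OF lim]) auto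
  qed
qed

text \<open>\<open>measure_of\<close> assigns 0 to every set unless the given set function is a
  measure; countable additivity of \<open>pos_part\<close> rules this default out.\<close>

lemma
  assumes \<nu>: "vector_measure \<Omega> \<nu>" and \<Omega>: "\<Omega> \<in> sets borel"
  shows space_jordan_pos: "space (jordan_pos \<Omega> \<nu>) = \<Omega>"
    and sets_jordan_pos: "sets (jordan_pos \<Omega> \<nu>) = borel_subsets \<Omega>"
    and emeasure_jordan_pos: "B \<in> borel_subsets \<Omega> \<Longrightarrow> emeasure (jordan_pos \<Omega> \<nu>) B = pos_part \<nu> B"
proof -
  interpret sigma_algebra \<Omega> "borel_subsets \<Omega>" by (rule sigma_algebra_borel_subsets[OF \<Omega>])
  have eq: "jordan_pos \<Omega> \<nu> = measure_of \<Omega> (borel_subsets \<Omega>) (pos_part \<nu>)"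
    by (simp add: jordan_pos_def pos_part_def[abs_def])
  show "space (jordan_pos \<Omega> \<nu>) = \<Omega>" "sets (jordan_pos \<Omega> \<nu>) = borel_subsets \<Omega>"
    unfolding eq by (simp_all add: space_measure_of_conv)
  have "positive (borel_subsets \<Omega>) (pos_part \<nu>)"
    using vector_measure_empty[OF \<nu>] by (auto simp: positive_def pos_part_def borel_subsets_def)
  then show "B \<in> borel_subsets \<Omega> \<Longrightarrow> emeasure (jordan_pos \<Omega> \<nu>) B = pos_part \<nu> B"
    unfolding eq by (intro emeasure_measure_of_sigma sigma_algebra_axioms pos_part_countably_additive[OF \<nu>])
qed

text \<open>
  If the positive part were infinite, one could split off sets on which \<open>\<bar>\<nu>\<bar>\<close> is arbitrarily
  large, one inside the other, contradicting the continuity of \<open>\<nu>\<close> along decreasing sequences.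
\<close>

lemma pos_part_finite:
  assumes \<nu>: "vector_measure \<Omega> \<nu>" and \<Omega>: "\<Omega> \<in> sets borel"
  shows "pos_part \<nu> \<Omega> < \<infinity>"
proof (rule ccontr)
  assume "\<not> pos_part \<nu> \<Omega> < \<infinity>"
  then have inf: "pos_part \<nu> \<Omega> = \<infinity>" by (simp add: less_top[symmetric])
  have step: "\<exists>C. C \<in> borel_subsets \<Omega> \<and> pos_part \<nu> C = \<infinity> \<and> C \<subseteq> B \<and> real n \<le> \<bar>\<nu> C\<bar>"
    if B: "B \<in> borel_subsets \<Omega> \<and> pos_part \<nu> B = \<infinity>" for B n
  proof -
    \<comment> \<open>Because \<open>\<nu> D\<close> exceeds \<open>n\<close> by more than
      \<open>\<bar>\<nu> B\<bar>\<close>, both \<open>D\<close> and \<open>B - D\<close> have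
      measure at least \<open>n\<close> in absolute value. So whichever of them has infinite
      positive part can be kept.\<close>
    have "ennreal (real n + \<bar>\<nu> B\<bar>) < pos_part \<nu> B" using B by simp
    then obtain D where D: "D \<in> borel_subsets B" "ennreal (real n + \<bar>\<nu> B\<bar>) < ennreal (\<nu> D)"
      unfolding pos_part_def less_SUP_iff by blast
    then have nD: "real n + \<bar>\<nu> B\<bar> < \<nu> D" by (subst (asm) ennreal_less_iff) auto
    have D\<Omega>: "D \<in> borel_subsets \<Omega>" "B - D \<in> borel_subsets \<Omega>" "D \<subseteq> B"
      using D B by (auto simp: borel_subsets_def)
    have eq: "\<nu> B = \<nu> D + \<nu> (B - D)" using vector_measure_Diff[OF \<nu>] B D\<Omega> by blast
    have "pos_part \<nu> B \<le> pos_part \<nu> D + pos_part \<nu> (B - D)"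
    proof -
      have "emeasure (jordan_pos \<Omega> \<nu>) (D \<union> (B - D)) \<le> emeasure (jordan_pos \<Omega> \<nu>) D + emeasure (jordan_pos \<Omega> \<nu>) (B - D)"
        using D\<Omega> by (intro emeasure_subadditive) (simp_all add: sets_jordan_pos[OF \<nu> \<Omega>])
      moreover have "D \<union> (B - D) = B" using D\<Omega> by auto
      ultimately show ?thesis using D\<Omega> B by (simp add: emeasure_jordan_pos[OF \<nu> \<Omega>])
    qed
    then have "pos_part \<nu> D = \<infinity> \<or> pos_part \<nu> (B - D) = \<infinity>"
      using B by (simp add: top_unique)
    then show ?thesis
    proof
      assume "pos_part \<nu> D = \<infinity>"
      then show ?thesis using D\<Omega> nD by (intro exI[of _ D]) auto
    next
      assume "pos_part \<nu> (B - D) = \<infinity>"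
      moreover have "real n \<le> \<bar>\<nu> (B - D)\<bar>" using eq nD by linarith
      ultimately show ?thesis using D\<Omega> by (intro exI[of _ "B - D"]) auto
    qed
  qed
  have "\<exists>X. \<forall>n. (X n \<in> borel_subsets \<Omega> \<and> pos_part \<nu> (X n) = \<infinity>) \<and> (X (Suc n) \<subseteq> X n \<and> real n \<le> \<bar>\<nu> (X (Suc n))\<bar>)"
  proof (rule dependent_nat_choice)
    show "\<exists>x. x \<in> borel_subsets \<Omega> \<and> pos_part \<nu> x = \<infinity>"
      using inf \<Omega> by (auto simp: borel_subsets_def)
  qed (use step in blast)
  then obtain X where X: "\<And>n. X n \<in> borel_subsets \<Omega>" "\<And>n. X (Suc n) \<subseteq> X n" "\<And>n. real n \<le> \<bar>\<nu> (X (Suc n))\<bar>"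
    by blast
  \<comment> \<open>The differences are disjoint and their measures telescope, so
    \<open>\<nu> (X n)\<close> converges although it is unbounded.\<close>
  define Y where "Y n = X n - X (Suc n)" for n
  have decr: "X m \<subseteq> X n" if "n \<le> m" for m n
    using lift_Suc_antimono_le[of X, OF X(2) that] .
  have "disjoint_family Y"
  proof -
    have "Y m \<inter> Y n = {}" if "m < n" for m n
      using decr[of "Suc m" n] that by (auto simp: Y_def)
    then show ?thesis unfolding disjoint_family_on_def by (metis inf_commute linorder_neqE_nat)
  qed
  moreover have YO: "range Y \<subseteq> borel_subsets \<Omega>" using X(1) by (auto simp: Y_def)
  ultimately have "(\<lambda>i. \<nu> (Y i)) sums \<nu> (\<Union>i. Y i)" using \<nu> unfolding vector_measure_def by blast
  moreover have "\<nu> (Y i) = \<nu> (X i) - \<nu> (X (Suc i))" for i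
    using vector_measure_Diff[OF \<nu> X(1) X(1) X(2), of i] by (simp add: Y_def)
  ultimately have "(\<lambda>n. \<Sum>i<n. \<nu> (X i) - \<nu> (X (Suc i))) \<longlonglongrightarrow> \<nu> (\<Union>i. Y i)" by (simp add: sums_def)
  moreover have "(\<Sum>i<n. \<nu> (X i) - \<nu> (X (Suc i))) = \<nu> (X 0) - \<nu> (X n)" for n
    by (rule sum_lessThan_telescope')
  ultimately have "(\<lambda>n. \<nu> (X 0) - \<nu> (X n)) \<longlonglongrightarrow> \<nu> (\<Union>i. Y i)" by simp
  then have "(\<lambda>n. \<nu> (X 0) - (\<nu> (X 0) - \<nu> (X n))) \<longlonglongrightarrow> \<nu> (X 0) - \<nu> (\<Union>i. Y i)"
    by (intro tendsto_diff tendsto_const)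
  then have "Bseq (\<lambda>n. \<nu> (X n))" by (intro convergent_imp_Bseq) (auto simp: convergent_def)
  then obtain K where K: "\<And>n. \<bar>\<nu> (X n)\<bar> \<le> K" by (auto simp: Bseq_def)
  obtain n where "K < real n" using reals_Archimedean2 by blast
  then show False using X(3)[of n] K[of "Suc n"] by linarith
qed

lemma finite_measure_jordan_pos:
  assumes "vector_measure \<Omega> \<nu>" "\<Omega> \<in> sets borel"
  shows "finite_measure (jordan_pos \<Omega> \<nu>)"
  by (rule finite_measureI)
     (use pos_part_finite[OF assms] emeasure_jordan_pos[OF assms, of \<Omega>] assms(2) in
      \<open>auto simp: space_jordan_pos[OF assms] borel_subsets_def\<close>)

text \<open>For \<open>C\<close> inside \<open>B\<close>,
  \<open>\<nu> C = \<nu> B - \<nu> (B - C)\<close> is at most \<open>\<nu> B\<close> plus the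
  negative part of \<open>B\<close>. The supremum over \<open>C\<close> gives one inequality, and
  \<open>- \<nu>\<close> in place of \<open>\<nu>\<close> the other.\<close>

lemma jordan_decomposition:
  assumes \<nu>: "vector_measure \<Omega> \<nu>" and \<Omega>: "\<Omega> \<in> sets borel" and B: "B \<in> borel_subsets \<Omega>"
  shows "\<nu> B = measure (jordan_pos \<Omega> \<nu>) B - measure (jordan_pos \<Omega> (\<lambda>B. - \<nu> B)) B"
proof -
  have half: "measure (jordan_pos \<Omega> \<nu>) B \<le> \<nu> B + measure (jordan_pos \<Omega> (\<lambda>B. - \<nu> B)) B"
    if \<nu>: "vector_measure \<Omega> \<nu>" for \<nu>
  proof -
    note \<nu>' = vector_measure_uminus[OF \<nu>]
    let ?q = "measure (jordan_pos \<Omega> (\<lambda>B. - \<nu> B)) B"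
    have q: "pos_part (\<lambda>B. - \<nu> B) B = ennreal ?q"
      using finite_measure.emeasure_eq_measure[OF finite_measure_jordan_pos[OF \<nu>' \<Omega>], of B]
        emeasure_jordan_pos[OF \<nu>' \<Omega> B] by simp
    have le: "\<nu> C \<le> \<nu> B + ?q" if C: "C \<in> borel_subsets B" for C
    proof -
      have "C \<in> borel_subsets \<Omega>" "C \<subseteq> B" "B - C \<in> borel_subsets B"
        using C B by (auto simp: borel_subsets_def)
      then have "\<nu> B = \<nu> C + \<nu> (B - C)" "ennreal (- \<nu> (B - C)) \<le> ennreal ?q"
        using vector_measure_Diff[OF \<nu> B] pos_part_upper[of "B - C" B "\<lambda>B. - \<nu> B"] unfolding q by auto
      then show ?thesis by (simp add: ennreal_le_iff)
    qed
    have nn: "0 \<le> \<nu> B + ?q" using le[of "{}"] vector_measure_empty[OF \<nu>] by auto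
    have "emeasure (jordan_pos \<Omega> \<nu>) B \<le> ennreal (\<nu> B + ?q)"
      unfolding emeasure_jordan_pos[OF \<nu> \<Omega> B] pos_part_def
      by (rule SUP_least) (rule ennreal_leI[OF le])
    then show ?thesis
      using nn finite_measure.emeasure_eq_measure[OF finite_measure_jordan_pos[OF \<nu> \<Omega>], of B]
      by (simp add: ennreal_le_iff)
  qed
  show ?thesis using half[OF \<nu>] half[OF vector_measure_uminus[OF \<nu>]] by simp
qed

text \<open>An identity of signed measures enters with its negative terms moved to the other side,
  which avoids subtraction in \<open>ennreal\<close>. It extends from sets to functions by monotone
  approximation.\<close>

lemma nn_integral_eq_of_sum_emeasure_eq:
  fixes M :: "'i \<Rightarrow> 'a measure" and M' :: "'j \<Rightarrow> 'a measure"
  assumes M: "\<And>i. i \<in> I \<Longrightarrow> sets (M i) = sets N" "\<And>j. j \<in> J \<Longrightarrow> sets (M' j) = sets N"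
    and eq: "\<And>A. A \<in> sets N \<Longrightarrow> (\<Sum>i\<in>I. emeasure (M i) A) = (\<Sum>j\<in>J. emeasure (M' j) A)"
    and u: "u \<in> borel_measurable N"
  shows "(\<Sum>i\<in>I. \<integral>\<^sup>+x. u x \<partial>M i) = (\<Sum>j\<in>J. \<integral>\<^sup>+x. u x \<partial>M' j)"
  using u
proof (induction rule: borel_measurable_induct)
  case (cong f g)
  have sp: "space (M i) = space N" "space (M' j) = space N" if "i \<in> I" "j \<in> J" for i j
    using M that sets_eq_imp_space_eq by metis+
  have "(\<integral>\<^sup>+x. f x \<partial>M i) = (\<integral>\<^sup>+x. g x \<partial>M i)" if "i \<in> I" for i
    using cong(3) sets_eq_imp_space_eq[OF M(1)[OF that]] by (intro nn_integral_cong) simp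
  moreover have "(\<integral>\<^sup>+x. f x \<partial>M' j) = (\<integral>\<^sup>+x. g x \<partial>M' j)" if "j \<in> J" for j
    using cong(3) sets_eq_imp_space_eq[OF M(2)[OF that]] by (intro nn_integral_cong) simp
  ultimately show ?case using cong(4) by (simp cong: sum.cong)
next
  case (set A)
  then show ?case using eq[OF set] M by (simp cong: sum.cong)
next
  case (mult u c)
  then show ?case
    using M by (simp add: nn_integral_cmult measurable_cong_sets[OF M(1) refl] measurable_cong_sets[OF M(2) refl]
        sum_distrib_left[symmetric] cong: sum.cong)
next
  case (add u v)
  then show ?case
    using M by (simp add: nn_integral_add measurable_cong_sets[OF M(1) refl] measurable_cong_sets[OF M(2) refl]
        sum.distrib cong: sum.cong)
next
  case (seq U)
  have mM: "U k \<in> borel_measurable (M i)" if "i \<in> I" for i k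
    using seq(1) measurable_cong_sets[OF M(1)[OF that] refl] by blast
  have mM': "U k \<in> borel_measurable (M' j)" if "j \<in> J" for j k
    using seq(1) measurable_cong_sets[OF M(2)[OF that] refl] by blast
  have inc: "incseq (\<lambda>k. \<integral>\<^sup>+x. U k x \<partial>K)" for K :: "'a measure"
    using seq(3) by (auto simp: incseq_def le_fun_def intro!: nn_integral_mono)
  have 1: "(\<integral>\<^sup>+x. (SUP k. U k) x \<partial>M i) = (SUP k. \<integral>\<^sup>+x. U k x \<partial>M i)" if "i \<in> I" for i
    using nn_integral_monotone_convergence_SUP[OF seq(3) mM[OF that]] by (simp add: SUP_apply image_comp)
  have 2: "(\<integral>\<^sup>+x. (SUP k. U k) x \<partial>M' j) = (SUP k. \<integral>\<^sup>+x. U k x \<partial>M' j)" if "j \<in> J" for j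
    using nn_integral_monotone_convergence_SUP[OF seq(3) mM'[OF that]] by (simp add: SUP_apply image_comp)
  have "(\<Sum>i\<in>I. \<integral>\<^sup>+x. (SUP k. U k) x \<partial>M i) = (\<Sum>i\<in>I. SUP k. \<integral>\<^sup>+x. U k x \<partial>M i)"
    by (intro sum.cong refl 1)
  also have "\<dots> = (SUP k. \<Sum>i\<in>I. \<integral>\<^sup>+x. U k x \<partial>M i)"
    by (rule ennreal_SUP_sum[symmetric]) (rule inc)
  also have "\<dots> = (SUP k. \<Sum>j\<in>J. \<integral>\<^sup>+x. U k x \<partial>M' j)" using seq(5) by simp
  also have "\<dots> = (\<Sum>j\<in>J. SUP k. \<integral>\<^sup>+x. U k x \<partial>M' j)"
    by (rule ennreal_SUP_sum) (rule inc)
  also have "\<dots> = (\<Sum>j\<in>J. \<integral>\<^sup>+x. (SUP k. U k) x \<partial>M' j)"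
    by (intro sum.cong refl 2[symmetric])
  finally show ?case .
qed

section \<open>Densities of singular measures and Lebesgue points\<close>

lemma singular_density_zero_aux:
  fixes \<sigma> :: "'a::euclidean_space measure"
  assumes sets: "sets \<sigma> = sets borel" and fin: "finite_measure \<sigma>"
    and N: "N \<in> sets borel" "emeasure \<sigma> (- N) = 0" and e: "e > 0"
  shows "negligible {x. x \<notin> N \<and> (\<forall>d>0. \<exists>h. 0 < h \<and> h < d \<and> e * h ^ DIM('a) < measure \<sigma> (cball x h))}"
    (is "negligible ?E")
  unfolding negligible_outer_le
proof (intro allI impI)
  fix \<epsilon> :: real assume \<epsilon>: "\<epsilon> > 0"
  interpret finite_measure \<sigma> by (rule fin)
  define c where "c = unit_ball_vol (real DIM('a))"
  have c: "c > 0" by (simp add: c_def)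
  \<comment> \<open>By Vitali, disjoint balls inside an open \<open>W\<close> around
    \<open>- N\<close> with \<open>emeasure \<sigma> W < \<delta>\<close> cover almost all of
    \<open>?E\<close>. The Lebesgue measure of each is at most \<open>c / e\<close> times its
    \<open>\<sigma>\<close> measure, so the total is at most
    \<open>c / e * \<delta> = \<epsilon>\<close>.\<close>
  define \<delta> where "\<delta> = \<epsilon> * e / c"
  have \<delta>: "\<delta> > 0" using \<epsilon> e c by (simp add: \<delta>_def)
  have "emeasure \<sigma> (- N) = (INF U \<in> {U. - N \<subseteq> U \<and> open U}. emeasure \<sigma> U)"
    by (rule outer_regular[OF sets]) (use N emeasure_finite in auto)
  then have "(INF U \<in> {U. - N \<subseteq> U \<and> open U}. emeasure \<sigma> U) < ennreal \<delta>" using N(2) \<delta> by simp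
  then obtain W where W: "- N \<subseteq> W" "open W" "emeasure \<sigma> W < ennreal \<delta>"
    unfolding INF_less_iff by blast
  define K where "K = {(x, h). x \<in> ?E \<and> 0 < h \<and> cball x h \<subseteq> W \<and> e * h ^ DIM('a) < measure \<sigma> (cball x h)}"
  obtain C where C: "countable C" "C \<subseteq> K"
    "pairwise (\<lambda>i j. disjnt (cball (fst i) (snd i)) (cball (fst j) (snd j))) C"
    "negligible (?E - (\<Union>i\<in>C. cball (fst i) (snd i)))"
  proof (rule Vitali_covering_theorem_cballs[of K snd ?E fst])
    show "0 < snd i" if "i \<in> K" for i using that by (auto simp: K_def)
    show "\<exists>i. i \<in> K \<and> x \<in> cball (fst i) (snd i) \<and> snd i < d" if x: "x \<in> ?E" and d: "d > 0" for x d
    proof -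
      have "x \<in> W" using x W(1) by auto
      then obtain r where r: "r > 0" "cball x r \<subseteq> W" using W(2) open_contains_cball by metis
      have "0 < min d r" using d r by simp
      then obtain h where h: "0 < h" "h < min d r" "e * h ^ DIM('a) < measure \<sigma> (cball x h)"
        using x by blast
      have "cball x h \<subseteq> W" using h(2) r(2) subset_cball[of h r x] by auto
      then have "(x, h) \<in> K" using x h by (simp add: K_def)
      then show ?thesis using h by (intro exI[of _ "(x, h)"]) auto
    qed
  qed blast
  define X where "X i = cball (fst i) (snd i)" for i :: "'a \<times> real"
  have disj: "disjoint_family_on X C"
    using C(3) by (auto simp: disjoint_family_on_def pairwise_def X_def disjnt_def)
  have Xs: "X i \<in> sets borel" for i by (simp add: X_def)
  have UX: "(\<Union>i\<in>C. X i) \<in> sets borel" using C(1) Xs by auto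
  have "emeasure lborel (\<Union>i\<in>C. X i) = (\<integral>\<^sup>+i. emeasure lborel (X i) \<partial>count_space C)"
    by (rule emeasure_UN_countable[OF _ C(1) disj]) (simp add: Xs)
  also have "\<dots> \<le> (\<integral>\<^sup>+i. ennreal (c / e) * emeasure \<sigma> (X i) \<partial>count_space C)"
  proof (rule nn_integral_mono)
    fix i assume "i \<in> space (count_space C)"
    then have i: "0 < snd i" "e * snd i ^ DIM('a) < measure \<sigma> (X i)"
      using C(2) by (auto simp: K_def X_def)
    have "emeasure lborel (X i) = ennreal (c * snd i ^ DIM('a))"
      unfolding X_def c_def using i(1) by (simp add: emeasure_cball)
    also have "\<dots> \<le> ennreal (c / e * measure \<sigma> (X i))"
    proof (rule ennreal_leI)
      have "c / e * (e * snd i ^ DIM('a)) \<le> c / e * measure \<sigma> (X i)"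
        using i(2) c e by (intro mult_left_mono) auto
      then show "c * snd i ^ DIM('a) \<le> c / e * measure \<sigma> (X i)" using e by simp
    qed
    also have "\<dots> = ennreal (c / e) * emeasure \<sigma> (X i)"
      unfolding emeasure_eq_measure by (rule ennreal_mult') (use c e in simp)
    finally show "emeasure lborel (X i) \<le> ennreal (c / e) * emeasure \<sigma> (X i)" .
  qed
  also have "\<dots> = ennreal (c / e) * emeasure \<sigma> (\<Union>i\<in>C. X i)"
    by (subst emeasure_UN_countable[OF _ C(1) disj]) (simp_all add: nn_integral_cmult sets Xs)
  also have "\<dots> \<le> ennreal (c / e) * emeasure \<sigma> W"
  proof (intro mult_left_mono emeasure_mono)
    have "X i \<subseteq> W" if "i \<in> C" for i
      using subsetD[OF C(2) that] by (cases i) (simp add: K_def X_def)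
    then show "(\<Union>i\<in>C. X i) \<subseteq> W" by blast
  qed (use W(2) in \<open>auto simp: sets\<close>)
  also have "\<dots> \<le> ennreal (c / e) * ennreal \<delta>" using W(3) by (intro mult_left_mono) auto
  also have "\<dots> = ennreal \<epsilon>" using c e by (simp add: ennreal_mult'[symmetric] \<delta>_def)
  finally have le: "emeasure lborel (\<Union>i\<in>C. X i) \<le> ennreal \<epsilon>" .
  have fm: "(\<Union>i\<in>C. X i) \<in> lmeasurable"
    using UX le by (intro fmeasurableI) (auto simp: emeasure_completion intro: le_less_trans)
  have mle: "measure lebesgue (\<Union>i\<in>C. X i) \<le> \<epsilon>"
    using le UX \<epsilon> by (simp add: measure_def emeasure_completion enn2real_leI)
  have neg: "?E - (\<Union>i\<in>C. X i) \<in> lmeasurable" "measure lebesgue (?E - (\<Union>i\<in>C. X i)) = 0"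
    using C(4) unfolding X_def[symmetric] by (simp_all add: negligible_iff_measure)
  show "\<exists>T. ?E \<subseteq> T \<and> T \<in> lmeasurable \<and> measure lebesgue T \<le> \<epsilon>"
  proof (intro exI conjI)
    show "?E \<subseteq> (?E - (\<Union>i\<in>C. X i)) \<union> (\<Union>i\<in>C. X i)" by blast
    show "(?E - (\<Union>i\<in>C. X i)) \<union> (\<Union>i\<in>C. X i) \<in> lmeasurable" using neg(1) fm by (rule fmeasurable.Un)
    have "measure lebesgue ((?E - (\<Union>i\<in>C. X i)) \<union> (\<Union>i\<in>C. X i))
        \<le> measure lebesgue (?E - (\<Union>i\<in>C. X i)) + measure lebesgue (\<Union>i\<in>C. X i)"
      using neg(1) fm by (intro measure_Un_le) auto
    then show "measure lebesgue ((?E - (\<Union>i\<in>C. X i)) \<union> (\<Union>i\<in>C. X i)) \<le> \<epsilon>" using neg(2) mle by linarith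
  qed
qed

text \<open>The null sets for \<open>e = 1 / (k + 1)\<close> are countable in number and settle
  every positive \<open>e\<close>.\<close>

lemma singular_density_zero:
  fixes \<sigma> :: "'a::euclidean_space measure"
  assumes "sets \<sigma> = sets borel" "finite_measure \<sigma>"
    and N: "N \<in> sets borel" "negligible N" "emeasure \<sigma> (- N) = 0"
  shows "\<exists>E. negligible E \<and> (\<forall>x. x \<notin> E \<longrightarrow>
    (\<forall>e>0. \<exists>d>0. \<forall>h. 0 < h \<and> h < d \<longrightarrow> measure \<sigma> (cball x h) \<le> e * h ^ DIM('a)))"
proof -
  define E where "E e = {x. x \<notin> N \<and> (\<forall>d>0. \<exists>h. 0 < h \<and> h < d \<and> e * h ^ DIM('a) < measure \<sigma> (cball x h))}" for e
  have "negligible (E e)" if "e > 0" for e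
    unfolding E_def by (rule singular_density_zero_aux) (use assms that in auto)
  then have "negligible (N \<union> (\<Union>k. E (1 / real (Suc k))))"
    using N(2) by (intro negligible_Un negligible_countable_Union) auto
  moreover have "\<exists>d>0. \<forall>h. 0 < h \<and> h < d \<longrightarrow> measure \<sigma> (cball x h) \<le> e * h ^ DIM('a)"
    if x: "x \<notin> N \<union> (\<Union>k. E (1 / real (Suc k)))" and e: "e > 0" for x e
  proof -
    obtain k where k: "1 / real (Suc k) < e"
      using reals_Archimedean[OF e] by (auto simp: inverse_eq_divide)
    have "x \<notin> E (1 / real (Suc k))" "x \<notin> N" using x by blast+
    then obtain d where d0: "d > 0" "\<And>h. \<not> (0 < h \<and> h < d \<and> 1 / real (Suc k) * h ^ DIM('a) < measure \<sigma> (cball x h))"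
      unfolding E_def by blast
    then have d: "d > 0" "\<And>h. 0 < h \<Longrightarrow> h < d \<Longrightarrow> measure \<sigma> (cball x h) \<le> 1 / real (Suc k) * h ^ DIM('a)"
      by (blast, meson not_le)
    have "measure \<sigma> (cball x h) \<le> e * h ^ DIM('a)" if "0 < h" "h < d" for h
      using d(2)[OF that] k that mult_right_mono[of "1 / real (Suc k)" e "h ^ DIM('a)"] by simp
    then show ?thesis using d(1) by blast
  qed
  ultimately show ?thesis by blast
qed

text \<open>Differentiation of integrals holds off one null set for all functions
  \<open>\<bar>g - q\<bar>\<close> with rational \<open>q\<close>; a rational \<open>q\<close>
  within \<open>e / 3\<close> of \<open>g x\<close> then stands in for the constant
  \<open>g x\<close>, which varies with the point. The point \<open>x\<close> is the lower corner of
  the cubes.\<close>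

lemma Lebesgue_point_cbox:
  fixes g :: "'a::euclidean_space \<Rightarrow> real"
  assumes g: "g absolutely_integrable_on UNIV"
  shows "\<exists>E. negligible E \<and> (\<forall>x. x \<notin> E \<longrightarrow>
    (\<forall>e>0. \<exists>d>0. \<forall>h. 0 < h \<and> h < d \<longrightarrow>
       integral (cbox x (x + h *\<^sub>R One)) (\<lambda>z. \<bar>g z - g x\<bar>) \<le> e * h ^ DIM('a)))"
proof -
  have ai: "(\<lambda>z. g z - q) absolutely_integrable_on cbox a b" for q a b
    using absolutely_integrable_on_subcbox[OF g] by (intro set_integral_diff absolutely_integrable_on_const) auto
  have int: "(\<lambda>z. \<bar>g z - q\<bar>) integrable_on cbox a b" for q a b
    using ai unfolding absolutely_integrable_on_def real_norm_def by blast
  have "\<forall>q. \<exists>N. negligible N \<and> (\<forall>x e. x \<notin> N \<longrightarrow> 0 < e \<longrightarrow> (\<exists>d>0. \<forall>h. 0 < h \<and> h < d \<longrightarrow>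
      norm (integral (cbox x (x + h *\<^sub>R One)) (\<lambda>z. \<bar>g z - q\<bar>) /\<^sub>R h ^ DIM('a) - \<bar>g x - q\<bar>) < e))"
  proof
    fix q
    obtain N where "negligible N" "\<And>x e. \<lbrakk>x \<notin> N; 0 < e\<rbrakk> \<Longrightarrow> \<exists>d>0. \<forall>h. 0 < h \<and> h < d \<longrightarrow>
      norm (integral (cbox x (x + h *\<^sub>R One)) (\<lambda>z. \<bar>g z - q\<bar>) /\<^sub>R h ^ DIM('a) - \<bar>g x - q\<bar>) < e"
      by (rule integrable_ccontinuous_explicit[of "\<lambda>z. \<bar>g z - q\<bar>"]) (use int in auto)
    then show "\<exists>N. negligible N \<and> (\<forall>x e. x \<notin> N \<longrightarrow> 0 < e \<longrightarrow> (\<exists>d>0. \<forall>h. 0 < h \<and> h < d \<longrightarrow>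
      norm (integral (cbox x (x + h *\<^sub>R One)) (\<lambda>z. \<bar>g z - q\<bar>) /\<^sub>R h ^ DIM('a) - \<bar>g x - q\<bar>) < e))" by (intro exI[of _ N]) simp
  qed
  from choice[OF this] obtain N where N: "\<And>q. negligible (N q)"
    "\<And>q x e. x \<notin> N q \<Longrightarrow> 0 < e \<Longrightarrow> \<exists>d>0. \<forall>h. 0 < h \<and> h < d \<longrightarrow>
      norm (integral (cbox x (x + h *\<^sub>R One)) (\<lambda>z. \<bar>g z - q\<bar>) /\<^sub>R h ^ DIM('a) - \<bar>g x - q\<bar>) < e"
    by blast
  define E where "E = (\<Union>q\<in>\<rat>. N q)"
  have E: "negligible E"
    unfolding E_def by (rule negligible_countable_Union) (auto intro: countable_rat N)
  have "\<exists>d>0. \<forall>h. 0 < h \<and> h < d \<longrightarrow>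
       integral (cbox x (x + h *\<^sub>R One)) (\<lambda>z. \<bar>g z - g x\<bar>) \<le> e * h ^ DIM('a)"
    if x: "x \<notin> E" and e: "e > 0" for x e
  proof -
    obtain q where q: "q \<in> \<rat>" "g x < q" "q < g x + e / 3"
      using Rats_dense_in_real[of "g x" "g x + e / 3"] e by auto
    obtain d where d: "d > 0" "\<And>h. 0 < h \<Longrightarrow> h < d \<Longrightarrow>
      norm (integral (cbox x (x + h *\<^sub>R One)) (\<lambda>z. \<bar>g z - q\<bar>) /\<^sub>R h ^ DIM('a) - \<bar>g x - q\<bar>) < e / 3"
      using N(2)[of x q "e/3"] x q(1) e by (auto simp: E_def)
    have "integral (cbox x (x + h *\<^sub>R One)) (\<lambda>z. \<bar>g z - g x\<bar>) \<le> e * h ^ DIM('a)" if h: "0 < h" "h < d" for h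
    proof -
      let ?Q = "cbox x (x + h *\<^sub>R One)" and ?I = "integral (cbox x (x + h *\<^sub>R One)) (\<lambda>z. \<bar>g z - q\<bar>)"
      have hn: "h ^ DIM('a) > 0" using h by simp
      have content: "measure lborel ?Q = h ^ DIM('a)"
        using h by (subst content_cbox) (auto simp: inner_add_left)
      have "?I / h ^ DIM('a) \<le> e / 3 + e / 3"
      proof -
        have "?I /\<^sub>R h ^ DIM('a) = ?I / h ^ DIM('a)" by (simp add: divide_inverse mult.commute)
        then have "\<bar>?I / h ^ DIM('a) - \<bar>g x - q\<bar>\<bar> < e / 3" using d(2)[OF h] by simp
        moreover have "\<bar>g x - q\<bar> < e / 3" using q by linarith
        ultimately show ?thesis by linarith
      qed
      then have I: "?I \<le> (2 * e / 3) * h ^ DIM('a)" using hn by (simp add: pos_divide_le_eq)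
      have "integral ?Q (\<lambda>z. \<bar>g z - g x\<bar>) \<le> integral ?Q (\<lambda>z. \<bar>g z - q\<bar> + e / 3)"
        using q by (intro integral_le int integrable_add integrable_on_const) (auto simp: abs_if)
      also have "\<dots> = ?I + e / 3 * h ^ DIM('a)"
        by (subst integral_add) (auto intro: int simp: content mult.commute)
      also have "\<dots> \<le> e * h ^ DIM('a)" using I by (simp add: algebra_simps)
      finally show ?thesis .
    qed
    then show ?thesis using d(1) by blast
  qed
  then show ?thesis using E by blast
qed

text \<open>Tested with \<open>\<phi>\<close>, the measure \<open>\<nu>\<close> minus
  \<open>L\<close> times Lebesgue measure leaves the density error \<open>g - L\<close> and the
  singular part, both bounded by their variations. The bound is stated in \<open>ennreal\<close>,
  ready to be averaged over the position of \<open>\<phi>\<close>.\<close>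

lemma signed_integral_estimate:
  fixes \<nu> \<nu>s :: "'a::euclidean_space set \<Rightarrow> real" and \<phi> g :: "'a \<Rightarrow> real"
  assumes \<Omega>: "open \<Omega>" and \<nu>: "vector_measure \<Omega> \<nu>" and \<nu>s: "vector_measure \<Omega> \<nu>s"
    and g: "g absolutely_integrable_on \<Omega>"
    and dec: "\<And>B. B \<in> borel_subsets \<Omega> \<Longrightarrow> \<nu> B = (LINT x:B|lebesgue. g x) + \<nu>s B"
    and \<phi>: "continuous_on UNIV \<phi>" "\<And>x. \<phi> x \<ge> 0" "\<And>x. x \<notin> cbox a b \<Longrightarrow> \<phi> x = 0" and ab: "cbox a b \<subseteq> \<Omega>"
  shows "ennreal \<bar>signed_integral \<Omega> \<nu> \<phi> - L * integral\<^sup>L lborel \<phi>\<bar>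
    \<le> (\<integral>\<^sup>+x. ennreal (\<phi> x * \<bar>g x - L\<bar>) \<partial>lebesgue_on \<Omega>)
      + (\<integral>\<^sup>+x. ennreal (\<phi> x) \<partial>jordan_pos \<Omega> \<nu>s) + (\<integral>\<^sup>+x. ennreal (\<phi> x) \<partial>jordan_pos \<Omega> (\<lambda>B. - \<nu>s B))"
proof -
  have \<Omega>b: "\<Omega> \<in> sets borel" and \<Omega>l: "\<Omega> \<in> sets lebesgue" using \<Omega> by auto
  let ?N = "restrict_space borel \<Omega>" and ?l = "lebesgue_on \<Omega>"
  define J1 J2 S1 S2 where "J1 = jordan_pos \<Omega> \<nu>" and "J2 = jordan_pos \<Omega> (\<lambda>B. - \<nu> B)"
    and "S1 = jordan_pos \<Omega> \<nu>s" and "S2 = jordan_pos \<Omega> (\<lambda>B. - \<nu>s B)"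
  \<comment> \<open>The positive and negative parts of \<open>g\<close> times Lebesgue measure, cut
    off by \<open>ennreal\<close>, as measures on the Borel subsets of \<open>\<Omega>\<close>; thus
    all six measures share one sigma-algebra.\<close>
  define Gp Gm where "Gp = distr (density ?l (\<lambda>x. ennreal (g x))) ?N (\<lambda>x. x)"
    and "Gm = distr (density ?l (\<lambda>x. ennreal (- g x))) ?N (\<lambda>x. x)"
  have gm: "g \<in> borel_measurable ?l" using g absolutely_integrable_measurable \<Omega>l by blast
  have gi: "integrable ?l g"
    using g \<Omega>l by (simp add: set_integrable_def integrable_restrict_space)
  have idm: "(\<lambda>x. x) \<in> measurable ?l ?N"
    by (intro measurable_restrict_space3) (auto simp: borel_measurable_if_I measurable_completion)
  have bs: "borel_subsets \<Omega> = sets ?N" by (rule borel_subsets_eq_sets[OF \<Omega>b])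
  have fins: "finite_measure J1" "finite_measure J2" "finite_measure S1" "finite_measure S2"
    unfolding J1_def J2_def S1_def S2_def
    by (intro finite_measure_jordan_pos vector_measure_uminus \<nu> \<nu>s \<Omega>b)+
  have setsJ: "sets J1 = sets ?N" "sets J2 = sets ?N" "sets S1 = sets ?N" "sets S2 = sets ?N"
    unfolding J1_def J2_def S1_def S2_def bs[symmetric]
    by (intro sets_jordan_pos vector_measure_uminus \<nu> \<nu>s \<Omega>b)+
  have setsG: "sets Gp = sets ?N" "sets Gm = sets ?N" by (simp_all add: Gp_def Gm_def)
  have eG: "emeasure Gp B = (\<integral>\<^sup>+x. ennreal (indicator B x * g x) \<partial>?l)"
    "emeasure Gm B = (\<integral>\<^sup>+x. ennreal (- (indicator B x * g x)) \<partial>?l)" if B: "B \<in> sets ?N" for B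
  proof -
    have vi: "B \<inter> \<Omega> = B"
      using sets.sets_into_space[OF B] by (auto simp: space_restrict_space)
    have Bl: "B \<in> sets ?l" using measurable_sets[OF idm B] sets.sets_into_space[OF B] by (auto simp: space_restrict_space Int_absorb2)
    show "emeasure Gp B = (\<integral>\<^sup>+x. ennreal (indicator B x * g x) \<partial>?l)"
      unfolding Gp_def using gm idm B Bl
      by (subst emeasure_distr) (auto simp: vi emeasure_density space_restrict_space intro!: nn_integral_cong split: split_indicator)
    show "emeasure Gm B = (\<integral>\<^sup>+x. ennreal (- (indicator B x * g x)) \<partial>?l)"
      unfolding Gm_def using gm idm B Bl
      by (subst emeasure_distr) (auto simp: vi emeasure_density space_restrict_space intro!: nn_integral_cong split: split_indicator)
  qed
  have gBi: "integrable ?l (\<lambda>x. indicator B x * g x)" if B: "B \<in> sets ?N" for B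
  proof -
    have "B \<in> sets ?l" using measurable_sets[OF idm B] sets.sets_into_space[OF B] by (auto simp: space_restrict_space Int_absorb2)
    then show ?thesis using integrable_mult_indicator[OF _ gi, of B] by simp
  qed
  have finG: "finite_measure Gp" "finite_measure Gm"
  proof -
    have "\<Omega> \<in> sets ?N" using \<Omega>b by (simp add: sets_restrict_space_iff)
    then have "emeasure Gp \<Omega> < \<infinity>" "emeasure Gm \<Omega> < \<infinity>"
      using gBi[of \<Omega>] eG[of \<Omega>] integrableD(2)[of ?l "\<lambda>x. indicator \<Omega> x * g x"]
        integrableD(3)[of ?l "\<lambda>x. indicator \<Omega> x * g x"] by (auto simp: less_top[symmetric])
    then show "finite_measure Gp" "finite_measure Gm"
      by (auto intro!: finite_measureI simp: Gp_def Gm_def space_restrict_space)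
  qed
  note em = finite_measure.emeasure_eq_measure
  have Gint: "(LINT x:B|lebesgue. g x) = measure Gp B - measure Gm B" if B: "B \<in> sets ?N" for B
  proof -
    have "B \<subseteq> \<Omega>" using B by (simp add: bs[symmetric] borel_subsets_def)
    then have "(LINT x:B|lebesgue. g x) = (LINT x|lebesgue. indicator \<Omega> x *\<^sub>R (indicator B x * g x))"
      unfolding set_lebesgue_integral_def by (intro Bochner_Integration.integral_cong) (auto split: split_indicator)
    also have "\<dots> = (LINT x|?l. indicator B x * g x)" using \<Omega>l by (simp add: integral_restrict_space)
    also have "\<dots> = enn2real (\<integral>\<^sup>+x. ennreal (indicator B x * g x) \<partial>?l) - enn2real (\<integral>\<^sup>+x. ennreal (- (indicator B x * g x)) \<partial>?l)"
      by (rule real_lebesgue_integral_def[OF gBi[OF B]])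
    finally show ?thesis by (simp add: measure_def eG[OF B])
  qed
  \<comment> \<open>The decomposition of \<open>\<nu>\<close> into density and singular part,
    rearranged so that only nonnegative terms occur.\<close>
  have sum_eq: "emeasure J1 B + emeasure S2 B + emeasure Gm B = emeasure J2 B + emeasure S1 B + emeasure Gp B"
    if B: "B \<in> sets ?N" for B
  proof -
    have "\<nu> B = measure J1 B - measure J2 B" "\<nu>s B = measure S1 B - measure S2 B"
      unfolding J1_def J2_def S1_def S2_def using jordan_decomposition \<nu> \<nu>s \<Omega>b B bs by blast+
    then have "measure J1 B + measure S2 B + measure Gm B = measure J2 B + measure S1 B + measure Gp B"
      using dec[of B] Gint[OF B] B bs by simp
    then show ?thesis
      by (simp add: em[OF fins(1)] em[OF fins(2)] em[OF fins(3)] em[OF fins(4)] em[OF finG(1)] em[OF finG(2)]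
          ennreal_plus[symmetric] del: ennreal_plus)
  qed
  have \<phi>b: "\<phi> \<in> borel_measurable borel" using \<phi>(1) by (rule borel_measurable_continuous_onI)
  have \<phi>N: "\<phi> \<in> borel_measurable ?N" using \<phi>b by (rule measurable_restrict_space1)
  have \<phi>M: "\<phi> \<in> borel_measurable M" if "sets M = sets ?N" for M
    using \<phi>N measurable_cong_sets[OF that refl] by blast
  have nn_eq: "(\<integral>\<^sup>+x. \<phi> x \<partial>J1) + (\<integral>\<^sup>+x. \<phi> x \<partial>S2) + (\<integral>\<^sup>+x. \<phi> x \<partial>Gm)
     = (\<integral>\<^sup>+x. \<phi> x \<partial>J2) + (\<integral>\<^sup>+x. \<phi> x \<partial>S1) + (\<integral>\<^sup>+x. \<phi> x \<partial>Gp)"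
  proof -
    have "(\<Sum>i<3. \<integral>\<^sup>+x. ennreal (\<phi> x) \<partial>([J1, S2, Gm] ! i)) = (\<Sum>i<3. \<integral>\<^sup>+x. ennreal (\<phi> x) \<partial>([J2, S1, Gp] ! i))"
    proof (rule nn_integral_eq_of_sum_emeasure_eq[where N = ?N])
      have three: "i = 0 \<or> i = 1 \<or> i = 2" if "i \<in> {..<3}" for i :: nat using that by auto
      show "sets ([J1, S2, Gm] ! i) = sets ?N" if "i \<in> {..<3}" for i
        using three[OF that] by (elim disjE) (simp_all only: nth_Cons_0 nth_Cons_numeral One_nat_def nth_Cons_Suc setsJ setsG numeral_2_eq_2)
      show "sets ([J2, S1, Gp] ! i) = sets ?N" if "i \<in> {..<3}" for i
        using three[OF that] by (elim disjE) (simp_all only: nth_Cons_0 nth_Cons_numeral One_nat_def nth_Cons_Suc setsJ setsG numeral_2_eq_2)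
      show "(\<Sum>i<3. emeasure ([J1, S2, Gm] ! i) B) = (\<Sum>i<3. emeasure ([J2, S1, Gp] ! i) B)" if "B \<in> sets ?N" for B
        using sum_eq[OF that] by (simp add: numeral_3_eq_3)
      show "(\<lambda>x. ennreal (\<phi> x)) \<in> borel_measurable ?N" using \<phi>N by simp
    qed
    then show ?thesis by (simp add: numeral_3_eq_3)
  qed
  obtain K where K: "\<And>x. \<phi> x \<le> K"
  proof -
    have "compact (\<phi> ` cbox a b)"
      using \<phi>(1) by (intro compact_continuous_image) (auto intro: continuous_on_subset)
    then obtain K where K: "\<And>y. y \<in> \<phi> ` cbox a b \<Longrightarrow> \<bar>y\<bar> \<le> K" using compact_imp_bounded bounded_real by metis
    have "\<phi> x \<le> max K 0" for x
      using K[of "\<phi> x"] \<phi>(3)[of x] by (cases "x \<in> cbox a b") auto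
    then show ?thesis by (rule that)
  qed
  have fint: "(\<integral>\<^sup>+x. \<phi> x \<partial>M) = ennreal (integral\<^sup>L M \<phi>)" if M: "finite_measure M" "sets M = sets ?N" for M
  proof (rule nn_integral_eq_integral)
    show "integrable M \<phi>"
      by (rule finite_measure.integrable_const_bound[OF M(1), of _ K]) (use K \<phi>(2) \<phi>M[OF M(2)] in auto)
  qed (use \<phi>(2) in auto)
  have real_eq: "integral\<^sup>L J1 \<phi> + integral\<^sup>L S2 \<phi> + integral\<^sup>L Gm \<phi> = integral\<^sup>L J2 \<phi> + integral\<^sup>L S1 \<phi> + integral\<^sup>L Gp \<phi>"
  proof -
    have nn: "integral\<^sup>L M \<phi> \<ge> 0" for M using \<phi>(2) by (intro Bochner_Integration.integral_nonneg) auto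
    show ?thesis
      using nn_eq nn by (simp add: fint[OF fins(1) setsJ(1)] fint[OF fins(2) setsJ(2)] fint[OF fins(3) setsJ(3)] fint[OF fins(4) setsJ(4)]
        fint[OF finG(1) setsG(1)] fint[OF finG(2) setsG(2)] ennreal_plus[symmetric] del: ennreal_plus)
  qed
  have \<phi>l: "\<phi> \<in> borel_measurable ?l"
    using \<phi>b by (intro measurable_restrict_space1 measurable_completion) simp
  have \<phi>gi: "integrable ?l (\<lambda>x. \<phi> x * (g x - q))" for q
  proof -
    have "integrable ?l (\<lambda>x. \<phi> x * g x)"
    proof (rule Bochner_Integration.integrable_bound[of _ "\<lambda>x. K * g x"])
      have "norm (\<phi> x * g x) \<le> norm (K * g x)" for x
        using mult_right_mono[OF order_trans[OF K[of x] abs_ge_self] abs_ge_zero, of "g x"] \<phi>(2)[of x]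
        by (simp add: abs_mult)
      then show "AE x in ?l. norm (\<phi> x * g x) \<le> norm (K * g x)" by simp
    qed (use gi gm \<phi>l in auto)
    moreover have "integrable ?l \<phi>"
    proof -
      have "integrable lborel \<phi>" using continuous_compact_support_integrable(2)[OF \<phi>(1,3)] .
      then have "integrable lebesgue \<phi>" using integrable_completion \<phi>b by auto
      then have "integrable lebesgue (\<lambda>x. indicator \<Omega> x *\<^sub>R \<phi> x)" by (rule integrable_mult_indicator[OF \<Omega>l])
      then show ?thesis using \<Omega>l by (simp add: integrable_restrict_space)
    qed
    ultimately show ?thesis by (simp add: right_diff_distrib)
  qed
  have Gdiff: "integral\<^sup>L Gp \<phi> - integral\<^sup>L Gm \<phi> = (LINT x|?l. \<phi> x * g x)"
  proof -
    have dens: "(\<integral>\<^sup>+x. \<phi> x \<partial>distr (density ?l (\<lambda>x. ennreal (h x))) ?N (\<lambda>x. x)) = (\<integral>\<^sup>+x. ennreal (\<phi> x * h x) \<partial>?l)"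
      if "h \<in> borel_measurable ?l" for h
      using that idm \<phi>N \<phi>l \<phi>(2)
      by (subst nn_integral_distr) (auto simp: nn_integral_density ennreal_mult' mult.commute)
    have "(\<integral>\<^sup>+x. \<phi> x \<partial>Gp) = (\<integral>\<^sup>+x. ennreal (\<phi> x * g x) \<partial>?l)"
      unfolding Gp_def by (rule dens[OF gm])
    then have "ennreal (integral\<^sup>L Gp \<phi>) = (\<integral>\<^sup>+x. ennreal (\<phi> x * g x) \<partial>?l)"
      by (simp only: fint[OF finG(1) setsG(1)])
    moreover have "(\<integral>\<^sup>+x. \<phi> x \<partial>Gm) = (\<integral>\<^sup>+x. ennreal (\<phi> x * - g x) \<partial>?l)"
      unfolding Gm_def by (rule dens) (use gm in simp)
    then have "ennreal (integral\<^sup>L Gm \<phi>) = (\<integral>\<^sup>+x. ennreal (- (\<phi> x * g x)) \<partial>?l)"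
      by (simp only: fint[OF finG(2) setsG(2)] mult_minus_right)
    moreover have "(LINT x|?l. \<phi> x * g x) = enn2real (\<integral>\<^sup>+x. ennreal (\<phi> x * g x) \<partial>?l) - enn2real (\<integral>\<^sup>+x. ennreal (- (\<phi> x * g x)) \<partial>?l)"
      using \<phi>gi[of 0] by (intro real_lebesgue_integral_def) simp
    moreover have nn: "integral\<^sup>L M \<phi> \<ge> 0" for M using \<phi>(2) by (intro Bochner_Integration.integral_nonneg) auto
    ultimately show ?thesis by (metis enn2real_ennreal)
  qed
  have L: "L * integral\<^sup>L lborel \<phi> = (LINT x|?l. \<phi> x * L)"
  proof -
    have "integral\<^sup>L lborel \<phi> = integral\<^sup>L lebesgue \<phi>" using \<phi>b by (simp add: integral_completion)
    also have "\<dots> = (LINT x|lebesgue. indicator \<Omega> x *\<^sub>R \<phi> x)"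
      using \<phi>(3) ab by (intro Bochner_Integration.integral_cong) (auto split: split_indicator)
    also have "\<dots> = integral\<^sup>L ?l \<phi>" using \<Omega>l by (simp add: integral_restrict_space)
    finally show ?thesis by simp
  qed
  have i0: "integrable ?l (\<lambda>x. \<phi> x * g x)" using \<phi>gi[of 0] by simp
  have "integrable ?l (\<lambda>x. \<phi> x * g x - \<phi> x * (g x - L))"
    by (intro Bochner_Integration.integrable_diff i0 \<phi>gi)
  then have iL: "integrable ?l (\<lambda>x. \<phi> x * L)" by (simp add: algebra_simps)
  have "signed_integral \<Omega> \<nu> \<phi> = integral\<^sup>L J1 \<phi> - integral\<^sup>L J2 \<phi>"
    by (simp add: signed_integral_def J1_def J2_def)
  then have "signed_integral \<Omega> \<nu> \<phi> - L * integral\<^sup>L lborel \<phi>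
      = integral\<^sup>L S1 \<phi> - integral\<^sup>L S2 \<phi> + ((LINT x|?l. \<phi> x * g x) - (LINT x|?l. \<phi> x * L))"
    using real_eq Gdiff L by linarith
  also have "(LINT x|?l. \<phi> x * g x) - (LINT x|?l. \<phi> x * L) = (LINT x|?l. \<phi> x * (g x - L))"
    using Bochner_Integration.integral_diff[OF i0 iL] by (simp add: right_diff_distrib)
  finally have eq: "signed_integral \<Omega> \<nu> \<phi> - L * integral\<^sup>L lborel \<phi>
      = integral\<^sup>L S1 \<phi> - integral\<^sup>L S2 \<phi> + (LINT x|?l. \<phi> x * (g x - L))" .
  have nn: "integral\<^sup>L M \<phi> \<ge> 0" for M using \<phi>(2) by (intro Bochner_Integration.integral_nonneg) auto
  have ab': "\<bar>\<phi> x * (g x - L)\<bar> = \<phi> x * \<bar>g x - L\<bar>" for x using \<phi>(2) by (simp add: abs_mult)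
  have "\<bar>LINT x|?l. \<phi> x * (g x - L)\<bar> \<le> (LINT x|?l. \<phi> x * \<bar>g x - L\<bar>)"
    using integral_norm_bound[of ?l "\<lambda>x. \<phi> x * (g x - L)"] by (simp add: ab')
  then have "\<bar>signed_integral \<Omega> \<nu> \<phi> - L * integral\<^sup>L lborel \<phi>\<bar>
      \<le> (LINT x|?l. \<phi> x * \<bar>g x - L\<bar>) + integral\<^sup>L S1 \<phi> + integral\<^sup>L S2 \<phi>"
    unfolding eq using nn[of S1] nn[of S2] by linarith
  then have "ennreal \<bar>signed_integral \<Omega> \<nu> \<phi> - L * integral\<^sup>L lborel \<phi>\<bar>
      \<le> ennreal ((LINT x|?l. \<phi> x * \<bar>g x - L\<bar>) + integral\<^sup>L S1 \<phi> + integral\<^sup>L S2 \<phi>)" by (rule ennreal_leI)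
  also have "\<dots> = ennreal (LINT x|?l. \<phi> x * \<bar>g x - L\<bar>) + ennreal (integral\<^sup>L S1 \<phi>) + ennreal (integral\<^sup>L S2 \<phi>)"
    using nn \<phi>(2) by (simp add: ennreal_plus)
  also have "ennreal (LINT x|?l. \<phi> x * \<bar>g x - L\<bar>) = (\<integral>\<^sup>+x. ennreal (\<phi> x * \<bar>g x - L\<bar>) \<partial>?l)"
    using integrable_norm[OF \<phi>gi[of L]] \<phi>(2) by (intro nn_integral_eq_integral[symmetric]) (auto simp: ab')
  finally show ?thesis
    using fint[OF fins(3) setsJ(3)] fint[OF fins(4) setsJ(4)] by (simp only: S1_def S2_def)
qed

section \<open>Mollification\<close>

definition moll :: "real \<Rightarrow> real^'n \<Rightarrow> real" where
  "moll \<epsilon> x = bump ((1 / \<epsilon>) *\<^sub>R x) * (1 / \<epsilon>) ^ CARD('n)"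

lemma moll_smooth: "smooth (moll \<epsilon> :: real^'n \<Rightarrow> real)"
proof -
  have "Ck k (\<lambda>x::real^'n. bump ((1 / \<epsilon>) *\<^sub>R x + 0) * (1 / \<epsilon>) ^ CARD('n))" for k
    by (rule Ck_mult[OF Ck_affine_compose[OF bounded_linear_scaleR_right smooth_Ck[OF bump_smooth]] Ck_const])
  then show ?thesis by (simp add: smooth_def moll_def[abs_def])
qed

lemma moll_nonneg: "\<epsilon> > 0 \<Longrightarrow> moll \<epsilon> x \<ge> 0"
  by (simp add: moll_def bump_nonneg)

lemma moll_zero: "\<epsilon> > 0 \<Longrightarrow> norm x \<ge> \<epsilon> \<Longrightarrow> moll \<epsilon> x = 0"
  by (simp add: moll_def bump_zero)

lemma moll_uminus: "moll \<epsilon> (- x) = moll \<epsilon> x"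
  by (simp add: moll_def bump_uminus)

lemma moll_translate_continuous: "continuous_on S (\<lambda>z. moll \<epsilon> (z - x))"
  by (rule continuous_on_compose2[OF smooth_continuous[OF moll_smooth, of UNIV]]) (auto intro!: continuous_intros)

lemma moll_translate_support: "\<epsilon> > 0 \<Longrightarrow> z \<notin> cball x \<epsilon> \<Longrightarrow> moll \<epsilon> (z - x) = 0"
  by (rule moll_zero) (auto simp: dist_norm norm_minus_commute)

lemma moll_translate_integral:
  fixes x :: "real^'n"
  assumes \<epsilon>: "\<epsilon> > 0"
  shows "integrable lborel (\<lambda>z. moll \<epsilon> (z - x))" "integral\<^sup>L lborel (\<lambda>z. moll \<epsilon> (z - x)) = 1"
proof -
  have int: "integrable lborel (\<lambda>z. moll \<epsilon> (z - y))" "integral\<^sup>L lborel (\<lambda>z. moll \<epsilon> (z - y)) = integral UNIV (\<lambda>z. moll \<epsilon> (z - y))" for y :: "real^'n"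
  proof -
    obtain a where a: "cball y \<epsilon> \<subseteq> cbox (-a) a" using bounded_subset_cbox_symmetric[OF bounded_cball] by blast
    have "moll \<epsilon> (z - y) = 0" if "z \<notin> cbox (-a) a" for z
      using a that by (intro moll_translate_support[OF \<epsilon>]) blast
    from continuous_compact_support_integrable(2,4)[OF moll_translate_continuous this]
    show "integrable lborel (\<lambda>z. moll \<epsilon> (z - y))" "integral\<^sup>L lborel (\<lambda>z. moll \<epsilon> (z - y)) = integral UNIV (\<lambda>z. moll \<epsilon> (z - y))" by auto
  qed
  show "integrable lborel (\<lambda>z. moll \<epsilon> (z - x))" by (rule int)
  define L where "L x = (1 / \<epsilon>) *\<^sub>R x" for x :: "real^'n"
  have L: "linear L" unfolding L_def by (auto intro!: linearI simp: scaleR_right_distrib)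
  have "matrix L = (\<chi> i. (1 / \<epsilon>) *s (mat 1 $ i))"
    by (simp add: matrix_def L_def vec_eq_iff mat_def axis_def)
  then have det: "det (matrix L) = (1 / \<epsilon>) ^ CARD('n)"
    using det_rows_mul[of "\<lambda>_. 1 / \<epsilon>" "\<lambda>i. (mat 1 :: real^'n^'n) $ i"] by simp
  have "\<bar>det (matrix L)\<bar> * integral UNIV (\<lambda>x. bump (L x)) = 1"
    by (rule integral_bump_linear[OF L]) (use det \<epsilon> in simp)
  moreover have "\<bar>det (matrix L)\<bar> = (1 / \<epsilon>) ^ CARD('n)" using det \<epsilon> by simp
  moreover have "integral UNIV (moll \<epsilon> :: real^'n \<Rightarrow> real) = integral UNIV (\<lambda>x. bump (L x)) * (1 / \<epsilon>) ^ CARD('n)"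
    unfolding moll_def[abs_def] L_def by (rule integral_mult_left)
  ultimately have "integral UNIV (moll \<epsilon> :: real^'n \<Rightarrow> real) = 1" by (simp add: mult.commute)
  then have "integral\<^sup>L lborel (moll \<epsilon> :: real^'n \<Rightarrow> real) = 1" using int(2)[of 0] by simp
  moreover have "integral\<^sup>L lborel (\<lambda>z. moll \<epsilon> (z + (- x))) = integral\<^sup>L lborel (moll \<epsilon> :: real^'n \<Rightarrow> real)"
    by (rule lborel_integral_translate) (intro borel_measurable_continuous_onI smooth_continuous moll_smooth)
  ultimately show "integral\<^sup>L lborel (\<lambda>z. moll \<epsilon> (z - x)) = 1" by simp
qed

lemma nn_integral_moll_translate:
  fixes z :: "real^'n"
  assumes \<epsilon>: "\<epsilon> > 0"
  shows "(\<integral>\<^sup>+x. ennreal (moll \<epsilon> (z - x)) \<partial>lborel) = 1"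
proof -
  have "(\<integral>\<^sup>+x. ennreal (moll \<epsilon> (z - x)) \<partial>lborel) = (\<integral>\<^sup>+x. ennreal (moll \<epsilon> (x - z)) \<partial>lborel)"
    using moll_uminus[of \<epsilon> "_ - z"] by simp
  also have "\<dots> = ennreal (integral\<^sup>L lborel (\<lambda>x. moll \<epsilon> (x - z)))"
    using moll_nonneg[OF \<epsilon>] by (intro nn_integral_eq_integral moll_translate_integral \<epsilon>) auto
  finally show ?thesis by (simp add: moll_translate_integral(2)[OF \<epsilon>])
qed

lemma moll_measurable: "sets M = sets borel \<Longrightarrow> (\<lambda>z. moll \<epsilon> (z - x)) \<in> borel_measurable M"
  using borel_measurable_continuous_onI[OF moll_translate_continuous] measurable_cong_sets by blast

lemma moll_pair_measurable:
  fixes M :: "(real^'n) measure"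
  assumes "sets M = sets borel"
  shows "(\<lambda>p. moll \<epsilon> (snd p - fst p)) \<in> borel_measurable (lborel \<Otimes>\<^sub>M M)"
proof -
  have "continuous_on UNIV (\<lambda>p :: (real^'n) \<times> (real^'n). moll \<epsilon> (snd p - fst p))"
    by (rule continuous_on_compose2[OF smooth_continuous[OF moll_smooth, of UNIV]]) (auto intro!: continuous_intros)
  then have "(\<lambda>p :: (real^'n) \<times> (real^'n). moll \<epsilon> (snd p - fst p)) \<in> borel_measurable (borel \<Otimes>\<^sub>M borel)"
    unfolding borel_prod by (rule borel_measurable_continuous_onI)
  moreover have "sets (lborel \<Otimes>\<^sub>M M) = sets (borel \<Otimes>\<^sub>M borel)"
    by (intro sets_pair_measure_cong) (simp_all add: assms)
  ultimately show ?thesis using measurable_cong_sets by blast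
qed

lemma nn_integral_moll_measurable:
  fixes M :: "(real^'n) measure"
  assumes sets: "sets M = sets borel" and fin: "finite_measure M"
  shows "(\<lambda>x. \<integral>\<^sup>+z. ennreal (moll \<epsilon> (z - x)) \<partial>M) \<in> borel_measurable lborel"
proof -
  interpret finite_measure M by (rule fin)
  show ?thesis
    by (rule borel_measurable_nn_integral)
       (use measurable_compose[OF moll_pair_measurable[OF sets] measurable_ennreal] in \<open>simp add: case_prod_unfold\<close>)
qed

text \<open>Integrated over \<open>x\<close> first, the kernel has mass one, and for
  \<open>x\<close> in \<open>S\<close> it sees only points \<open>z\<close> of \<open>Q\<close>. So
  smoothing does not increase mass, whatever \<open>\<epsilon>\<close> is.\<close>

lemma nn_integral_moll_average:
  fixes M :: "(real^'n) measure"
  assumes \<epsilon>: "\<epsilon> > 0" and sets: "sets M = sets borel" and fin: "finite_measure M"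
    and S: "S \<in> sets borel" and Q: "Q \<in> sets borel" and sub: "\<And>x. x \<in> S \<Longrightarrow> cball x \<epsilon> \<subseteq> Q"
  shows "(\<integral>\<^sup>+x. indicator S x * (\<integral>\<^sup>+z. ennreal (moll \<epsilon> (z - x)) \<partial>M) \<partial>lborel) \<le> emeasure M Q"
proof -
  interpret M: finite_measure M by (rule fin)
  interpret pair_sigma_finite lborel M by standard
  note m1 = moll_pair_measurable[OF sets]
  have [measurable]: "S \<in> sets lborel" using S by simp
  have m: "(\<lambda>(x, z). indicator S x * ennreal (moll \<epsilon> (z - x))) \<in> borel_measurable (lborel \<Otimes>\<^sub>M M)"
    unfolding case_prod_unfold
    by (intro borel_measurable_times_ennreal measurable_compose[OF measurable_fst] measurable_compose[OF m1 measurable_ennreal])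
       (use S in simp)
  have "(\<integral>\<^sup>+x. indicator S x * (\<integral>\<^sup>+z. ennreal (moll \<epsilon> (z - x)) \<partial>M) \<partial>lborel)
     = (\<integral>\<^sup>+x. (\<integral>\<^sup>+z. indicator S x * ennreal (moll \<epsilon> (z - x)) \<partial>M) \<partial>lborel)"
    by (intro nn_integral_cong nn_integral_cmult[symmetric])
       (use moll_measurable[OF sets] in simp)
  also have "\<dots> = (\<integral>\<^sup>+z. (\<integral>\<^sup>+x. indicator S x * ennreal (moll \<epsilon> (z - x)) \<partial>lborel) \<partial>M)"
    using Fubini'[OF m] by simp
  also have "\<dots> \<le> (\<integral>\<^sup>+z. indicator Q z \<partial>M)"
  proof (rule nn_integral_mono)
    fix z
    have "(\<integral>\<^sup>+x. indicator S x * ennreal (moll \<epsilon> (z - x)) \<partial>lborel)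
        \<le> (\<integral>\<^sup>+x. indicator Q z * ennreal (moll \<epsilon> (z - x)) \<partial>lborel)"
    proof (rule nn_integral_mono)
      fix x
      have "moll \<epsilon> (z - x) = 0" if "x \<in> S" "z \<notin> Q"
        using sub[OF that(1)] that(2) by (intro moll_translate_support[OF \<epsilon>]) blast
      then show "indicator S x * ennreal (moll \<epsilon> (z - x)) \<le> indicator Q z * ennreal (moll \<epsilon> (z - x))"
        by (auto split: split_indicator)
    qed
    also have "\<dots> = indicator Q z * (\<integral>\<^sup>+x. ennreal (moll \<epsilon> (z - x)) \<partial>lborel)"
    proof (rule nn_integral_cmult)
      have "continuous_on UNIV (\<lambda>x. moll \<epsilon> (z - x))"
        by (rule continuous_on_compose2[OF smooth_continuous[OF moll_smooth, of UNIV]]) (auto intro!: continuous_intros)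
      then have "(\<lambda>x. moll \<epsilon> (z - x)) \<in> borel_measurable lborel"
        using borel_measurable_continuous_onI by auto
      then show "(\<lambda>x. ennreal (moll \<epsilon> (z - x))) \<in> borel_measurable lborel" by simp
    qed
    finally show "(\<integral>\<^sup>+x. indicator S x * ennreal (moll \<epsilon> (z - x)) \<partial>lborel) \<le> indicator Q z"
      by (simp add: nn_integral_moll_translate[OF \<epsilon>])
  qed
  also have "\<dots> = emeasure M Q" using Q by (simp add: sets)
  finally show ?thesis .
qed

lemma pd_translate:
  assumes "smooth g"
  shows "pd j (\<lambda>z. g (z - x)) z = pd j g (z - x)"
proof -
  have "((\<lambda>z. z - x) has_derivative (\<lambda>h. h)) (at z)" by (auto intro!: derivative_eq_intros)
  from has_derivative_compose[OF this smooth_has_derivative[OF assms]]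
  have "((\<lambda>z. g (z - x)) has_derivative frechet_derivative g (at (z - x))) (at z)" by simp
  then have "frechet_derivative (\<lambda>z. g (z - x)) (at z) = frechet_derivative g (at (z - x))"
    by (metis frechet_derivative_at)
  then show ?thesis by (simp add: pd_def)
qed

text \<open>The integral is confined to a box on which \<open>v\<close> is continuous; nothing is
  lost at points whose \<open>\<epsilon>\<close>-ball lies in the box.\<close>

definition mollify :: "real \<Rightarrow> real^'n \<Rightarrow> real^'n \<Rightarrow> (real^'n \<Rightarrow> real) \<Rightarrow> real^'n \<Rightarrow> real" where
  "mollify \<epsilon> a b v x = integral (cbox a b) (\<lambda>z. v z * moll \<epsilon> (z - x))"

text \<open>The \<open>j\<close>-th partial derivative of \<open>mollify\<close>, carried by the
  kernel alone; the minus sign arises from differentiating \<open>z - x\<close> with respect to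
  \<open>x\<close>.\<close>

definition dmollify :: "'n \<Rightarrow> real \<Rightarrow> real^'n \<Rightarrow> real^'n \<Rightarrow> (real^'n \<Rightarrow> real) \<Rightarrow> real^'n \<Rightarrow> real" where
  "dmollify j \<epsilon> a b v x = integral (cbox a b) (\<lambda>z. v z * - pd j (moll \<epsilon>) (z - x))"

lemma pd_moll_continuous: "continuous_on S (pd j (moll \<epsilon>))"
  by (intro smooth_continuous pd_smooth moll_smooth)

lemma mollify_has_derivative:
  assumes v: "continuous_on (cbox a b) v"
  shows "((\<lambda>s. mollify \<epsilon> a b v (y + s *\<^sub>R axis j 1)) has_real_derivative
    dmollify j \<epsilon> a b v (y + s *\<^sub>R axis j 1)) (at s)"
  unfolding mollify_def dmollify_def
proof (rule leibniz_rule_field_derivative[where U = UNIV])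
  fix s z
  have "((\<lambda>s. moll \<epsilon> ((z - y) + s *\<^sub>R axis j 1)) has_real_derivative pd j (moll \<epsilon>) ((z - y) + (- s) *\<^sub>R axis j 1)) (at (- s))"
    using has_vector_derivative_along_axis[OF moll_smooth, of \<epsilon> "z - y" j "- s"]
    by (simp add: has_real_derivative_iff_has_vector_derivative)
  then have "((\<lambda>s. moll \<epsilon> ((z - y) + (- s) *\<^sub>R axis j 1)) has_real_derivative
      pd j (moll \<epsilon>) ((z - y) + (- s) *\<^sub>R axis j 1) * (- 1)) (at s)"
    by (rule DERIV_chain2) (auto intro!: derivative_eq_intros)
  then have "((\<lambda>s. moll \<epsilon> (z - (y + s *\<^sub>R axis j 1))) has_real_derivative - pd j (moll \<epsilon>) (z - (y + s *\<^sub>R axis j 1))) (at s)"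
    by (simp add: algebra_simps)
  then show "((\<lambda>s. v z * moll \<epsilon> (z - (y + s *\<^sub>R axis j 1))) has_real_derivative
      v z * - pd j (moll \<epsilon>) (z - (y + s *\<^sub>R axis j 1))) (at s)"
    by (rule DERIV_cmult)
next
  show "(\<lambda>z. v z * moll \<epsilon> (z - (y + s *\<^sub>R axis j 1))) integrable_on cbox a b" for s
    by (intro integrable_continuous continuous_on_mult v moll_translate_continuous)
  have "continuous_on (UNIV \<times> cbox a b) (\<lambda>w. v (snd w) * - pd j (moll \<epsilon>) (snd w - (y + fst w *\<^sub>R axis j 1)))"
    by (intro continuous_on_mult continuous_on_minus continuous_on_compose2[OF v] continuous_on_compose2[OF pd_moll_continuous[of UNIV]] continuous_intros) auto
  then show "continuous_on (UNIV \<times> cbox a b) (\<lambda>(s, z). v z * - pd j (moll \<epsilon>) (z - (y + s *\<^sub>R axis j 1)))"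
    by (simp add: case_prod_unfold)
qed auto

lemma dmollify_continuous:
  assumes v: "continuous_on (cbox a b) v"
  shows "continuous_on S (dmollify j \<epsilon> a b v)"
proof -
  have "continuous_on (UNIV \<times> cbox a b) (\<lambda>w. v (snd w) * - pd j (moll \<epsilon>) (snd w - fst w))"
    by (intro continuous_on_mult continuous_on_minus continuous_on_compose2[OF v] continuous_on_compose2[OF pd_moll_continuous[of UNIV]] continuous_intros) auto
  then have "continuous_on (UNIV \<times> cbox a b) (\<lambda>(x, z). v z * - pd j (moll \<epsilon>) (z - x))"
    by (simp add: case_prod_unfold)
  then have "continuous_on UNIV (dmollify j \<epsilon> a b v)"
    unfolding dmollify_def[abs_def] by (rule integral_continuous_on_param)
  then show ?thesis using continuous_on_subset by blast
qed

text \<open>The kernel is nonnegative with mass one, so the mollification is an average of the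
  values of \<open>v\<close> on the ball.\<close>

lemma mollify_close:
  fixes v :: "real^'n \<Rightarrow> real"
  assumes \<epsilon>: "\<epsilon> > 0" and v: "continuous_on (cbox a b) v" and sub: "cball x \<epsilon> \<subseteq> cbox a b"
    and close: "\<And>z. z \<in> cball x \<epsilon> \<Longrightarrow> \<bar>v z - v x\<bar> \<le> \<theta>"
  shows "\<bar>mollify \<epsilon> a b v x - v x\<bar> \<le> \<theta>"
proof -
  let ?m = "\<lambda>z. moll \<epsilon> (z - x)"
  have supp: "?m z = 0" if "z \<notin> cbox a b" for z
    using moll_translate_support[OF \<epsilon>] sub that by blast
  have one: "integral (cbox a b) ?m = 1"
    using continuous_compact_support_integrable(3,4)[OF moll_translate_continuous supp] moll_translate_integral(2)[OF \<epsilon>, of x] by simp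
  have im: "(\<lambda>z. c * ?m z) integrable_on cbox a b" for c
    by (intro integrable_continuous continuous_on_mult moll_translate_continuous continuous_on_const)
  have iv: "(\<lambda>z. v z * ?m z) integrable_on cbox a b"
    by (intro integrable_continuous continuous_on_mult v moll_translate_continuous)
  have "mollify \<epsilon> a b v x - v x = integral (cbox a b) (\<lambda>z. v z * ?m z) - integral (cbox a b) (\<lambda>z. v x * ?m z)"
    by (simp add: mollify_def one)
  also have "\<dots> = integral (cbox a b) (\<lambda>z. v z * ?m z - v x * ?m z)"
    by (rule integral_diff[symmetric, OF iv im])
  finally have eq: "mollify \<epsilon> a b v x - v x = integral (cbox a b) (\<lambda>z. v z * ?m z - v x * ?m z)" .
  have "norm (integral (cbox a b) (\<lambda>z. v z * ?m z - v x * ?m z)) \<le> integral (cbox a b) (\<lambda>z. \<theta> * ?m z)"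
  proof (rule integral_norm_bound_integral)
    show "(\<lambda>z. v z * ?m z - v x * ?m z) integrable_on cbox a b" by (rule integrable_diff[OF iv im])
    show "norm (v z * ?m z - v x * ?m z) \<le> \<theta> * ?m z" for z
    proof (cases "z \<in> cball x \<epsilon>")
      case True
      have "norm (v z * ?m z - v x * ?m z) = \<bar>v z - v x\<bar> * ?m z"
        using moll_nonneg[OF \<epsilon>, of "z - x"] by (simp add: left_diff_distrib[symmetric] abs_mult)
      then show ?thesis using mult_right_mono[OF close[OF True] moll_nonneg[OF \<epsilon>]] by simp
    qed (simp add: moll_translate_support[OF \<epsilon>])
  qed (rule im)
  then show ?thesis by (simp add: eq one)
qed

lemma moll_test_function:
  fixes x :: "real^'n"
  assumes \<epsilon>: "\<epsilon> > 0" and sub: "cball x \<epsilon> \<subseteq> \<Omega>"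
  shows "test_function \<Omega> (\<lambda>z. moll \<epsilon> (z - x))"
proof -
  have "Ck k (\<lambda>z. moll \<epsilon> (z + (- x)))" for k
    using Ck_affine_compose[OF bounded_linear_ident smooth_Ck[OF moll_smooth]] .
  then have "smooth (\<lambda>z. moll \<epsilon> (z - x))" by (simp add: smooth_def)
  moreover have cl: "closure {z. moll \<epsilon> (z - x) \<noteq> 0} \<subseteq> cball x \<epsilon>"
    using moll_translate_support[OF \<epsilon>] by (intro closure_minimal) blast+
  moreover have "compact (closure {z. moll \<epsilon> (z - x) \<noteq> 0})"
    using cl bounded_subset[OF bounded_cball] by (auto simp: compact_eq_bounded_closed)
  ultimately show ?thesis using sub by (auto simp: test_function_def)
qed

text \<open>The translated kernel is a test function. The minus sign in \<open>dmollify\<close>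
  cancels the one in the definition of the distributional derivative.\<close>

lemma dmollify_eq_signed_integral:
  fixes f :: "real^'n \<Rightarrow> real^'m"
  assumes D: "distributional_derivative \<Omega> f \<mu>" and f: "continuous_on (cbox a b) f"
    and sub: "cbox a b \<subseteq> \<Omega>" and \<epsilon>: "\<epsilon> > 0" and x: "cball x \<epsilon> \<subseteq> cbox a b"
  shows "dmollify j \<epsilon> a b (\<lambda>z. f z $ i) x = signed_integral \<Omega> (\<lambda>B. \<mu> B $ i $ j) (\<lambda>z. moll \<epsilon> (z - x))"
proof -
  let ?\<phi> = "\<lambda>z. moll \<epsilon> (z - x)"
  have "test_function \<Omega> ?\<phi>" by (rule moll_test_function[OF \<epsilon>]) (use x sub in blast)
  then have "(LINT z:\<Omega>|lebesgue. f z $ i * partial j ?\<phi> z) = - signed_integral \<Omega> (\<lambda>B. \<mu> B $ i $ j) ?\<phi>"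
    using D unfolding distributional_derivative_def by blast
  moreover have p: "partial j ?\<phi> z = pd j (moll \<epsilon>) (z - x)" for z
    using pd_translate[OF moll_smooth, of j \<epsilon> x z] by (simp add: partial_def pd_def)
  moreover have "(LINT z:\<Omega>|lebesgue. f z $ i * pd j (moll \<epsilon>) (z - x)) = integral (cbox a b) (\<lambda>z. f z $ i * pd j (moll \<epsilon>) (z - x))"
  proof -
    have z0: "pd j (moll \<epsilon>) (z - x) = 0" if "z \<notin> cbox a b" for z
    proof -
      have o: "open (- cball x \<epsilon>)" by auto
      have "z \<in> - cball x \<epsilon>" using that x by blast
      have "(?\<phi> has_derivative (\<lambda>_. 0)) (at z)"
        by (rule has_derivative_transform_within_open[where f = "\<lambda>_. 0", OF has_derivative_const o \<open>z \<in> - cball x \<epsilon>\<close>])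
           (use moll_translate_support[OF \<epsilon>] in simp)
      then have "frechet_derivative ?\<phi> (at z) = (\<lambda>_. 0)" by (metis frechet_derivative_at)
      then show ?thesis unfolding p[symmetric] by (simp add: partial_def)
    qed
    have "(LINT z:\<Omega>|lebesgue. f z $ i * pd j (moll \<epsilon>) (z - x)) = (LINT z:cbox a b|lebesgue. f z $ i * pd j (moll \<epsilon>) (z - x))"
      unfolding set_lebesgue_integral_def
      using sub z0 by (intro Bochner_Integration.integral_cong) (auto split: split_indicator)
    also have "\<dots> = integral (cbox a b) (\<lambda>z. f z $ i * pd j (moll \<epsilon>) (z - x))"
    proof (rule set_lebesgue_integral_eq_integral(2))
      show "set_integrable lebesgue (cbox a b) (\<lambda>z. f z $ i * pd j (moll \<epsilon>) (z - x))"
        by (intro absolutely_integrable_continuous continuous_on_mult continuous_on_component f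
            continuous_on_compose2[OF pd_moll_continuous[of UNIV]] continuous_intros) auto
    qed
    finally show ?thesis .
  qed
  ultimately show ?thesis by (simp add: dmollify_def)
qed

lemma set_integrable_bounded_linear:
  assumes T: "bounded_linear T" and f: "set_integrable M B f"
  shows "set_integrable M B (\<lambda>x. T (f x))" "(LINT x:B|M. T (f x)) = T (LINT x:B|M. f x)"
proof -
  interpret T: bounded_linear T by (rule T)
  have eq: "indicator B x *\<^sub>R T (f x) = T (indicator B x *\<^sub>R f x)" for x by (simp add: T.scaleR)
  show "set_integrable M B (\<lambda>x. T (f x))"
    using integrable_bounded_linear[OF T f[unfolded set_integrable_def]] by (simp add: set_integrable_def eq)
  show "(LINT x:B|M. T (f x)) = T (LINT x:B|M. f x)"
    using integral_bounded_linear[OF T f[unfolded set_integrable_def]] by (simp add: set_lebesgue_integral_def eq)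
qed

lemma bounded_linear_entry: "bounded_linear (\<lambda>A :: real^'n^'m. A $ i $ j)"
  by (rule bounded_linear_compose[of "\<lambda>x. x $ j" "\<lambda>A. A $ i", OF bounded_linear_vec_nth bounded_linear_vec_nth])

text \<open>The measures \<open>jordan_pos\<close> live on the Borel subsets of
  \<open>\<Omega>\<close>. Pushed forward along the inclusion they live on all Borel sets, as the
  product measure arguments expect.\<close>

lemma nn_integral_restrict_borel:
  assumes \<Omega>: "\<Omega> \<in> sets borel" and M: "sets M = borel_subsets \<Omega>" and fin: "finite_measure M" and Q: "Q \<in> sets borel" "Q \<subseteq> \<Omega>"
    and u: "u \<in> borel_measurable borel"
  defines "M' \<equiv> distr M borel (\<lambda>x. x)"
  shows "(\<integral>\<^sup>+x. u x \<partial>M) = (\<integral>\<^sup>+x. u x \<partial>M')" "emeasure M' Q = emeasure M Q" "finite_measure M'" "sets M' = sets borel"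
proof -
  have id: "(\<lambda>x. x) \<in> measurable M borel"
    using measurable_restrict_space1[of "\<lambda>x. x" borel borel \<Omega>] borel_subsets_eq_sets[OF \<Omega>] M
      measurable_cong_sets[of M "restrict_space borel \<Omega>" borel borel] by auto
  show "(\<integral>\<^sup>+x. u x \<partial>M) = (\<integral>\<^sup>+x. u x \<partial>M')" unfolding M'_def
    by (subst nn_integral_distr) (use id u in auto)
  have "Q \<in> sets M" using M Q by (simp add: borel_subsets_def)
  then have "(\<lambda>x. x) -` Q \<inter> space M = Q" using sets.sets_into_space by blast
  then show "emeasure M' Q = emeasure M Q" unfolding M'_def using emeasure_distr[OF id Q(1)] by simp
  show "finite_measure M'" unfolding M'_def by (rule finite_measure.finite_measure_distr[OF fin id])
  show "sets M' = sets borel" by (simp add: M'_def)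
qed

text \<open>Pointwise the derivative error is bounded by the mollifications of three positive
  measures: \<open>\<bar>G - L\<bar>\<close> times Lebesgue measure, entrywise, and the two Jordan
  parts of the singular part. Integration over \<open>S\<close> replaces each by its mass on the
  box. No \<open>\<epsilon>\<close> is left in the bound.\<close>

lemma dmollify_L1_bound:
  fixes f :: "real^'n \<Rightarrow> real^'m" and G :: "real^'n \<Rightarrow> real^'n^'m"
  assumes \<Omega>: "open \<Omega>" and D: "distributional_derivative \<Omega> f \<mu>" and \<mu>s: "vector_measure \<Omega> \<mu>s"
    and G: "G absolutely_integrable_on \<Omega>"
    and dec: "\<And>B. B \<in> borel_subsets \<Omega> \<Longrightarrow> \<mu> B = (LINT x:B|lebesgue. G x) + \<mu>s B"
    and f: "continuous_on (cbox a b) f" and ab: "cbox a b \<subseteq> \<Omega>" and \<epsilon>: "\<epsilon> > 0"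
    and S: "S \<in> sets borel" "\<And>x. x \<in> S \<Longrightarrow> cball x \<epsilon> \<subseteq> cbox a b"
  shows "(\<integral>\<^sup>+x. indicator S x * ennreal \<bar>dmollify j \<epsilon> a b (\<lambda>z. f z $ i) x - L\<bar> \<partial>lborel)
    \<le> ennreal (integral (cbox a b) (\<lambda>z. \<bar>G z $ i $ j - L\<bar>))
      + emeasure (jordan_pos \<Omega> (\<lambda>B. \<mu>s B $ i $ j)) (cbox a b)
      + emeasure (jordan_pos \<Omega> (\<lambda>B. - (\<mu>s B $ i $ j))) (cbox a b)"
proof -
  let ?Q = "cbox a b" and ?\<phi> = "\<lambda>x z. moll \<epsilon> (z - x)"
  define g where "g z = G z $ i $ j" for z
  define \<nu> \<nu>s where "\<nu> B = \<mu> B $ i $ j" and "\<nu>s B = \<mu>s B $ i $ j" for B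
  have \<Omega>b: "\<Omega> \<in> sets borel" and \<Omega>l: "\<Omega> \<in> sets lebesgue" using \<Omega> by auto
  have \<nu>: "vector_measure \<Omega> \<nu>" unfolding \<nu>_def
    using D by (intro vector_measure_entry) (simp add: distributional_derivative_def)
  have \<nu>s: "vector_measure \<Omega> \<nu>s" unfolding \<nu>s_def by (rule vector_measure_entry[OF \<mu>s])
  have g: "g absolutely_integrable_on \<Omega>"
    unfolding g_def by (rule set_integrable_bounded_linear(1)[OF bounded_linear_entry G])
  have decr: "\<nu> B = (LINT x:B|lebesgue. g x) + \<nu>s B" if B: "B \<in> borel_subsets \<Omega>" for B
  proof -
    have "set_integrable lebesgue B G"
      by (rule set_integrable_subset[OF G]) (use B in \<open>auto simp: borel_subsets_def\<close>)
    from set_integrable_bounded_linear(2)[OF bounded_linear_entry this, of i j]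
    show ?thesis using dec[OF B] by (simp add: \<nu>_def \<nu>s_def g_def)
  qed
  have gQ: "set_integrable lebesgue ?Q (\<lambda>z. \<bar>g z - L\<bar>)"
  proof -
    have "g absolutely_integrable_on ?Q"
      by (rule set_integrable_subset[OF g]) (use ab in auto)
    then have "(\<lambda>z. g z - L) absolutely_integrable_on ?Q"
      by (intro set_integral_diff(1) absolutely_integrable_on_const) auto
    then show ?thesis using set_integrable_abs by blast
  qed
  have hi: "integrable lebesgue (\<lambda>z. indicator ?Q z * \<bar>g z - L\<bar>)"
    using gQ by (simp add: set_integrable_def)
  \<comment> \<open>The density error as a finite Borel measure, so that it can be averaged in the
    same way as the singular parts.\<close>
  define M0 where "M0 = distr (density lebesgue (\<lambda>z. ennreal (indicator ?Q z * \<bar>g z - L\<bar>))) borel (\<lambda>z. z)"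
  have idl: "(\<lambda>z. z) \<in> measurable (density lebesgue h) borel" for h
    by (simp add: measurable_completion)
  have hm: "(\<lambda>z. ennreal (indicator ?Q z * \<bar>g z - L\<bar>)) \<in> borel_measurable lebesgue"
    using hi by simp
  have M0_nn: "(\<integral>\<^sup>+z. u z \<partial>M0) = (\<integral>\<^sup>+z. ennreal (indicator ?Q z * \<bar>g z - L\<bar>) * u z \<partial>lebesgue)"
    if u: "u \<in> borel_measurable borel" for u :: "real^'n \<Rightarrow> ennreal"
    unfolding M0_def using u hm
    by (subst nn_integral_distr[OF idl]) (auto simp: nn_integral_density measurable_completion)
  have total: "(\<integral>\<^sup>+z. ennreal (indicator ?Q z * \<bar>g z - L\<bar>) \<partial>lebesgue) = ennreal (integral ?Q (\<lambda>z. \<bar>g z - L\<bar>))"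
    using nn_integral_eq_integral[OF hi] set_lebesgue_integral_eq_integral(2)[OF gQ]
    by (simp add: set_lebesgue_integral_def)
  have M0_Q: "emeasure M0 ?Q \<le> ennreal (integral ?Q (\<lambda>z. \<bar>g z - L\<bar>))"
  proof -
    have "emeasure M0 ?Q = (\<integral>\<^sup>+z. indicator ?Q z \<partial>M0)" by (simp add: M0_def)
    also have "\<dots> = (\<integral>\<^sup>+z. ennreal (indicator ?Q z * \<bar>g z - L\<bar>) * indicator ?Q z \<partial>lebesgue)"
      by (rule M0_nn) simp
    also have "\<dots> \<le> (\<integral>\<^sup>+z. ennreal (indicator ?Q z * \<bar>g z - L\<bar>) \<partial>lebesgue)"
      by (intro nn_integral_mono) (auto split: split_indicator)
    finally show ?thesis by (simp only: total)
  qed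
  have M0_fin: "finite_measure M0"
  proof (rule finite_measureI)
    have "emeasure M0 UNIV = (\<integral>\<^sup>+z. 1 \<partial>M0)" by (simp add: M0_def)
    also have "\<dots> = (\<integral>\<^sup>+z. ennreal (indicator ?Q z * \<bar>g z - L\<bar>) * 1 \<partial>lebesgue)" by (rule M0_nn) simp
    finally show "emeasure M0 (space M0) \<noteq> \<infinity>" using total by (simp add: M0_def)
  qed
  have M0_sets: "sets M0 = sets borel" by (simp add: M0_def)
  define J1 J2 where "J1 = distr (jordan_pos \<Omega> \<nu>s) borel (\<lambda>x. x)" and "J2 = distr (jordan_pos \<Omega> (\<lambda>B. - \<nu>s B)) borel (\<lambda>x. x)"
  note \<nu>s' = vector_measure_uminus[OF \<nu>s]
  have Qb: "?Q \<in> sets borel" by simp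
  note R1 = nn_integral_restrict_borel[OF \<Omega>b sets_jordan_pos[OF \<nu>s \<Omega>b] finite_measure_jordan_pos[OF \<nu>s \<Omega>b] Qb ab, folded J1_def]
  note R2 = nn_integral_restrict_borel[OF \<Omega>b sets_jordan_pos[OF \<nu>s' \<Omega>b] finite_measure_jordan_pos[OF \<nu>s' \<Omega>b] Qb ab, folded J2_def]
  have \<phi>m: "(\<lambda>z. ennreal (?\<phi> x z)) \<in> borel_measurable borel" for x
    by (intro measurable_compose[OF _ measurable_ennreal] moll_measurable) simp
  let ?N = "\<lambda>M x. \<integral>\<^sup>+z. ennreal (?\<phi> x z) \<partial>M"
  have pt: "ennreal \<bar>dmollify j \<epsilon> a b (\<lambda>z. f z $ i) x - L\<bar> \<le> ?N M0 x + ?N J1 x + ?N J2 x" if x: "x \<in> S" for x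
  proof -
    note ball = S(2)[OF x]
    have "ennreal \<bar>signed_integral \<Omega> \<nu> (?\<phi> x) - L * integral\<^sup>L lborel (?\<phi> x)\<bar>
      \<le> (\<integral>\<^sup>+z. ennreal (?\<phi> x z * \<bar>g z - L\<bar>) \<partial>lebesgue_on \<Omega>)
      + (\<integral>\<^sup>+z. ennreal (?\<phi> x z) \<partial>jordan_pos \<Omega> \<nu>s) + (\<integral>\<^sup>+z. ennreal (?\<phi> x z) \<partial>jordan_pos \<Omega> (\<lambda>B. - \<nu>s B))"
    proof (rule signed_integral_estimate[OF \<Omega> \<nu> \<nu>s g decr moll_translate_continuous moll_nonneg[OF \<epsilon>] _ ab])
      show "?\<phi> x z = 0" if "z \<notin> cbox a b" for z
        using ball that by (intro moll_translate_support[OF \<epsilon>]) blast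
    qed
    moreover have "signed_integral \<Omega> \<nu> (?\<phi> x) = dmollify j \<epsilon> a b (\<lambda>z. f z $ i) x"
      unfolding \<nu>_def by (rule dmollify_eq_signed_integral[OF D f ab \<epsilon> ball, symmetric])
    moreover have "(\<integral>\<^sup>+z. ennreal (?\<phi> x z * \<bar>g z - L\<bar>) \<partial>lebesgue_on \<Omega>) = ?N M0 x"
    proof -
      have "(\<integral>\<^sup>+z. ennreal (?\<phi> x z * \<bar>g z - L\<bar>) \<partial>lebesgue_on \<Omega>)
         = (\<integral>\<^sup>+z. ennreal (?\<phi> x z * \<bar>g z - L\<bar>) * indicator \<Omega> z \<partial>lebesgue)"
        using \<Omega>l by (intro nn_integral_restrict_space) simp
      also have "\<dots> = (\<integral>\<^sup>+z. ennreal (indicator ?Q z * \<bar>g z - L\<bar>) * ennreal (?\<phi> x z) \<partial>lebesgue)"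
      proof (intro nn_integral_cong)
        fix z
        show "ennreal (?\<phi> x z * \<bar>g z - L\<bar>) * indicator \<Omega> z = ennreal (indicator ?Q z * \<bar>g z - L\<bar>) * ennreal (?\<phi> x z)"
        proof (cases "z \<in> ?Q")
          case True
          then show ?thesis using ab by (auto simp: ennreal_mult'[symmetric] mult.commute)
        next
          case False
          then have "?\<phi> x z = 0" using ball by (intro moll_translate_support[OF \<epsilon>]) blast
          then show ?thesis by simp
        qed
      qed
      also have "\<dots> = ?N M0 x" by (rule M0_nn[OF \<phi>m, symmetric])
      finally show ?thesis .
    qed
    ultimately show ?thesis
      by (simp add: moll_translate_integral(2)[OF \<epsilon>] R1(1)[OF \<phi>m] R2(1)[OF \<phi>m])
  qed
  \<comment> \<open>The facts in \<open>R1\<close> and \<open>R2\<close> share an integrand as a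
    parameter; the zero function fills it in where only the measures matter.\<close>
  have dummy: "(\<lambda>_. 0) \<in> borel_measurable borel" by simp
  note fin1 = R1(3)[OF dummy] and fin2 = R2(3)[OF dummy] and sets1 = R1(4)[OF dummy] and sets2 = R2(4)[OF dummy]
  have Sm: "indicator S \<in> borel_measurable lborel" using S(1) by simp
  note m0 = nn_integral_moll_measurable[OF M0_sets M0_fin, of \<epsilon>]
    and m1 = nn_integral_moll_measurable[OF sets1 fin1, of \<epsilon>] and m2 = nn_integral_moll_measurable[OF sets2 fin2, of \<epsilon>]
  have "(\<integral>\<^sup>+x. indicator S x * ennreal \<bar>dmollify j \<epsilon> a b (\<lambda>z. f z $ i) x - L\<bar> \<partial>lborel)
     \<le> (\<integral>\<^sup>+x. indicator S x * ?N M0 x + indicator S x * ?N J1 x + indicator S x * ?N J2 x \<partial>lborel)"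
    using pt by (intro nn_integral_mono) (auto split: split_indicator)
  also have "\<dots> = (\<integral>\<^sup>+x. indicator S x * ?N M0 x \<partial>lborel) + (\<integral>\<^sup>+x. indicator S x * ?N J1 x \<partial>lborel)
      + (\<integral>\<^sup>+x. indicator S x * ?N J2 x \<partial>lborel)"
    by (subst nn_integral_add; (subst nn_integral_add)?)
       (intro borel_measurable_add borel_measurable_times_ennreal Sm m0 m1 m2 refl)+
  also have "\<dots> \<le> emeasure M0 ?Q + emeasure J1 ?Q + emeasure J2 ?Q"
    by (intro add_mono nn_integral_moll_average[OF \<epsilon>] M0_sets M0_fin sets1 sets2 fin1 fin2 S Qb)
  also have "\<dots> \<le> ennreal (integral ?Q (\<lambda>z. \<bar>g z - L\<bar>)) + emeasure (jordan_pos \<Omega> \<nu>s) ?Q + emeasure (jordan_pos \<Omega> (\<lambda>B. - \<nu>s B)) ?Q"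
    unfolding R1(2)[OF dummy] R2(2)[OF dummy] by (intro add_right_mono M0_Q)
  finally show ?thesis unfolding g_def \<nu>s_def .
qed

section \<open>Averaging over translated segments\<close>

lemma nn_integral_lborel_translate:
  fixes u :: "'a::euclidean_space \<Rightarrow> ennreal"
  assumes "u \<in> borel_measurable borel"
  shows "(\<integral>\<^sup>+x. u (x + c) \<partial>lborel) = (\<integral>\<^sup>+x. u x \<partial>lborel)"
proof -
  have "(\<integral>\<^sup>+x. u x \<partial>lborel) = (\<integral>\<^sup>+x. u x \<partial>distr lborel borel ((+) c))" by (simp add: lborel_distr_plus)
  also have "\<dots> = (\<integral>\<^sup>+x. u (c + x) \<partial>lborel)" by (rule nn_integral_distr) (use assms in auto)
  finally show ?thesis by (simp add: add.commute)
qed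

text \<open>For fixed \<open>s\<close> in \<open>I\<close> the integral over \<open>x\<close> runs
  over a translate of \<open>X\<close> inside \<open>S\<close> and is at most \<open>c\<close>;
  exchanging the integrals leaves only the length of \<open>I\<close> as a factor.\<close>

lemma nn_integral_line_average:
  fixes k :: "'a::euclidean_space \<Rightarrow> ennreal"
  assumes k: "k \<in> borel_measurable borel" and S: "S \<in> sets borel" and c: "(\<integral>\<^sup>+x. indicator S x * k x \<partial>lborel) \<le> c"
    and X: "X \<in> sets borel" and I: "I \<in> sets (borel :: real measure)"
    and sub: "\<And>x s. x \<in> X \<Longrightarrow> s \<in> I \<Longrightarrow> x + y + s *\<^sub>R v \<in> S"
  shows "(\<integral>\<^sup>+x. indicator X x * (\<integral>\<^sup>+s. indicator I s * k (x + y + s *\<^sub>R v) \<partial>lborel) \<partial>lborel) \<le> emeasure lborel I * c"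
    and "(\<lambda>x. \<integral>\<^sup>+s. indicator I s * k (x + y + s *\<^sub>R v) \<partial>lborel) \<in> borel_measurable borel"
proof -
  have "continuous_on UNIV (\<lambda>p :: 'a \<times> real. fst p + y + snd p *\<^sub>R v)" by (intro continuous_intros)
  then have "(\<lambda>p :: 'a \<times> real. fst p + y + snd p *\<^sub>R v) \<in> borel_measurable (borel \<Otimes>\<^sub>M borel)"
    unfolding borel_prod by (rule borel_measurable_continuous_onI)
  from measurable_compose[OF this k]
  have km: "(\<lambda>p. k (fst p + y + snd p *\<^sub>R v)) \<in> borel_measurable (lborel \<Otimes>\<^sub>M lborel)"
    by (simp add: measurable_cong_sets[OF sets_pair_measure_cong[OF sets_lborel sets_lborel] refl])
  have Im: "indicator I \<in> borel_measurable lborel" and Xm: "indicator X \<in> borel_measurable lborel" using I X by auto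
  have m1: "(\<lambda>(x, s). indicator I s * k (x + y + s *\<^sub>R v)) \<in> borel_measurable (lborel \<Otimes>\<^sub>M lborel)"
    unfolding case_prod_unfold
    by (intro borel_measurable_times_ennreal measurable_compose[OF measurable_snd Im] km)
  show m2: "(\<lambda>x. \<integral>\<^sup>+s. indicator I s * k (x + y + s *\<^sub>R v) \<partial>lborel) \<in> borel_measurable borel"
    using lborel.borel_measurable_nn_integral[OF m1] by simp
  have m: "(\<lambda>(x, s). indicator X x * (indicator I s * k (x + y + s *\<^sub>R v))) \<in> borel_measurable (lborel \<Otimes>\<^sub>M lborel)"
    unfolding case_prod_unfold
    by (rule borel_measurable_times_ennreal[OF measurable_compose[OF measurable_fst Xm] m1[unfolded case_prod_unfold]])
  have line: "(\<lambda>s. indicator I s * k (x + y + s *\<^sub>R v)) \<in> borel_measurable lborel" for x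
    using measurable_compose[OF measurable_Pair1' m1, of x] by simp
  have "(\<integral>\<^sup>+x. indicator X x * (\<integral>\<^sup>+s. indicator I s * k (x + y + s *\<^sub>R v) \<partial>lborel) \<partial>lborel)
     = (\<integral>\<^sup>+x. (\<integral>\<^sup>+s. indicator X x * (indicator I s * k (x + y + s *\<^sub>R v)) \<partial>lborel) \<partial>lborel)"
    by (intro nn_integral_cong nn_integral_cmult[symmetric] line)
  also have "\<dots> = (\<integral>\<^sup>+s. (\<integral>\<^sup>+x. indicator X x * (indicator I s * k (x + y + s *\<^sub>R v)) \<partial>lborel) \<partial>lborel)"
    using lborel_pair.Fubini'[OF m] by simp
  also have "\<dots> \<le> (\<integral>\<^sup>+s. indicator I s * c \<partial>lborel)"
  proof (rule nn_integral_mono)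
    fix s :: real
    show "(\<integral>\<^sup>+x. indicator X x * (indicator I s * k (x + y + s *\<^sub>R v)) \<partial>lborel) \<le> indicator I s * c"
    proof (cases "s \<in> I")
      case True
      let ?t = "y + s *\<^sub>R v"
      have Sk: "(\<lambda>x. indicator S x * k x) \<in> borel_measurable borel" using k S by (intro borel_measurable_times_ennreal) auto
      have "(\<integral>\<^sup>+x. indicator X x * (indicator I s * k (x + y + s *\<^sub>R v)) \<partial>lborel) \<le> (\<integral>\<^sup>+x. indicator S (x + ?t) * k (x + ?t) \<partial>lborel)"
        using sub True by (intro nn_integral_mono) (auto split: split_indicator simp: add.assoc)
      also have "\<dots> = (\<integral>\<^sup>+x. indicator S x * k x \<partial>lborel)" by (rule nn_integral_lborel_translate[OF Sk])
      finally show ?thesis using c True by simp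
    qed simp
  qed
  also have "\<dots> = emeasure lborel I * c" using I by (simp add: nn_integral_multc)
  finally show "(\<integral>\<^sup>+x. indicator X x * (\<integral>\<^sup>+s. indicator I s * k (x + y + s *\<^sub>R v) \<partial>lborel) \<partial>lborel) \<le> emeasure lborel I * c" .
qed

text \<open>If some \<open>V \<alpha>\<close> exceeded \<open>c\<close> at every point of
  \<open>X\<close>, their sum would be at least \<open>c\<close> on \<open>X\<close>, and
  integrating it would contradict \<open>big\<close>.\<close>

lemma common_small_point:
  fixes V :: "'b \<Rightarrow> 'a::euclidean_space \<Rightarrow> ennreal"
  assumes A: "finite A" and V: "\<And>\<alpha>. \<alpha> \<in> A \<Longrightarrow> V \<alpha> \<in> borel_measurable borel"
    and int: "\<And>\<alpha>. \<alpha> \<in> A \<Longrightarrow> (\<integral>\<^sup>+x. indicator X x * V \<alpha> x \<partial>lborel) \<le> b"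
    and X: "X \<in> sets borel" and big: "of_nat (card A) * b < c * emeasure lborel X"
  obtains x where "x \<in> X" "\<And>\<alpha>. \<alpha> \<in> A \<Longrightarrow> V \<alpha> x \<le> c"
proof (rule ccontr)
  assume no: "\<not> thesis"
  note found = that
  have "\<exists>\<alpha>\<in>A. c < V \<alpha> x" if "x \<in> X" for x
    using no found[of x] that by (meson not_less)
  then have ge: "c \<le> (\<Sum>\<alpha>\<in>A. V \<alpha> x)" if "x \<in> X" for x
    using that A by (metis (no_types, lifting) less_imp_le member_le_sum order_trans zero_le)
  have "c * emeasure lborel X = (\<integral>\<^sup>+x. c * indicator X x \<partial>lborel)" using X by (simp add: nn_integral_cmult)
  also have "\<dots> \<le> (\<integral>\<^sup>+x. (\<Sum>\<alpha>\<in>A. indicator X x * V \<alpha> x) \<partial>lborel)"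
    using ge by (intro nn_integral_mono) (auto split: split_indicator)
  also have "\<dots> = (\<Sum>\<alpha>\<in>A. \<integral>\<^sup>+x. indicator X x * V \<alpha> x \<partial>lborel)"
    using X V by (intro nn_integral_sum borel_measurable_times_ennreal) auto
  also have "\<dots> \<le> (\<Sum>\<alpha>\<in>A. b)" by (intro sum_mono int)
  finally show False using big by simp
qed

lemma oscillation_le_nn_integral:
  fixes F h :: "real \<Rightarrow> real"
  assumes F: "\<And>s. (F has_real_derivative h s) (at s)" and h: "continuous_on UNIV h"
    and c: "(\<integral>\<^sup>+s. indicator {-t..t} s * ennreal \<bar>h s\<bar> \<partial>lborel) \<le> ennreal c" "c \<ge> 0" and s: "\<bar>s\<bar> \<le> t"
  shows "\<bar>F s - F 0\<bar> \<le> c"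
proof -
  have *: "\<bar>F q - F p\<bar> \<le> c" if pq: "p \<le> q" "-t \<le> p" "q \<le> t" for p q
  proof -
    have hc: "continuous_on {p..q} h" using h continuous_on_subset by blast
    have "(h has_integral (F q - F p)) {p..q}"
      using F pq(1) by (intro fundamental_theorem_of_calculus)
        (auto simp: has_real_derivative_iff_has_vector_derivative[symmetric] intro: DERIV_subset)
    then have "F q - F p = integral {p..q} h" by (simp add: integral_unique)
    then have "\<bar>F q - F p\<bar> \<le> integral {p..q} (\<lambda>s. \<bar>h s\<bar>)"
      using integral_norm_bound_integral[of h "{p..q}" "\<lambda>s. \<bar>h s\<bar>"] hc
      by (auto intro!: integrable_continuous_interval continuous_intros)
    moreover have "ennreal (integral {p..q} (\<lambda>s. \<bar>h s\<bar>)) \<le> ennreal c"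
    proof -
      have si: "set_integrable lborel {p..q} (\<lambda>s. \<bar>h s\<bar>)"
        unfolding set_integrable_def using hc by (intro borel_integrable_compact) (auto intro!: continuous_intros)
      have "integral {p..q} (\<lambda>s. \<bar>h s\<bar>) = (LINT s|lborel. indicator {p..q} s * \<bar>h s\<bar>)"
        using set_borel_integral_eq_integral(2)[OF si] by (simp add: set_lebesgue_integral_def)
      also have "ennreal \<dots> = (\<integral>\<^sup>+s. ennreal (indicator {p..q} s * \<bar>h s\<bar>) \<partial>lborel)"
        using si by (intro nn_integral_eq_integral[symmetric]) (auto simp: set_integrable_def)
      also have "\<dots> \<le> (\<integral>\<^sup>+s. indicator {-t..t} s * ennreal \<bar>h s\<bar> \<partial>lborel)"
        using pq by (intro nn_integral_mono) (auto split: split_indicator)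
      finally show ?thesis using c(1) by simp
    qed
    ultimately show ?thesis using c(2) by (simp add: ennreal_le_iff)
  qed
  show ?thesis
  proof (cases "s \<ge> 0")
    case True
    then show ?thesis using *[of 0 s] s by simp
  next
    case False
    then show ?thesis using *[of s 0] s by (simp add: abs_minus_commute)
  qed
qed

section \<open>Averaging over lattices\<close>

lemma One_cart: "(One :: real^'n) $ i = 1"
proof -
  have "(One :: real^'n) $ i = (One :: real^'n) \<bullet> axis i 1" by (simp only: inner_axis real_inner_1_right)
  also have "\<dots> = 1" by (rule inner_sum_Basis) simp
  finally show ?thesis .
qed

lemma mem_cube_iff:
  "x \<in> cbox (x0 + a *\<^sub>R One) (x0 + b *\<^sub>R (One :: real^'n)) \<longleftrightarrow> (\<forall>i. x0 $ i + a \<le> x $ i \<and> x $ i \<le> x0 $ i + b)"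
  by (simp only: mem_box_cart vector_add_component vector_scaleR_component One_cart real_scaleR_def mult_1_right)

lemma emeasure_cube:
  fixes x0 :: "real^'n"
  assumes "a \<le> b"
  shows "emeasure lborel (cbox (x0 + a *\<^sub>R One) (x0 + b *\<^sub>R One)) = ennreal ((b - a) ^ CARD('n))"
proof -
  have "emeasure lborel (cbox (x0 + a *\<^sub>R One) (x0 + b *\<^sub>R One)) = (\<Prod>k\<in>Basis. ((x0 + b *\<^sub>R One) - (x0 + a *\<^sub>R One)) \<bullet> k)"
    by (rule emeasure_lborel_cbox) (use assms in \<open>simp add: inner_add_left\<close>)
  also have "(\<Prod>k\<in>Basis. ((x0 + b *\<^sub>R One) - (x0 + a *\<^sub>R One)) \<bullet> k) = (\<Prod>k\<in>(Basis :: (real^'n) set). b - a)"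
    by (intro prod.cong refl) (simp add: inner_diff_left inner_add_left)
  finally show ?thesis by simp
qed

lemma finite_grid_points: "finite {p \<in> grid_box. \<forall>i. (p :: real^'n) $ i \<in> \<int>}"
proof (rule finite_subset)
  show "{p \<in> grid_box. \<forall>i. (p :: real^'n) $ i \<in> \<int>} \<subseteq> vec_lambda ` (UNIV \<rightarrow>\<^sub>E of_int ` {-2..2})"
  proof
    fix p :: "real^'n" assume p: "p \<in> {p \<in> grid_box. \<forall>i. p $ i \<in> \<int>}"
    have "p $ i \<in> of_int ` {-2..2}" for i
    proof -
      obtain m where m: "p $ i = of_int m" using p by (auto elim: Ints_cases)
      moreover have "\<bar>p $ i\<bar> \<le> 2" using p by (auto simp: grid_box_def)
      ultimately have "\<bar>m\<bar> \<le> 2" by linarith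
      then have "m \<in> {-2..2}" by auto
      then show ?thesis using m by blast
    qed
    then have "vec_nth p \<in> (UNIV \<rightarrow>\<^sub>E of_int ` {-2..2})" by auto
    then show "p \<in> vec_lambda ` (UNIV \<rightarrow>\<^sub>E of_int ` {-2..2})" by (metis image_eqI vec_lambda_eta)
  qed
qed (intro finite_imageI finite_PiE, auto)

text \<open>The bound \<open>c + 2 * (\<kappa> * r)\<close> of
  \<open>grid_oscillation_exists\<close>, summed over \<open>CARD('n)\<close> components and divided
  by \<open>\<kappa> * r\<close>. There \<open>c\<close> contributes \<open>8 * card A + 8\<close>
  and the mollification error 2, and \<open>card A\<close> is bounded by the number of triples of
  two indices and a lattice point.\<close>

definition osc_const :: "'n::finite itself \<Rightarrow> real" where
  "osc_const _ = real CARD('n) * (8 * real (card {p \<in> grid_box. \<forall>i. (p :: real^'n) $ i \<in> \<int>} * CARD('n) * CARD('n)) + 10)"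

text \<open>The fundamental theorem of calculus is used on the lattice lines for the mollified
  components, whose line integrals are small for a suitable translate \<open>x\<close>. On
  \<open>S\<close> these components differ from those of \<open>f\<close> by at most
  \<open>\<kappa> * r\<close>.\<close>

lemma grid_oscillation_exists:
  fixes f :: "real^'n \<Rightarrow> real^'n" and G :: "real^'n \<Rightarrow> real^'n^'n" and L :: "real^'n^'n" and x0 :: "real^'n"
  assumes \<Omega>: "open \<Omega>" and D: "distributional_derivative \<Omega> f \<mu>" and \<mu>s: "vector_measure \<Omega> \<mu>s"
    and G: "G absolutely_integrable_on \<Omega>"
    and dec: "\<And>B. B \<in> borel_subsets \<Omega> \<Longrightarrow> \<mu> B = (LINT x:B|lebesgue. G x) + \<mu>s B"
    and f: "continuous_on \<Omega> f" and r: "r > 0" and \<kappa>: "\<kappa> > 0"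
    and Q: "cbox x0 (x0 + (6 * r) *\<^sub>R One) \<subseteq> \<Omega>"
    and bound: "\<And>i j. ennreal (integral (cbox x0 (x0 + (6 * r) *\<^sub>R One)) (\<lambda>z. \<bar>G z $ i $ j - L $ i $ j\<bar>))
      + emeasure (jordan_pos \<Omega> (\<lambda>B. \<mu>s B $ i $ j)) (cbox x0 (x0 + (6 * r) *\<^sub>R One))
      + emeasure (jordan_pos \<Omega> (\<lambda>B. - (\<mu>s B $ i $ j))) (cbox x0 (x0 + (6 * r) *\<^sub>R One)) \<le> ennreal (\<kappa> * r ^ CARD('n))"
  obtains x' where "(\<lambda>y. x' + r *\<^sub>R y) ` grid_box \<subseteq> \<Omega>"
    "grid_oscillation (\<lambda>y. f (x' + r *\<^sub>R y) - L *v (r *\<^sub>R y)) (osc_const TYPE('n) * \<kappa> * r)"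
proof -
  define b where "b = x0 + (6 * r) *\<^sub>R One"
  have bQ: "cbox x0 b = cbox (x0 + 0 *\<^sub>R One) (x0 + (6 * r) *\<^sub>R One)" by (simp add: b_def)
  have fQ: "continuous_on (cbox x0 b) f" using f Q continuous_on_subset unfolding b_def by blast
  have "uniformly_continuous_on (cbox x0 b) f" by (rule compact_uniformly_continuous[OF fQ compact_cbox])
  moreover have \<theta>: "\<kappa> * r > 0" using \<kappa> r by simp
  ultimately obtain d where d: "d > 0" "\<And>x z. x \<in> cbox x0 b \<Longrightarrow> z \<in> cbox x0 b \<Longrightarrow> dist z x < d \<Longrightarrow> dist (f z) (f x) < \<kappa> * r"
    unfolding uniformly_continuous_on_def by metis
  \<comment> \<open>\<open>r / 2\<close> keeps the \<open>\<epsilon>\<close>-balls around points of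
    \<open>S\<close> inside the cube, and \<open>d / 2\<close> makes the mollification close to
    \<open>f\<close>.\<close>
  define \<epsilon> where "\<epsilon> = min (r / 2) (d / 2)"
  have \<epsilon>: "\<epsilon> > 0" "\<epsilon> \<le> r / 2" "\<epsilon> < d" using r d by (auto simp: \<epsilon>_def)
  \<comment> \<open>Coordinates relative to \<open>x0\<close>: the lattice origin ranges over
    \<open>X\<close>, from \<open>5/2 r\<close> to \<open>7/2 r\<close>; the lattice extends by
    \<open>2 r\<close> to either side, which fills \<open>S\<close>, from \<open>r/2\<close> to
    \<open>11/2 r\<close>; mollification takes another \<open>r/2\<close>. Hence the side
    \<open>6 r\<close> of the cube.\<close>
  define S where "S = cbox (x0 + (r / 2) *\<^sub>R One) (x0 + (11 / 2 * r) *\<^sub>R One)"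
  define X where "X = cbox (x0 + (5 / 2 * r) *\<^sub>R One) (x0 + (7 / 2 * r) *\<^sub>R One)"
  have ballS: "cball x \<epsilon> \<subseteq> cbox x0 b" if x: "x \<in> S" for x
  proof
    fix z assume "z \<in> cball x \<epsilon>"
    then have "norm (z - x) \<le> r / 2" using \<epsilon> by (simp add: dist_norm norm_minus_commute)
    then have zx: "\<bar>z $ i - x $ i\<bar> \<le> r / 2" for i using component_le_norm_cart[of "z - x" i] by simp
    have "x0 $ i + 0 \<le> z $ i \<and> z $ i \<le> x0 $ i + 6 * r" for i
    proof -
      have "x0 $ i + r / 2 \<le> x $ i" "x $ i \<le> x0 $ i + 11 / 2 * r"
        using x unfolding S_def mem_cube_iff by auto
      then show ?thesis using zx[of i] r by linarith
    qed
    then show "z \<in> cbox x0 b" unfolding bQ mem_cube_iff by simp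
  qed
  define P where "P = {p \<in> grid_box. \<forall>i. (p :: real^'n) $ i \<in> \<int>}"
  \<comment> \<open>One index for each component \<open>i\<close>, each direction \<open>j\<close>
    and each lattice line in that direction, given by its point with
    \<open>p $ j = 0\<close>.\<close>
  define A where "A = {(i :: 'n, j :: 'n, p). p \<in> P \<and> p $ j = 0}"
  define w where "w i j x = dmollify j \<epsilon> x0 b (\<lambda>z. f z $ i) x - L $ i $ j" for i j x
  define V where "V \<alpha> x = (case \<alpha> of (i, j, p) \<Rightarrow>
      \<integral>\<^sup>+s. indicator {- (2 * r)..2 * r} s * ennreal \<bar>w i j (x + r *\<^sub>R p + s *\<^sub>R axis j 1)\<bar> \<partial>lborel)" for \<alpha> x
  have P: "finite P" unfolding P_def by (rule finite_grid_points)
  have Asub: "A \<subseteq> UNIV \<times> UNIV \<times> P" by (auto simp: A_def)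
  have A: "finite A" by (rule finite_subset[OF Asub]) (use P in auto)
  have cardA: "card A \<le> CARD('n) * (CARD('n) * card P)"
    using card_mono[OF _ Asub] P by (simp add: card_cartesian_product)
  have comp: "continuous_on (cbox x0 b) (\<lambda>z. f z $ i)" for i by (intro continuous_on_component fQ)
  have cw: "continuous_on UNIV (w i j)" for i j
    unfolding w_def[abs_def] by (intro continuous_on_diff dmollify_continuous[OF comp] continuous_on_const)
  have km: "(\<lambda>x. ennreal \<bar>w i j x\<bar>) \<in> borel_measurable borel" for i j
    using borel_measurable_continuous_onI[OF cw, of i j] by measurable
  have L1: "(\<integral>\<^sup>+x. indicator S x * ennreal \<bar>w i j x\<bar> \<partial>lborel) \<le> ennreal (\<kappa> * r ^ CARD('n))" for i j
    unfolding w_def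
    by (rule order_trans[OF dmollify_L1_bound[OF \<Omega> D \<mu>s G dec fQ _ \<epsilon>(1) _ ballS] bound[of i j, folded b_def]])
       (use Q in \<open>auto simp: b_def S_def\<close>)
  have line: "x + r *\<^sub>R p + s *\<^sub>R axis j 1 \<in> S" if x: "x \<in> X" and p: "p \<in> P" "p $ j = 0" and s: "s \<in> {- (2 * r)..2 * r}" for x p s j
    unfolding S_def mem_cube_iff
  proof
    fix k
    have xk: "x0 $ k + 5 / 2 * r \<le> x $ k" "x $ k \<le> x0 $ k + 7 / 2 * r" using x unfolding X_def mem_cube_iff by auto
    have "\<bar>p $ k\<bar> \<le> 2" using p by (auto simp: P_def grid_box_def)
    then have "\<bar>r * p $ k\<bar> \<le> r * 2" unfolding abs_mult using r by (intro mult_mono) auto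
    then have rp: "- (2 * r) \<le> r * p $ k" "r * p $ k \<le> 2 * r" by (auto simp: abs_le_iff)
    show "x0 $ k + r / 2 \<le> (x + r *\<^sub>R p + s *\<^sub>R axis j 1) $ k \<and> (x + r *\<^sub>R p + s *\<^sub>R axis j 1) $ k \<le> x0 $ k + 11 / 2 * r"
      using xk rp s p(2) by (cases "k = j") (auto simp: axis_def)
  qed
  \<comment> \<open>The average over \<open>X\<close> of each line integral is at most
    \<open>4 * r * \<kappa>\<close>, where \<open>4 * r\<close> is the length of the segment. Twice
    the sum of the \<open>card A\<close> averages, with a positive amount added, yields the strict
    inequality for \<open>common_small_point\<close>.\<close>
  define c where "c = 8 * (real (card A) + 1) * \<kappa> * r"
  have c: "c \<ge> 0" using \<kappa> r by (simp add: c_def)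
  obtain x where x: "x \<in> X" "\<And>\<alpha>. \<alpha> \<in> A \<Longrightarrow> V \<alpha> x \<le> ennreal c"
  proof (rule common_small_point[OF A, of V X "ennreal (4 * r) * ennreal (\<kappa> * r ^ CARD('n))" "ennreal c"])
    fix \<alpha> assume \<alpha>: "\<alpha> \<in> A"
    obtain i j p where ijp: "\<alpha> = (i, j, p)" by (cases \<alpha>)
    then have p: "p \<in> P" "p $ j = 0" using \<alpha> by (auto simp: A_def)
    have Sb: "S \<in> sets borel" "X \<in> sets borel" by (simp_all add: S_def X_def)
    note avg = nn_integral_line_average[OF km Sb(1) L1 Sb(2), of "{- (2 * r)..2 * r}" "r *\<^sub>R p" "axis j 1" i j]
    show "V \<alpha> \<in> borel_measurable borel"
      unfolding V_def[abs_def] ijp prod.case by (rule avg(2)) (use line p in auto)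
    have "(\<integral>\<^sup>+x. indicator X x * V \<alpha> x \<partial>lborel) \<le> emeasure lborel {- (2 * r)..2 * r} * ennreal (\<kappa> * r ^ CARD('n))"
      unfolding V_def ijp prod.case by (rule avg(1)) (use line p in auto)
    also have "emeasure lborel {- (2 * r)..2 * r} = ennreal (4 * r)" using r by simp
    finally show "(\<integral>\<^sup>+x. indicator X x * V \<alpha> x \<partial>lborel) \<le> ennreal (4 * r) * ennreal (\<kappa> * r ^ CARD('n))" .
  next
    have eX: "emeasure lborel X = ennreal (r ^ CARD('n))"
      unfolding X_def using r by (subst emeasure_cube) auto
    have "real (card A) * (4 * r * (\<kappa> * r ^ CARD('n))) < c * r ^ CARD('n)"
    proof -
      have "0 < \<kappa> * r * r ^ CARD('n)" using \<kappa> r by simp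
      then have "real (card A) * 4 * (\<kappa> * r * r ^ CARD('n)) < 8 * (real (card A) + 1) * (\<kappa> * r * r ^ CARD('n))"
        by (intro mult_strict_right_mono) auto
      then show ?thesis by (simp add: c_def algebra_simps)
    qed
    then have "ennreal (real (card A) * (4 * r * (\<kappa> * r ^ CARD('n)))) < ennreal (c * r ^ CARD('n))"
      using \<kappa> r by (intro ennreal_lessI) (auto simp: c_def)
    then show "of_nat (card A) * (ennreal (4 * r) * ennreal (\<kappa> * r ^ CARD('n))) < ennreal c * emeasure lborel X"
      unfolding eX using \<kappa> r c by (simp add: ennreal_mult ennreal_of_nat_eq_real_of_nat)
  qed (auto simp: X_def)
  have inQ: "z \<in> cbox x0 b" if "z \<in> S" for z using ballS[OF that] \<epsilon>(1) by auto
  have grid_in: "x + r *\<^sub>R y \<in> S" if y: "y \<in> grid_box" for y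
    unfolding S_def mem_cube_iff
  proof
    fix k
    have xk: "x0 $ k + 5 / 2 * r \<le> x $ k" "x $ k \<le> x0 $ k + 7 / 2 * r" using x(1) unfolding X_def mem_cube_iff by auto
    have "\<bar>y $ k\<bar> \<le> 2" using y by (auto simp: grid_box_def)
    then have "\<bar>r * y $ k\<bar> \<le> r * 2" unfolding abs_mult using r by (intro mult_mono) auto
    then show "x0 $ k + r / 2 \<le> (x + r *\<^sub>R y) $ k \<and> (x + r *\<^sub>R y) $ k \<le> x0 $ k + 11 / 2 * r"
      using xk by (auto simp: abs_le_iff)
  qed
  have close: "\<bar>mollify \<epsilon> x0 b (\<lambda>z. f z $ i) z - f z $ i\<bar> \<le> \<kappa> * r" if z: "z \<in> S" for z i
  proof (rule mollify_close[OF \<epsilon>(1) comp ballS[OF z]])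
    fix z' assume z': "z' \<in> cball z \<epsilon>"
    have "dist (f z') (f z) < \<kappa> * r"
    proof (rule d(2)[OF inQ[OF z]])
      show "z' \<in> cbox x0 b" using z' ballS[OF z] by blast
      show "dist z' z < d" using z' \<epsilon>(3) by (simp add: dist_commute)
    qed
    then show "\<bar>f z' $ i - f z $ i\<bar> \<le> \<kappa> * r"
      using component_le_norm_cart[of "f z' - f z" i] by (simp add: dist_norm)
  qed
  have "grid_oscillation (\<lambda>y. f (x + r *\<^sub>R y) - L *v (r *\<^sub>R y)) (osc_const TYPE('n) * \<kappa> * r)"
    unfolding grid_oscillation_def
  proof (intro allI impI)
    fix p :: "real^'n" and k and s :: real
    assume p: "p \<in> grid_box" "\<forall>i. p $ i \<in> \<int>" "p $ k = 0" and s: "\<bar>s\<bar> \<le> 2"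
    have pP: "p \<in> P" using p by (simp add: P_def)
    let ?y = "x + r *\<^sub>R p" and ?e = "axis k 1 :: real^'n"
    have rs: "\<bar>r * s\<bar> \<le> 2 * r" using s r by (simp add: abs_mult)
    have yS: "?y \<in> S" by (rule grid_in[OF p(1)])
    have ysS: "?y + (r * s) *\<^sub>R ?e \<in> S" using line[OF x(1) pP p(3), of "r * s"] rs by (simp add: abs_le_iff)
    have osc: "\<bar>(f (?y + (r * s) *\<^sub>R ?e) - f ?y) $ i - L $ i $ k * (r * s)\<bar> \<le> c + 2 * (\<kappa> * r)" for i
    proof -
      let ?u = "mollify \<epsilon> x0 b (\<lambda>z. f z $ i)"
      \<comment> \<open>With the linear function removed, the derivative along the line is
        \<open>w i k\<close>, the quantity that was averaged.\<close>
      define F where "F t = ?u (?y + t *\<^sub>R ?e) - L $ i $ k * t" for t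
      have "\<bar>F (r * s) - F 0\<bar> \<le> c"
      proof (rule oscillation_le_nn_integral[OF _ _ _ c rs])
        show "(F has_real_derivative w i k (?y + t *\<^sub>R ?e)) (at t)" for t
          unfolding F_def w_def
          by (intro DERIV_diff mollify_has_derivative[OF comp]) (auto intro!: derivative_eq_intros)
        show "continuous_on UNIV (\<lambda>t. w i k (?y + t *\<^sub>R ?e))"
          by (rule continuous_on_compose2[OF cw]) (auto intro!: continuous_intros)
        have "(i, k, p) \<in> A" using pP p(3) by (simp add: A_def)
        from x(2)[OF this]
        show "(\<integral>\<^sup>+t. indicator {- (2 * r)..2 * r} t * ennreal \<bar>w i k (?y + t *\<^sub>R ?e)\<bar> \<partial>lborel) \<le> ennreal c"
          by (simp add: V_def)
      qed
      then have "\<bar>?u (?y + (r * s) *\<^sub>R ?e) - ?u ?y - L $ i $ k * (r * s)\<bar> \<le> c" by (simp add: F_def)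
      then show ?thesis
        using close[OF yS, of i] close[OF ysS, of i] unfolding vector_minus_component by linarith
    qed
    have Le: "(L *v ((r * s) *\<^sub>R ?e)) $ i = L $ i $ k * (r * s)" for i
      by (simp add: matrix_vector_mult_def axis_def if_distrib[of "\<lambda>x. _ * x"] cong: if_cong)
    have diff: "f (x + r *\<^sub>R (p + s *\<^sub>R ?e)) - L *v (r *\<^sub>R (p + s *\<^sub>R ?e)) - (f (x + r *\<^sub>R p) - L *v (r *\<^sub>R p))
        = (f (?y + (r * s) *\<^sub>R ?e) - f ?y) - L *v ((r * s) *\<^sub>R ?e)"
      by (simp add: scaleR_right_distrib matrix_vector_right_distrib add.assoc)
    have ci: "\<bar>(f (x + r *\<^sub>R (p + s *\<^sub>R ?e)) - L *v (r *\<^sub>R (p + s *\<^sub>R ?e)) - (f (x + r *\<^sub>R p) - L *v (r *\<^sub>R p))) $ i\<bar>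
        \<le> c + 2 * (\<kappa> * r)" for i
      using osc[of i] unfolding diff by (simp only: vector_minus_component Le)
    have "norm (f (x + r *\<^sub>R (p + s *\<^sub>R ?e)) - L *v (r *\<^sub>R (p + s *\<^sub>R ?e)) - (f (x + r *\<^sub>R p) - L *v (r *\<^sub>R p)))
        \<le> (\<Sum>i\<in>(UNIV :: 'n set). c + 2 * (\<kappa> * r))"
      by (rule order_trans[OF norm_le_l1_cart sum_mono[OF ci]])
    also have "\<dots> = real CARD('n) * (8 * real (card A) + 10) * (\<kappa> * r)"
      by (simp add: c_def algebra_simps)
    also have "\<dots> \<le> real CARD('n) * (8 * real (CARD('n) * (CARD('n) * card P)) + 10) * (\<kappa> * r)"
      using cardA \<theta> by (intro mult_right_mono mult_left_mono add_right_mono) (auto simp del: of_nat_mult)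
    also have "\<dots> = osc_const TYPE('n) * \<kappa> * r"
      unfolding osc_const_def P_def by (simp add: mult_ac)
    finally show "norm (f (x + r *\<^sub>R (p + s *\<^sub>R ?e)) - L *v (r *\<^sub>R (p + s *\<^sub>R ?e)) - (f (x + r *\<^sub>R p) - L *v (r *\<^sub>R p)))
        \<le> osc_const TYPE('n) * \<kappa> * r" .
  qed
  moreover have "(\<lambda>y. x + r *\<^sub>R y) ` grid_box \<subseteq> \<Omega>"
    using grid_in inQ Q unfolding b_def[symmetric] by blast
  ultimately show ?thesis using that by blast
qed

section \<open>Blow-up at a Lebesgue point\<close>

lemma eventually_at_right_0_iff:
  "(\<forall>\<^sub>F h in at_right (0::real). P h) \<longleftrightarrow> (\<exists>d>0. \<forall>h. 0 < h \<and> h < d \<longrightarrow> P h)"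
  by (auto simp: eventually_at_right_field)

lemma cube_subset_cball:
  fixes x :: "real^'n"
  assumes "h \<ge> 0"
  shows "cbox x (x + h *\<^sub>R One) \<subseteq> cball x (h * real CARD('n))"
proof
  fix z assume "z \<in> cbox x (x + h *\<^sub>R One)"
  then have "z \<in> cbox (x + 0 *\<^sub>R One) (x + h *\<^sub>R One)" by simp
  then have z: "\<bar>(z - x) $ i\<bar> \<le> h" for i
    unfolding mem_cube_iff by (auto simp: abs_le_iff algebra_simps dest: spec[of _ i])
  have "norm (z - x) \<le> (\<Sum>i\<in>(UNIV :: 'n set). h)"
    by (rule order_trans[OF norm_le_l1_cart sum_mono[OF z]])
  then show "z \<in> cball x (h * real CARD('n))" by (simp add: dist_norm norm_minus_commute mult.commute)
qed

text \<open>A cube of side \<open>h\<close> with corner \<open>x\<close> lies in the ball of radius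
  \<open>h * CARD('n)\<close> around \<open>x\<close>. The density theorem for balls is therefore
  used with \<open>e\<close> divided by \<open>CARD('n) ^ CARD('n)\<close>.\<close>

lemma singular_jordan_density_zero:
  fixes \<nu> :: "(real^'n) set \<Rightarrow> real"
  assumes \<Omega>: "open \<Omega>" and \<nu>: "vector_measure \<Omega> \<nu>" and N: "N \<in> borel_subsets \<Omega>" "emeasure lborel N = 0"
    and null: "\<And>B. B \<in> borel_subsets (\<Omega> - N) \<Longrightarrow> \<nu> B = 0"
  shows "\<exists>E. negligible E \<and> (\<forall>x. x \<notin> E \<longrightarrow> (\<forall>e>0. \<forall>\<^sub>F h in at_right 0.
    cbox x (x + h *\<^sub>R One) \<subseteq> \<Omega> \<longrightarrow> emeasure (jordan_pos \<Omega> \<nu>) (cbox x (x + h *\<^sub>R One)) \<le> ennreal (e * h ^ CARD('n))))"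
proof -
  have \<Omega>b: "\<Omega> \<in> sets borel" using \<Omega> by auto
  have Nb: "N \<in> sets borel" "N \<subseteq> \<Omega>" using N(1) by (auto simp: borel_subsets_def)
  note R = nn_integral_restrict_borel[OF \<Omega>b sets_jordan_pos[OF \<nu> \<Omega>b] finite_measure_jordan_pos[OF \<nu> \<Omega>b]]
  define \<sigma> where "\<sigma> = distr (jordan_pos \<Omega> \<nu>) borel (\<lambda>x. x)"
  have z: "(\<lambda>_. 0) \<in> borel_measurable borel" by simp
  have fin: "finite_measure \<sigma>" and sets: "sets \<sigma> = sets borel"
    unfolding \<sigma>_def using R(3)[of "{}", OF _ _ z] R(4)[of "{}", OF _ _ z] by auto
  have eq: "emeasure \<sigma> Q = emeasure (jordan_pos \<Omega> \<nu>) Q" if "Q \<in> sets borel" "Q \<subseteq> \<Omega>" for Q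
    unfolding \<sigma>_def by (rule R(2)[OF that z])
  have "emeasure \<sigma> (- N) = 0"
  proof -
    have id: "(\<lambda>x. x) \<in> measurable (jordan_pos \<Omega> \<nu>) borel"
      using measurable_restrict_space1[of "\<lambda>x. x" borel borel \<Omega>] borel_subsets_eq_sets[OF \<Omega>b] sets_jordan_pos[OF \<nu> \<Omega>b]
        measurable_cong_sets[of "jordan_pos \<Omega> \<nu>" "restrict_space borel \<Omega>" borel borel] by auto
    have "emeasure \<sigma> (- N) = emeasure (jordan_pos \<Omega> \<nu>) (- N \<inter> \<Omega>)"
      unfolding \<sigma>_def using emeasure_distr[OF id, of "- N"] Nb space_jordan_pos[OF \<nu> \<Omega>b] by simp
    also have "- N \<inter> \<Omega> = \<Omega> - N" by auto
    also have "emeasure (jordan_pos \<Omega> \<nu>) (\<Omega> - N) = pos_part \<nu> (\<Omega> - N)"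
      by (rule emeasure_jordan_pos[OF \<nu> \<Omega>b]) (use \<Omega>b Nb in \<open>auto simp: borel_subsets_def\<close>)
    also have "\<dots> = 0" unfolding pos_part_def using null by (auto simp: bot_ennreal intro!: antisym SUP_least)
    finally show ?thesis .
  qed
  moreover have "negligible N"
    using N(2) Nb by (simp add: negligible_iff_null_sets null_sets_def emeasure_completion)
  ultimately obtain E where E: "negligible E" "\<And>x e. x \<notin> E \<Longrightarrow> e > 0 \<Longrightarrow>
      \<exists>d>0. \<forall>h. 0 < h \<and> h < d \<longrightarrow> measure \<sigma> (cball x h) \<le> e * h ^ DIM(real^'n)"
    using singular_density_zero[OF sets fin Nb(1)] by blast
  have "\<forall>\<^sub>F h in at_right 0. cbox x (x + h *\<^sub>R One) \<subseteq> \<Omega> \<longrightarrow>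
      emeasure (jordan_pos \<Omega> \<nu>) (cbox x (x + h *\<^sub>R One)) \<le> ennreal (e * h ^ CARD('n))"
    if x: "x \<notin> E" and e: "e > 0" for x e
  proof -
    define n where "n = real CARD('n)"
    have n: "n > 0" by (simp add: n_def)
    obtain d where d: "d > 0" "\<And>h. 0 < h \<Longrightarrow> h < d \<Longrightarrow> measure \<sigma> (cball x h) \<le> (e / n ^ CARD('n)) * h ^ CARD('n)"
      using E(2)[OF x, of "e / n ^ CARD('n)"] e n by auto
    have "emeasure (jordan_pos \<Omega> \<nu>) (cbox x (x + h *\<^sub>R One)) \<le> ennreal (e * h ^ CARD('n))"
      if h: "0 < h" "h < d / n" and sub: "cbox x (x + h *\<^sub>R One) \<subseteq> \<Omega>" for h
    proof -
      have "emeasure (jordan_pos \<Omega> \<nu>) (cbox x (x + h *\<^sub>R One)) = emeasure \<sigma> (cbox x (x + h *\<^sub>R One))"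
        using eq[OF _ sub] by simp
      also have "\<dots> \<le> emeasure \<sigma> (cball x (h * n))"
        using cube_subset_cball[of h x] h(1) by (intro emeasure_mono) (auto simp: n_def sets)
      also have "\<dots> = ennreal (measure \<sigma> (cball x (h * n)))" by (rule finite_measure.emeasure_eq_measure[OF fin])
      also have "\<dots> \<le> ennreal ((e / n ^ CARD('n)) * (h * n) ^ CARD('n))"
        using h n by (intro ennreal_leI d(2)) (auto simp: pos_less_divide_eq)
      also have "(e / n ^ CARD('n)) * (h * n) ^ CARD('n) = e * h ^ CARD('n)"
        using n by (simp add: power_mult_distrib)
      finally show ?thesis .
    qed
    then show ?thesis unfolding eventually_at_right_0_iff using d(1) n by (intro exI[of _ "d / n"]) auto
  qed
  then show ?thesis using E(1) by blast
qed

text \<open>An entry of \<open>G\<close> is extended by zero to the whole space, which changes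
  nothing on cubes inside \<open>\<Omega>\<close>.\<close>

lemma gradient_Lebesgue_point:
  fixes G :: "real^'n \<Rightarrow> real^'n^'m"
  assumes G: "G absolutely_integrable_on \<Omega>"
  shows "\<exists>E. negligible E \<and> (\<forall>x\<in>\<Omega> - E. \<forall>e>0. \<forall>\<^sub>F h in at_right 0.
    cbox x (x + h *\<^sub>R One) \<subseteq> \<Omega> \<longrightarrow>
    integral (cbox x (x + h *\<^sub>R One)) (\<lambda>z. \<bar>G z $ i $ j - G x $ i $ j\<bar>) \<le> e * h ^ CARD('n))"
proof -
  define g where "g x = (if x \<in> \<Omega> then G x $ i $ j else 0)" for x
  have "g absolutely_integrable_on UNIV"
    unfolding g_def absolutely_integrable_restrict_UNIV
    by (rule set_integrable_bounded_linear(1)[OF bounded_linear_entry G])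
  from Lebesgue_point_cbox[OF this] obtain E where E: "negligible E \<and> (\<forall>x. x \<notin> E \<longrightarrow>
      (\<forall>e>0. \<exists>d>0. \<forall>h. 0 < h \<and> h < d \<longrightarrow>
       integral (cbox x (x + h *\<^sub>R One)) (\<lambda>z. \<bar>g z - g x\<bar>) \<le> e * h ^ DIM(real^'n)))" ..
  have eq: "integral (cbox x (x + h *\<^sub>R One)) (\<lambda>z. \<bar>g z - g x\<bar>) = integral (cbox x (x + h *\<^sub>R One)) (\<lambda>z. \<bar>G z $ i $ j - G x $ i $ j\<bar>)"
    if "x \<in> \<Omega>" "cbox x (x + h *\<^sub>R One) \<subseteq> \<Omega>" for x h
    using that by (intro integral_cong) (auto simp: g_def)
  have "\<forall>\<^sub>F h in at_right 0. cbox x (x + h *\<^sub>R One) \<subseteq> \<Omega> \<longrightarrow>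
    integral (cbox x (x + h *\<^sub>R One)) (\<lambda>z. \<bar>G z $ i $ j - G x $ i $ j\<bar>) \<le> e * h ^ CARD('n)"
    if x: "x \<in> \<Omega> - E" and e: "e > 0" for x e
  proof -
    have "\<forall>\<^sub>F h in at_right 0. integral (cbox x (x + h *\<^sub>R One)) (\<lambda>z. \<bar>g z - g x\<bar>) \<le> e * h ^ CARD('n)"
      unfolding eventually_at_right_0_iff using E x e by simp
    then show ?thesis by eventually_elim (use eq x in auto)
  qed
  then show ?thesis using E by blast
qed

theorem theorem1p1:
  fixes \<Omega> :: "(real^'n) set" and f :: "real^'n \<Rightarrow> real^'n"
    and G :: "real^'n \<Rightarrow> real^'n^'n"
  assumes "CARD('n) = 2 \<or> CARD('n) = 3"
    and "open \<Omega>" and "connected \<Omega>" and "\<Omega> \<noteq> {}"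
    and "f \<in> BV \<Omega>"
    and "\<exists>g. homeomorphism \<Omega> (f ` \<Omega>) f g"
    and "sense_preserving \<Omega> f"
    and "BV_gradient \<Omega> f G"
  shows "AE x\<^sub>0 in lebesgue_on \<Omega>. det (G x\<^sub>0) \<ge> 0"
proof -
  note \<Omega> = \<open>open \<Omega>\<close>
  have f: "continuous_on \<Omega> f" "inj_on f \<Omega>"
    using assms(6) by (auto simp: homeomorphism_def intro: inj_on_inverseI)
  obtain \<mu> \<mu>s where G: "G absolutely_integrable_on \<Omega>" and D: "distributional_derivative \<Omega> f \<mu>"
    and sing: "singular_measure \<Omega> \<mu>s" and dec: "\<And>B. B \<in> borel_subsets \<Omega> \<Longrightarrow> \<mu> B = (LINT x:B|lebesgue. G x) + \<mu>s B"
    using assms(8) unfolding BV_gradient_def by blast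
  have \<mu>s: "vector_measure \<Omega> \<mu>s" using sing by (simp add: singular_measure_def)
  obtain N where N: "N \<in> borel_subsets \<Omega>" "emeasure lborel N = 0" "\<And>B. B \<in> borel_subsets (\<Omega> - N) \<Longrightarrow> \<mu>s B = 0"
    using sing unfolding singular_measure_def by blast
  let ?Q = "\<lambda>x h. cbox x (x + h *\<^sub>R One)"
  define J where "J i j = jordan_pos \<Omega> (\<lambda>B. \<mu>s B $ i $ j)" for i j
  define J' where "J' i j = jordan_pos \<Omega> (\<lambda>B. - (\<mu>s B $ i $ j))" for i j
  note \<mu>s_entry = vector_measure_entry[OF \<mu>s]
  have "\<exists>E. negligible E \<and> (\<forall>x\<in>\<Omega> - E. \<forall>e>0. \<forall>\<^sub>F h in at_right 0. ?Q x h \<subseteq> \<Omega> \<longrightarrow>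
      integral (?Q x h) (\<lambda>z. \<bar>G z $ i $ j - G x $ i $ j\<bar>) \<le> e * h ^ CARD('n)
      \<and> emeasure (J i j) (?Q x h) \<le> ennreal (e * h ^ CARD('n)) \<and> emeasure (J' i j) (?Q x h) \<le> ennreal (e * h ^ CARD('n)))"
    for i j
  proof -
    obtain E1 where E1: "negligible E1" "\<And>x e. x \<in> \<Omega> - E1 \<Longrightarrow> e > 0 \<Longrightarrow> \<forall>\<^sub>F h in at_right 0. ?Q x h \<subseteq> \<Omega> \<longrightarrow>
        integral (?Q x h) (\<lambda>z. \<bar>G z $ i $ j - G x $ i $ j\<bar>) \<le> e * h ^ CARD('n)"
      using gradient_Lebesgue_point[OF G, of i j] by blast
    have "\<mu>s B $ i $ j = 0" if "B \<in> borel_subsets (\<Omega> - N)" for B using N(3)[OF that] by simp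
    then obtain E2 where E2: "negligible E2" "\<And>x e. x \<notin> E2 \<Longrightarrow> e > 0 \<Longrightarrow> \<forall>\<^sub>F h in at_right 0. ?Q x h \<subseteq> \<Omega> \<longrightarrow>
        emeasure (J i j) (?Q x h) \<le> ennreal (e * h ^ CARD('n))"
      using singular_jordan_density_zero[OF \<Omega> \<mu>s_entry N(1,2), of i j] unfolding J_def by blast
    have "- (\<mu>s B $ i $ j) = 0" if "B \<in> borel_subsets (\<Omega> - N)" for B using N(3)[OF that] by simp
    then obtain E3 where E3: "negligible E3" "\<And>x e. x \<notin> E3 \<Longrightarrow> e > 0 \<Longrightarrow> \<forall>\<^sub>F h in at_right 0. ?Q x h \<subseteq> \<Omega> \<longrightarrow>
        emeasure (J' i j) (?Q x h) \<le> ennreal (e * h ^ CARD('n))"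
      using singular_jordan_density_zero[OF \<Omega> vector_measure_uminus[OF \<mu>s_entry] N(1,2), of i j] unfolding J'_def by blast
    show ?thesis
    proof (intro exI[of _ "E1 \<union> E2 \<union> E3"] conjI ballI allI impI)
      show "negligible (E1 \<union> E2 \<union> E3)" using E1 E2 E3 by (intro negligible_Un)
      fix x e assume x: "x \<in> \<Omega> - (E1 \<union> E2 \<union> E3)" and e: "e > (0::real)"
      have "x \<in> \<Omega> - E1" "x \<notin> E2" "x \<notin> E3" using x by auto
      from E1(2)[OF this(1) e] E2(2)[OF this(2) e] E3(2)[OF this(3) e]
      show "\<forall>\<^sub>F h in at_right 0. ?Q x h \<subseteq> \<Omega> \<longrightarrow>
        integral (?Q x h) (\<lambda>z. \<bar>G z $ i $ j - G x $ i $ j\<bar>) \<le> e * h ^ CARD('n)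
        \<and> emeasure (J i j) (?Q x h) \<le> ennreal (e * h ^ CARD('n)) \<and> emeasure (J' i j) (?Q x h) \<le> ennreal (e * h ^ CARD('n))"
        by eventually_elim blast
    qed
  qed
  \<comment> \<open>Pairing the two indices lets one application of \<open>choice\<close> supply the
    exceptional sets of all finitely many entries.\<close>
  then have "\<forall>ij. \<exists>E. negligible E \<and> (\<forall>x\<in>\<Omega> - E. \<forall>e>0. \<forall>\<^sub>F h in at_right 0. ?Q x h \<subseteq> \<Omega> \<longrightarrow>
      integral (?Q x h) (\<lambda>z. \<bar>G z $ fst ij $ snd ij - G x $ fst ij $ snd ij\<bar>) \<le> e * h ^ CARD('n)
      \<and> emeasure (J (fst ij) (snd ij)) (?Q x h) \<le> ennreal (e * h ^ CARD('n))
      \<and> emeasure (J' (fst ij) (snd ij)) (?Q x h) \<le> ennreal (e * h ^ CARD('n)))" by (intro allI)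
  from choice[OF this] obtain E where E: "\<forall>ij. negligible (E ij) \<and> (\<forall>x\<in>\<Omega> - E ij. \<forall>e>0. \<forall>\<^sub>F h in at_right 0. ?Q x h \<subseteq> \<Omega> \<longrightarrow>
      integral (?Q x h) (\<lambda>z. \<bar>G z $ fst ij $ snd ij - G x $ fst ij $ snd ij\<bar>) \<le> e * h ^ CARD('n)
      \<and> emeasure (J (fst ij) (snd ij)) (?Q x h) \<le> ennreal (e * h ^ CARD('n))
      \<and> emeasure (J' (fst ij) (snd ij)) (?Q x h) \<le> ennreal (e * h ^ CARD('n)))" ..
  define E' where "E' = (\<Union>ij\<in>UNIV. E ij)"
  have negE: "negligible E'"
    unfolding E'_def by (rule negligible_Union) (use E in auto)
  have main: "det (G x) \<ge> 0" if x: "x \<in> \<Omega> - E'" for x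
  proof (cases "det (G x) = 0")
    case False
    \<comment> \<open>The sign of the determinant is not assumed: a nonzero determinant suffices for
      the lattice argument, which yields strict positivity.\<close>
    obtain \<eta> where \<eta>: "\<eta> > 0" "\<And>x' r. r > 0 \<Longrightarrow> (\<lambda>y. x' + r *\<^sub>R y) ` grid_box \<subseteq> \<Omega> \<Longrightarrow>
        grid_oscillation (\<lambda>y. f (x' + r *\<^sub>R y) - G x *v (r *\<^sub>R y)) (\<eta> * r) \<Longrightarrow> det (G x) > 0"
      using det_pos_of_grid_oscillation[OF assms(1) False] assms(7) f by blast
    define C where "C = osc_const TYPE('n)"
    have C: "C > 0" unfolding C_def osc_const_def by (intro mult_pos_pos add_nonneg_pos) auto
    \<comment> \<open>Chosen so that the oscillation bound
      \<open>osc_const TYPE('n) * \<kappa> * r\<close> is exactly the threshold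
      \<open>\<eta> * r\<close>.\<close>
    define \<kappa> where "\<kappa> = \<eta> / C"
    have \<kappa>: "\<kappa> > 0" using \<eta>(1) C by (simp add: \<kappa>_def)
    \<comment> \<open>Three terms of size \<open>e * h ^ CARD('n)\<close> with
      \<open>h = 6 * r\<close> add up to \<open>\<kappa> * r ^ CARD('n)\<close>.\<close>
    define e where "e = \<kappa> / (3 * 6 ^ CARD('n))"
    have e: "e > 0" using \<kappa> by (simp add: e_def)
    have "\<forall>\<^sub>F h in at_right 0. \<forall>ij. ?Q x h \<subseteq> \<Omega> \<longrightarrow>
      integral (?Q x h) (\<lambda>z. \<bar>G z $ fst ij $ snd ij - G x $ fst ij $ snd ij\<bar>) \<le> e * h ^ CARD('n)
      \<and> emeasure (J (fst ij) (snd ij)) (?Q x h) \<le> ennreal (e * h ^ CARD('n))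
      \<and> emeasure (J' (fst ij) (snd ij)) (?Q x h) \<le> ennreal (e * h ^ CARD('n))"
      using E x e by (intro eventually_all_finite) (auto simp: E'_def)
    then obtain d where d: "d > 0" "\<And>h ij. 0 < h \<Longrightarrow> h < d \<Longrightarrow> ?Q x h \<subseteq> \<Omega> \<Longrightarrow>
      integral (?Q x h) (\<lambda>z. \<bar>G z $ fst ij $ snd ij - G x $ fst ij $ snd ij\<bar>) \<le> e * h ^ CARD('n)
      \<and> emeasure (J (fst ij) (snd ij)) (?Q x h) \<le> ennreal (e * h ^ CARD('n))
      \<and> emeasure (J' (fst ij) (snd ij)) (?Q x h) \<le> ennreal (e * h ^ CARD('n))"
      unfolding eventually_at_right_0_iff by blast
    obtain \<rho> where \<rho>: "\<rho> > 0" "cball x \<rho> \<subseteq> \<Omega>" using \<Omega> x open_contains_cball by (metis DiffD1)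
    \<comment> \<open>\<open>d / 2\<close> ensures \<open>h < d\<close>, and the other bound keeps
      the cube inside the ball of radius \<open>\<rho>\<close> around \<open>x\<close>, hence inside
      \<open>\<Omega>\<close>.\<close>
    define h where "h = min (d / 2) (\<rho> / real CARD('n))"
    have h: "0 < h" "h < d" using d(1) \<rho>(1) by (auto simp: h_def)
    have "h * real CARD('n) \<le> \<rho>"
    proof -
      have "h \<le> \<rho> / real CARD('n)" by (simp add: h_def)
      then show ?thesis by (simp add: pos_le_divide_eq)
    qed
    then have Qs: "?Q x h \<subseteq> \<Omega>" using cube_subset_cball[of h x] h(1) \<rho>(2) subset_cball[of "h * real CARD('n)" \<rho> x] by auto
    define r where "r = h / 6"
    have r: "r > 0" and hr: "6 * r = h" using h by (auto simp: r_def)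
    have bound: "ennreal (integral (?Q x (6 * r)) (\<lambda>z. \<bar>G z $ i $ j - G x $ i $ j\<bar>))
      + emeasure (jordan_pos \<Omega> (\<lambda>B. \<mu>s B $ i $ j)) (?Q x (6 * r))
      + emeasure (jordan_pos \<Omega> (\<lambda>B. - (\<mu>s B $ i $ j))) (?Q x (6 * r)) \<le> ennreal (\<kappa> * r ^ CARD('n))" for i j
    proof -
      have eh: "e * h ^ CARD('n) \<ge> 0" using e h by simp
      note dd = d(2)[OF h Qs, of "(i, j)", unfolded fst_conv snd_conv J_def J'_def]
      have "ennreal (integral (?Q x h) (\<lambda>z. \<bar>G z $ i $ j - G x $ i $ j\<bar>))
        + emeasure (jordan_pos \<Omega> (\<lambda>B. \<mu>s B $ i $ j)) (?Q x h)
        + emeasure (jordan_pos \<Omega> (\<lambda>B. - (\<mu>s B $ i $ j))) (?Q x h)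
        \<le> ennreal (e * h ^ CARD('n)) + ennreal (e * h ^ CARD('n)) + ennreal (e * h ^ CARD('n))"
        using dd by (intro add_mono ennreal_leI) auto
      also have "\<dots> = ennreal (3 * (e * h ^ CARD('n)))"
        using eh by (simp add: ennreal_plus[symmetric] del: ennreal_plus)
      also have "3 * (e * h ^ CARD('n)) = \<kappa> * r ^ CARD('n)"
        by (simp add: e_def hr[symmetric] power_mult_distrib)
      finally show ?thesis unfolding hr .
    qed
    obtain x' where x': "(\<lambda>y. x' + r *\<^sub>R y) ` grid_box \<subseteq> \<Omega>"
      "grid_oscillation (\<lambda>y. f (x' + r *\<^sub>R y) - G x *v (r *\<^sub>R y)) (osc_const TYPE('n) * \<kappa> * r)"
      by (rule grid_oscillation_exists[OF \<Omega> D \<mu>s G dec f(1) r \<kappa> Qs[folded hr] bound])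
    have "osc_const TYPE('n) * \<kappa> * r = \<eta> * r" using C by (simp add: \<kappa>_def C_def)
    then have "det (G x) > 0" using \<eta>(2)[OF r x'(1)] x'(2) by (simp only:)
    then show ?thesis by simp
  qed simp
  have "AE x in lebesgue. x \<notin> E'" using negE by (simp add: negligible_iff_null_sets AE_not_in)
  then have "AE x in lebesgue. x \<in> \<Omega> \<longrightarrow> det (G x) \<ge> 0"
    by eventually_elim (use main in auto)
  moreover have "\<Omega> \<in> sets lebesgue" using \<Omega> by auto
  ultimately show ?thesis by (simp add: AE_restrict_space_iff)
qed

end
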